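(* Let $A$ and $D$ be real symmetric and semi-positive definite $N\times N$ matrices with constant elements, let $p\geqslant 1$ and let $C_p$ be the $(N-p)\times N$ matrix of synchronization by $p$-groups defined in the context. Assume that $A$ satisfies the condition of $C_p$-compatibility $A\operatorname{Ker}(C_p)\subseteq\operatorname{Ker}(C_p)$, and that $D$ satisfies the condition of strong $C_p$-compatibility in the form $$D=C_p^TRC_p$$ with $R$ a symmetric and semi-positive definite matrix of order $N-p$ such that $\operatorname{rank}(R)=N-p$. Assume furthermore that the scalar equation $$u''+Lu+gu'=0$$ is uniformly stable in the space $V\times H$. Then the system $$U''+\mathcal LU+AU+D\mathcal GU'=0$$ is uniformly synchronizable by $p$-groups in $(V\times H)^N$.
   Context: $H$ and $V$ are real Hilbert spaces with $V\subset H\subset V'$, where $V'$ is the dual of $V$, $H$ is identified with its dual, and the embeddings are dense and compact. $L:V\to V'$ is the duality mapping, $\langle Lu,\phi\rangle_{V',V}=(u,\phi)_V$. $g:V\to V'$ is a linear continuous symmetric operator with $\langle gv,v\rangle_{V',V}\geqslant 0$ for all $v\in V$. With $I$ the identity of $\mathbb R^N$, $\mathcal L=LI$ and $\mathcal G=gI$ act componentwise on $V^N$; matrices act on the $\mathbb R^N$-index. The solution with initial data $(U_0,U_1)\in(V\times H)^N$ is the weak (mild) solution $U\in C^0(\mathbb R^+,V^N)\cap C^1(\mathbb R^+,H^N)$ given by the $C_0$-semigroup on $(V\times H)^N$ whose generator is $(U,Z)\mapsto (Z,-\mathcal LU-AU-D\mathcal GZ)$ with domain $\{(U,Z)\in V^N\times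 V^N:\ \mathcal LU+AU+D\mathcal GZ\in H^N\}$; solutions of the scalar equation are understood in the same way (case $N=1$, $A=0$, $D=1$). The scalar equation is uniformly stable in $V\times H$ if there exist $M\geqslant1$, $\omega>0$ such that $\|(u(t),u'(t))\|_{V\times H}\leqslant Me^{-\omega t}\|(u_0,u_1)\|_{V\times H}$, $t\geqslant0$, for all initial data $(u_0,u_1)\in V\times H$. Groups: integers $0=n_0<n_1<\dots<n_p=N$ with $n_r-n_{r-1}\geqslant 2$ for $1\leqslant r\leqslant p$ are fixed. $S_r$ is the $(n_r-n_{r-1}-1)\times(n_r-n_{r-1})$ matrix whose $i$-th row has $1$ in column $i$, $-1$ in column $i+1$, and $0$ elsewhere; $C_p=\operatorname{diag}(S_1,\dots,S_p)$ (block diagonal), of order $(N-p)\times N$. Uniform synchronizability by $p$-groups: there exist constants $M\geqslant 1$, $\omega>0$ such that for every $(U_0,U_1)\in(V\times H)^N$ the corresponding solution satisfies $$\|C_p(U(t),U'(t))\|_{(V\times H)^{N-p}}\leqslant Me^{-\omega t}\|C_p(U_0,U_1)\|_{(V\times H)^{N-p}},\quad t\geqslant 0,$$ where $C_p(U,U')=(C_pU,C_pU')$. *)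

theory Defs
  imports "HOL-Analysis.Analysis"
begin

section \<open>The triple V, H, V'\<close>

text \<open>V and H are types; the inclusion of V in H is an injective bounded linear map j.
  The dual V' is \<open>'v \<Rightarrow>\<^sub>L real\<close>, and H, identified with its own dual, is mapped into V' by
  sending h to the functional v \<open>\<mapsto>\<close> (h, j v).\<close>

definition dense_compact_embedding ::
    "('a::real_normed_vector \<Rightarrow>\<^sub>L 'b::real_normed_vector) \<Rightarrow> bool" where
  "dense_compact_embedding f \<longleftrightarrow>
     inj (blinfun_apply f) \<and> closure (range (blinfun_apply f)) = UNIV \<and>
     (\<forall>S. bounded S \<longrightarrow> compact (closure (blinfun_apply f ` S)))"

definition H_to_dual ::
    "('v::real_inner \<Rightarrow>\<^sub>L 'h::real_inner) \<Rightarrow> 'h \<Rightarrow> 'v \<Rightarrow>\<^sub>L real" where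
  "H_to_dual j h = blinfun_inner_left h o\<^sub>L j"

lemma bounded_linear_H_to_dual: "bounded_linear (H_to_dual j)"
  unfolding H_to_dual_def
  by (rule bounded_bilinear.bounded_linear_left[OF bounded_bilinear_blinfun_compose,
        THEN bounded_linear_compose, OF bounded_linear_blinfun_inner_left])

text \<open>The second clause is about the embedding of H in V', packed as a bounded linear map.\<close>

definition hilbert_triple ::
    "('v::{real_inner,banach} \<Rightarrow>\<^sub>L 'h::{real_inner,banach}) \<Rightarrow> bool" where
  "hilbert_triple j \<longleftrightarrow>
     dense_compact_embedding j \<and> dense_compact_embedding (Blinfun (H_to_dual j))"

definition duality_map :: "'v::real_inner \<Rightarrow> 'v \<Rightarrow>\<^sub>L real" where
  "duality_map u = blinfun_inner_left u"

definition symmetric_nonneg_op ::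
    "('v::real_normed_vector \<Rightarrow>\<^sub>L 'v \<Rightarrow>\<^sub>L real) \<Rightarrow> bool" where
  "symmetric_nonneg_op g \<longleftrightarrow>
     (\<forall>u v. blinfun_apply (blinfun_apply g u) v = blinfun_apply (blinfun_apply g v) u) \<and>
     (\<forall>v. 0 \<le> blinfun_apply (blinfun_apply g v) v)"


section \<open>Matrices\<close>

text \<open>A real matrix acting on tuples of vectors through the tuple index (\<open>*v\<close> does not apply,
  since entries and components have different types).\<close>

definition mat_act :: "real^'k^'l \<Rightarrow> 'a::real_vector^'k \<Rightarrow> 'a^'l" where
  "mat_act B U = (\<chi> i. \<Sum>k\<in>UNIV. B $ i $ k *\<^sub>R U $ k)"

definition componentwise :: "('a \<Rightarrow> 'b) \<Rightarrow> 'a^'k \<Rightarrow> 'b^'k" where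
  "componentwise f U = (\<chi> i. f (U $ i))"

definition symmetric_psd :: "real^'k^'k \<Rightarrow> bool" where
  "symmetric_psd B \<longleftrightarrow> transpose B = B \<and> (\<forall>x. 0 \<le> x \<bullet> (B *v x))"

definition matrix_ker :: "real^'k^'l \<Rightarrow> (real^'k) set" where
  "matrix_ker B = {x. B *v x = 0}"


section \<open>Semigroups and mild solutions\<close>

definition C0_semigroup :: "(real \<Rightarrow> 'a::banach \<Rightarrow>\<^sub>L 'a) \<Rightarrow> bool" where
  "C0_semigroup T \<longleftrightarrow>
     T 0 = id_blinfun \<and>
     (\<forall>s\<ge>0. \<forall>t\<ge>0. T (s + t) = T s o\<^sub>L T t) \<and>
     (\<forall>x. ((\<lambda>t. blinfun_apply (T t) x) \<longlongrightarrow> x) (at_right 0))"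

text \<open>Unbounded operators are given by their graphs.\<close>

definition generator :: "(real \<Rightarrow> 'a::banach \<Rightarrow>\<^sub>L 'a) \<Rightarrow> ('a \<times> 'a) set" where
  "generator T =
     {(x, y). ((\<lambda>t. (blinfun_apply (T t) x - x) /\<^sub>R t) \<longlongrightarrow> y) (at_right 0)}"

text \<open>The operator (U, Z) \<open>\<mapsto>\<close> (Z, - (LU + AU + DGZ)). Its domain asks for U, Z in \<open>V\<^sup>N\<close> such that
  the sum LU + AU + DGZ, formed in \<open>V'\<^sup>N\<close>, is (the image of) an element F of \<open>H\<^sup>N\<close>.
  The state space is \<open>V\<^sup>N \<times> H\<^sup>N\<close>, isometric to \<open>(V \<times> H)\<^sup>N\<close>.\<close>

definition wave_operator ::
    "('v::{real_inner,banach} \<Rightarrow>\<^sub>L 'h::{real_inner,banach}) \<Rightarrow> ('v \<Rightarrow>\<^sub>L 'v \<Rightarrow>\<^sub>L real) \<Rightarrow>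
     real^'n^'n \<Rightarrow> real^'n^'n \<Rightarrow> ((('v^'n) \<times> ('h^'n)) \<times> (('v^'n) \<times> ('h^'n))) set" where
  "wave_operator j g A D =
     {((U, componentwise (blinfun_apply j) Z), (Z, - F)) | U Z F.
        componentwise duality_map U
        + mat_act A (componentwise (\<lambda>u. H_to_dual j (blinfun_apply j u)) U)
        + mat_act D (componentwise (blinfun_apply g) Z)
        = componentwise (H_to_dual j) F}"

text \<open>U is the mild solution, with time derivative U', for the initial data \<open>(U\<^sub>0, U\<^sub>1)\<close>.
  A semigroup is determined by its generator, so U and U' are unique on \<open>t \<ge> 0\<close>.\<close>

definition mild_solution ::
    "('v::{real_inner,banach} \<Rightarrow>\<^sub>L 'h::{real_inner,banach}) \<Rightarrow> ('v \<Rightarrow>\<^sub>L 'v \<Rightarrow>\<^sub>L real) \<Rightarrow>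
     real^'n^'n \<Rightarrow> real^'n^'n \<Rightarrow> 'v^'n \<Rightarrow> 'h^'n \<Rightarrow>
     (real \<Rightarrow> 'v^'n) \<Rightarrow> (real \<Rightarrow> 'h^'n) \<Rightarrow> bool" where
  "mild_solution j g A D U0 U1 U U' \<longleftrightarrow>
     (\<exists>T. C0_semigroup T \<and> generator T = wave_operator j g A D \<and>
          (\<forall>t\<ge>0. (U t, U' t) = blinfun_apply (T t) (U0, U1))) \<and>
     continuous_on {0..} U \<and>
     (\<forall>t\<ge>0. ((\<lambda>s. componentwise (blinfun_apply j) (U s)) has_vector_derivative U' t)
              (at t within {0..})) \<and>
     continuous_on {0..} U'"

text \<open>The scalar equation is the case N = 1, A = 0, D = 1.\<close>

definition scalar_mild_solution ::
    "('v::{real_inner,banach} \<Rightarrow>\<^sub>L 'h::{real_inner,banach}) \<Rightarrow> ('v \<Rightarrow>\<^sub>L 'v \<Rightarrow>\<^sub>L real) \<Rightarrow>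
     'v \<Rightarrow> 'h \<Rightarrow> (real \<Rightarrow> 'v) \<Rightarrow> (real \<Rightarrow> 'h) \<Rightarrow> bool" where
  "scalar_mild_solution j g u0 u1 u u' \<longleftrightarrow>
     mild_solution j g (0 :: real^1^1) (mat 1) (vec u0) (vec u1)
       (\<lambda>t. vec (u t)) (\<lambda>t. vec (u' t))"


section \<open>Stability and synchronization\<close>

text \<open>In both notions the existence of the solution is part of the assertion, so that neither
  can hold vacuously.\<close>

definition uniformly_stable ::
    "('v::{real_inner,banach} \<Rightarrow>\<^sub>L 'h::{real_inner,banach}) \<Rightarrow> ('v \<Rightarrow>\<^sub>L 'v \<Rightarrow>\<^sub>L real) \<Rightarrow> bool" where
  "uniformly_stable j g \<longleftrightarrow>
     (\<exists>M \<omega>. 1 \<le> M \<and> 0 < \<omega> \<and>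
        (\<forall>u0 u1. \<exists>u u'. scalar_mild_solution j g u0 u1 u u' \<and>
           (\<forall>t\<ge>0. norm (u t, u' t) \<le> M * exp (- \<omega> * t) * norm (u0, u1))))"

definition uniformly_synchronizable ::
    "('v::{real_inner,banach} \<Rightarrow>\<^sub>L 'h::{real_inner,banach}) \<Rightarrow> ('v \<Rightarrow>\<^sub>L 'v \<Rightarrow>\<^sub>L real) \<Rightarrow>
     real^'n^'n \<Rightarrow> real^'n^'n \<Rightarrow> real^'n^'m \<Rightarrow> bool" where
  "uniformly_synchronizable j g A D C \<longleftrightarrow>
     (\<exists>M \<omega>. 1 \<le> M \<and> 0 < \<omega> \<and>
        (\<forall>U0 U1. \<exists>U U'. mild_solution j g A D U0 U1 U U' \<and>
           (\<forall>t\<ge>0. norm (mat_act C (U t), mat_act C (U' t))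
                  \<le> M * exp (- \<omega> * t) * norm (mat_act C U0, mat_act C U1))))"

text \<open>Groups \<open>0 = n 0 < n 1 < \<dots> < n p = N\<close>, each of size at least 2.\<close>

definition group_division :: "nat \<Rightarrow> (nat \<Rightarrow> nat) \<Rightarrow> nat \<Rightarrow> bool" where
  "group_division p n N \<longleftrightarrow> n 0 = 0 \<and> n p = N \<and> (\<forall>r\<in>{1..p}. n (r - 1) + 2 \<le> n r)"

text \<open>Rows and columns are counted from 1, in the order of the (linearly ordered) index type.\<close>

definition index_pos :: "'k::{finite,linorder} \<Rightarrow> nat" where
  "index_pos i = card {k. k \<le> i}"

definition S_entry :: "nat \<Rightarrow> nat \<Rightarrow> real" where
  "S_entry i k = (if k = i then 1 else if k = i + 1 then - 1 else 0)"

text \<open>\<open>diag(S\<^sub>1, \<dots>, S\<^sub>p)\<close>: block r starts after row \<open>n (r - 1) - (r - 1)\<close> and after column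
  \<open>n (r - 1)\<close>, since each earlier block has one row fewer than it has columns.\<close>

definition sync_matrix ::
    "nat \<Rightarrow> (nat \<Rightarrow> nat) \<Rightarrow> real^('n::{finite,linorder})^('m::{finite,linorder})" where
  "sync_matrix p n =
     (\<chi> i k. \<Sum>r = 1..p.
        if index_pos i \<in> {n (r - 1) - (r - 1)<..n r - r} \<and> index_pos k \<in> {n (r - 1)<..n r}
        then S_entry (index_pos i - (n (r - 1) - (r - 1))) (index_pos k - n (r - 1))
        else 0)"

end

theory Submission
  imports Defs "HOL-Library.Diagonal_Subsequence"
begin

text \<open>Let Q be the orthogonal projection onto Ker C and P = I - Q. The compatibility conditions make
  P commute with A and give (D + Q) P = P D, so P maps solutions for (A, D) to solutions for
  (A, D + Q), and C = C P. As P x is controlled by C x, it suffices that the system with the positive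
  definite damping matrix D + Q is exponentially stable.

  For that system, subtract from a solution v the solution u of the N decoupled stable
  scalar equations with the same initial data; an energy estimate for u - v bounds the initial energy
  of v by its dissipation plus the term from A, which is compact. Hence the semigroup is, at some
  time, a strict contraction up to a compact seminorm. Either it decays exponentially, or there is a
  nonzero orbit of constant energy. Minimising a Rayleigh quotient over such orbits gives U \<noteq> 0 with
  \<open>L U + A U = \<mu> U\<close> and \<open>G U = 0\<close>; contracting with eigenvectors of A yields a nonzero
  z with \<open>L z = \<nu> z\<close> and \<open>g z = 0\<close>, an undamped oscillation of the scalar equation, which is
  impossible.\<close>

section \<open>One-sided derivatives and positive forms\<close>

text \<open>Passing to \<open>D + Q\<close> is forced: Ker C is invariant under \<open>A\<close> and
  annihilated by \<open>D\<close>, so energy is conserved there and the full state does not decay.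
  But \<open>A\<close> and \<open>D + Q\<close> need not commute, so the system does not split into
  scalar equations. Only \<open>A\<close> and the identity matrix can be diagonalised together.
  Hence the comparison with decoupled copies, where it suffices that the damping forms bound each
  other; the eigenvectors of \<open>A\<close> are used only for a single undamped mode. The spaces
  are real, so a skew generator has no nonzero eigenvalue to look for; the Rayleigh quotient of a
  state and its time derivative takes the place of a spectral argument. Existence of solutions
  belongs to the conclusion, so the semigroups are constructed, as limits of backward Euler steps.
  The stability hypothesis may supply a different semigroup for each initial datum, and these must
  be identified with the constructed one. Orbits are handled through right derivatives, because
  \<open>generator\<close> is a limit from the right at 0.\<close>

lemma right_derivative_bound:
  fixes f f' :: "real \<Rightarrow> real"
  assumes ab: "a \<le> b" and cont: "continuous_on {a..b} f"
    and der: "\<And>t. a \<le> t \<Longrightarrow> t < b \<Longrightarrow> (f has_vector_derivative f' t) (at_right t)"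
    and le: "\<And>t. a \<le> t \<Longrightarrow> t < b \<Longrightarrow> f' t \<le> c"
  shows "f b \<le> f a + c * (b - a)"
proof (rule ccontr)
  assume "\<not> ?thesis"
  then have gt: "f b - f a - c * (b - a) > 0" by simp
  have "a \<noteq> b" using gt by auto
  with ab have "a < b" by simp
  \<comment> \<open>Half of the excess slope, so that \<open>g\<close> is still positive at
    \<open>b\<close>.\<close>
  define \<epsilon> where "\<epsilon> = (f b - f a - c * (b - a)) / (2 * (b - a))"
  have \<epsilon>: "\<epsilon> > 0" using gt \<open>a < b\<close> by (simp add: \<epsilon>_def)
  define g where "g t = f t - f a - (c + \<epsilon>) * (t - a)" for t
  have gb: "g b > 0"
  proof -
    have half: "x / (2 * y) * y = x / 2" if "y \<noteq> 0" for x y :: real using that by simp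
    have "\<epsilon> * (b - a) = (f b - f a - c * (b - a)) / 2"
      unfolding \<epsilon>_def by (rule half) (use \<open>a < b\<close> in simp)
    then show ?thesis using gt by (simp add: g_def algebra_simps)
  qed
  have cg: "continuous_on {a..b} g" unfolding g_def by (intro continuous_intros cont)
  \<comment> \<open>At the last point where \<open>g\<close> is nonpositive its right derivative is
    negative, so \<open>g\<close> is nonpositive a little later too.\<close>
  define S where "S = {t \<in> {a..b}. g t \<le> 0}"
  have "closed S" unfolding S_def
    using continuous_closed_preimage[OF cg closed_atLeastAtMost, of "{..0}"]
    by (simp add: vimage_def Int_def Collect_conj_eq[symmetric])
  moreover have "S \<subseteq> {a..b}" by (auto simp: S_def)
  ultimately have "compact S"
    by (metis compact_Icc compact_Int_closed inf.absorb_iff2)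
  moreover have "a \<in> S" using ab by (simp add: S_def g_def)
  ultimately obtain s where s: "s \<in> S" "\<And>t. t \<in> S \<Longrightarrow> t \<le> s"
    using compact_attains_sup[of S] by auto
  have sb: "a \<le> s" "s < b" "g s \<le> 0"
    using s(1) gb by (auto simp: S_def less_le)
  have "(g has_vector_derivative (f' s - (c + \<epsilon>))) (at_right s)"
    unfolding g_def
    by (rule derivative_eq_intros der sb refl | simp)+
  then have "(g has_real_derivative (f' s - (c + \<epsilon>))) (at_right s)"
    by (simp add: has_real_derivative_iff_has_vector_derivative)
  moreover have "f' s - (c + \<epsilon>) < 0" using le[of s] sb \<epsilon> by simp
  ultimately obtain d where d: "d > 0" "\<And>h. 0 < h \<Longrightarrow> s + h \<in> {s<..} \<Longrightarrow> h < d \<Longrightarrow> g s > g (s + h)"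
    using has_real_derivative_neg_dec_right by blast
  define h where "h = min (d / 2) (b - s)"
  have "0 < h" "h < d" "s + h \<le> b" using d sb by (auto simp: h_def)
  then have "s + h \<in> S" using d(2)[of h] sb by (auto simp: S_def)
  from s(2)[OF this] \<open>0 < h\<close> show False by simp
qed

text \<open>Discriminant criterion. With \<open>p = 0\<close> it says that a first variation
  vanishes, and in this form it yields the equations satisfied by minimisers and maximisers
  below.\<close>

lemma quadratic_nonneg_imp:
  fixes p q r :: real
  assumes "\<And>t. 0 \<le> p + 2 * t * q + t\<^sup>2 * r" and r: "0 \<le> r"
  shows "q\<^sup>2 \<le> p * r"
proof (cases "r = 0")
  case True
  have "q = 0"
  proof (rule ccontr)
    assume "q \<noteq> 0"
    \<comment> \<open>At this value of \<open>t\<close> the quadratic equals -1.\<close>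
    then show False
      using assms(1)[of "- (p + 1) / (2 * q)"] True by (simp add: field_simps)
  qed
  with True show ?thesis by simp
next
  case False
  have "0 \<le> (p + 2 * (- q / r) * q + (- q / r)\<^sup>2 * r) * r" using assms(1) r by (simp only: mult_nonneg_nonneg)
  also have "\<dots> = p * r - q\<^sup>2" using False by (simp add: power2_eq_square field_simps)
  finally show ?thesis by simp
qed

lemma linear_funpow: "linear A \<Longrightarrow> linear (A ^^ n)" for A :: "'a::real_vector \<Rightarrow> 'a"
  by (induction n) (auto intro: linear_compose simp: linear_id[unfolded id_def] id_def)

text \<open>Definiteness is left out on purpose: the forms of \<open>A\<close> and of the damping
  may vanish on nonzero vectors, and so may the energy lost along an orbit,
  \<open>b x x - b (flow t x) (flow t x)\<close>, to which the locale is applied as well.\<close>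

locale sym_form =
  fixes b :: "'a::real_normed_vector \<Rightarrow> 'a \<Rightarrow> real"
  assumes bilinear: "bounded_bilinear b"
    and sym: "b x y = b y x"
    and nonneg: "0 \<le> b x x"
begin

interpretation b: bounded_bilinear b by (rule bilinear)

lemmas form_simps = b.add_left b.add_right b.diff_left b.diff_right b.scaleR_left b.scaleR_right
  b.minus_left b.minus_right b.zero_left b.zero_right

definition semi :: "'a \<Rightarrow> real" where "semi x = sqrt (b x x)"

lemma semi_sq: "(semi x)\<^sup>2 = b x x"
  by (simp add: semi_def nonneg)

lemma semi_nonneg [simp]: "0 \<le> semi x"
  by (simp add: semi_def nonneg)

lemma semi_zero [simp]: "semi 0 = 0"
  by (simp add: semi_def form_simps)

lemma expand_add_scale: "b (x + t *\<^sub>R y) (x + t *\<^sub>R y) = b x x + 2 * t * b x y + t\<^sup>2 * b y y"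
  by (simp add: form_simps sym[of y x] power2_eq_square algebra_simps)

lemma cauchy_schwarz_sq: "(b x y)\<^sup>2 \<le> b x x * b y y"
  by (rule quadratic_nonneg_imp) (metis expand_add_scale nonneg, rule nonneg)

lemma cauchy_schwarz: "\<bar>b x y\<bar> \<le> semi x * semi y"
proof -
  have "(b x y)\<^sup>2 \<le> (semi x * semi y)\<^sup>2"
    using cauchy_schwarz_sq by (simp add: power_mult_distrib semi_sq)
  then show ?thesis by (metis abs_le_square_iff abs_of_nonneg mult_nonneg_nonneg semi_nonneg)
qed

text \<open>By Cauchy-Schwarz the null vectors of a semidefinite form make up its radical. In this
  way zero dissipation becomes a vanishing damping term, and constant energy of one orbit becomes a
  conserved pairing with every orbit.\<close>

lemma eq_0_of_diag: "b x x = 0 \<Longrightarrow> b x y = 0"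
  using cauchy_schwarz[of x y] by (simp add: semi_def)

lemma semi_triangle: "semi (x + y) \<le> semi x + semi y"
proof -
  have "(semi (x + y))\<^sup>2 = b x x + 2 * b x y + b y y"
    using expand_add_scale[of x 1 y] by (simp add: semi_sq)
  also have "\<dots> \<le> (semi x + semi y)\<^sup>2"
    using cauchy_schwarz[of x y] by (simp add: power2_sum semi_sq)
  finally show ?thesis by (rule power2_le_imp_le) (simp add: add_nonneg_nonneg)
qed

lemma semi_scale: "semi (t *\<^sub>R x) = \<bar>t\<bar> * semi x"
  by (simp add: semi_def form_simps real_sqrt_mult power2_eq_square[symmetric] mult.assoc[symmetric])

lemma semi_minus [simp]: "semi (- x) = semi x"
  by (simp add: semi_def form_simps)

lemma semi_commute: "semi (x - y) = semi (y - x)"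
  using semi_minus[of "x - y"] by simp

lemma semi_triangle_diff: "semi (x - y) \<le> semi x + semi y"
  using semi_triangle[of x "- y"] by simp

lemma semi_triangle3: "semi (x - z) \<le> semi (x - y) + semi (y - z)"
  using semi_triangle[of "x - y" "y - z"] by simp

lemma pow_semi:
  assumes "\<And>y. semi (A y) \<le> semi y" shows "semi ((A ^^ n) y) \<le> semi y"
  by (induction n) (auto intro: order_trans[OF assms])

lemma semi_bound: "\<exists>K>0. \<forall>x. semi x \<le> K * norm x"
proof -
  obtain K where K: "K > 0" "\<And>x y. norm (b x y) \<le> norm x * norm y * K" using b.pos_bounded by blast
  have "semi x \<le> sqrt K * norm x" for x
  proof -
    have "b x x \<le> norm x * norm x * K" using K(2)[of x x] by simp
    then have "semi x \<le> sqrt (norm x * norm x * K)" by (simp add: semi_def)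
    also have "\<dots> = sqrt K * norm x" by (simp add: real_sqrt_mult)
    finally show ?thesis .
  qed
  with K(1) show ?thesis by (metis real_sqrt_gt_0_iff)
qed

lemma young: "\<epsilon> > 0 \<Longrightarrow> \<bar>b x y\<bar> \<le> \<epsilon> * b x x + b y y / (4 * \<epsilon>)"
proof -
  assume \<epsilon>: "\<epsilon> > 0"
  have "0 \<le> (2 * \<epsilon> * semi x - semi y)\<^sup>2" by simp
  then have "4 * \<epsilon> * (semi x * semi y) \<le> 4 * \<epsilon>\<^sup>2 * b x x + b y y"
    by (simp add: power2_diff power_mult_distrib semi_sq algebra_simps)
  then have "semi x * semi y \<le> \<epsilon> * b x x + b y y / (4 * \<epsilon>)"
    using \<epsilon> by (simp add: field_simps power2_eq_square)
  then show ?thesis using cauchy_schwarz[of x y] by linarith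
qed

end

text \<open>\<open>semi\<close> is then an equivalent norm, in general not that of the type:
  contraction estimates hold for an energy or for a graph norm, while limits and completeness refer
  to \<open>norm\<close>.\<close>

locale coercive_form = sym_form b for b :: "'a::banach \<Rightarrow> 'a \<Rightarrow> real" +
  assumes coercive: "\<exists>c>0. \<forall>x. c * (norm x)\<^sup>2 \<le> b x x"
begin

lemma norm_le_semi: "\<exists>K>0. \<forall>x. norm x \<le> K * semi x"
proof -
  obtain c where c: "c > 0" "\<And>x. c * (norm x)\<^sup>2 \<le> b x x" using coercive by blast
  have "norm x \<le> (1 / sqrt c) * semi x" for x
  proof -
    have "sqrt (c * (norm x)\<^sup>2) \<le> semi x" using c(2) by (simp only: semi_def real_sqrt_le_iff)
    then show ?thesis using c(1) by (simp add: real_sqrt_mult field_simps)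
  qed
  with c(1) show ?thesis by (intro exI[of _ "1 / sqrt c"]) auto
qed

lemma semi_eq_0 [simp]: "semi x = 0 \<longleftrightarrow> x = 0"
proof
  obtain K where "norm x \<le> K * semi x" using norm_le_semi by blast
  then show "semi x = 0 \<Longrightarrow> x = 0" by simp
qed simp

lemma bounded_linear_of_contraction:
  fixes T :: "'a \<Rightarrow> 'a"
  assumes "linear T" "\<And>x. semi (T x) \<le> semi x" shows "bounded_linear T"
proof -
  interpret linear T by fact
  obtain K where K: "K > 0" "\<And>x. norm x \<le> K * semi x" using norm_le_semi by blast
  obtain K' where K': "K' > 0" "\<And>x. semi x \<le> K' * norm x" using semi_bound by blast
  have "norm (T x) \<le> norm x * (K * K')" for x
  proof -
    have "norm (T x) \<le> K * semi (T x)" by (rule K(2))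
    also have "\<dots> \<le> K * (K' * norm x)"
      using K(1) order_trans[OF assms(2) K'(2)] by (intro mult_left_mono) auto
    finally show ?thesis by (simp add: algebra_simps)
  qed
  then show ?thesis
    by (intro bounded_linear_intro[of _ "K * K'"]) (auto simp: add scale)
qed

lemma semi_Cauchy_convergent:
  assumes "\<And>\<epsilon>. \<epsilon> > 0 \<Longrightarrow> \<exists>N. \<forall>m\<ge>N. \<forall>n\<ge>N. semi (X m - X n) < \<epsilon>"
  shows "convergent X"
proof -
  obtain K where K: "K > 0" "\<And>x. norm x \<le> K * semi x" using norm_le_semi by blast
  have "Cauchy X" unfolding Cauchy_def dist_norm
  proof (intro allI impI)
    fix \<epsilon> :: real assume "\<epsilon> > 0"
    then obtain N where N: "\<forall>m\<ge>N. \<forall>n\<ge>N. semi (X m - X n) < \<epsilon> / K"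
      using assms[of "\<epsilon> / K"] K(1) by auto
    have "norm (X m - X n) < \<epsilon>" if "m \<ge> N" "n \<ge> N" for m n
      using K(2)[of "X m - X n"] N that K(1)
      by (smt (verit, best) mult.commute pos_less_divide_eq)
    then show "\<exists>N. \<forall>m\<ge>N. \<forall>n\<ge>N. norm (X m - X n) < \<epsilon>" by blast
  qed
  then show ?thesis by (rule Cauchy_convergent)
qed

lemma tendsto_semi: "(f \<longlongrightarrow> l) F \<Longrightarrow> ((\<lambda>x. semi (f x)) \<longlongrightarrow> semi l) F"
  unfolding semi_def by (intro tendsto_real_sqrt bounded_bilinear.tendsto[OF bilinear])

lemma tendsto_of_semi:
  assumes "((\<lambda>x. semi (f x - l)) \<longlongrightarrow> 0) F" shows "(f \<longlongrightarrow> l) F"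
proof -
  obtain K where K: "K > 0" "\<And>x. norm x \<le> K * semi x" using norm_le_semi by blast
  have "((\<lambda>x. K * semi (f x - l)) \<longlongrightarrow> K * 0) F" using assms by (intro tendsto_intros)
  then have "((\<lambda>x. K * semi (f x - l)) \<longlongrightarrow> 0) F" by simp
  then have "((\<lambda>x. f x - l) \<longlongrightarrow> 0) F"
    by (rule Lim_null_comparison[rotated]) (simp add: K)
  then show ?thesis by (simp add: LIM_zero_iff)
qed

lemma density_semi:
  assumes "closure S = UNIV" "\<epsilon> > 0" shows "\<exists>y\<in>S. semi (y - x) < \<epsilon>"
proof -
  obtain K where K: "K > 0" "\<And>x. semi x \<le> K * norm x" using semi_bound by blast
  have "x \<in> closure S" using assms by simp
  then obtain y where y: "y \<in> S" "dist y x < \<epsilon> / K"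
    using closure_approachable[of x S] assms(2) K(1) by (meson divide_pos_pos)
  then have "semi (y - x) < \<epsilon>" using K(2)[of "y - x"] K(1)
    by (smt (verit, best) dist_norm mult.commute pos_less_divide_eq)
  with y show ?thesis by blast
qed

text \<open>The solution minimises the quadratic functional \<open>b x x - 2 * l x\<close>; a minimising sequence
  is Cauchy by the parallelogram law.\<close>

lemma lax_milgram:
  assumes l: "bounded_linear l"
  shows "\<exists>z. \<forall>\<phi>. b z \<phi> = l \<phi>"
proof -
  interpret l: bounded_linear l by (rule l)
  define q where "q x = b x x - 2 * l x" for x
  obtain c where c: "c > 0" "\<And>x. c * (norm x)\<^sup>2 \<le> b x x" using coercive by blast
  obtain K where K: "\<And>x. norm (l x) \<le> norm x * K" using l.bounded by blast
  have low: "- (K\<^sup>2 / c) \<le> q x" for x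
  proof -
    have "0 \<le> (c * norm x - K)\<^sup>2 / c" using c(1) by simp
    also have "\<dots> = c * (norm x)\<^sup>2 - 2 * (norm x * K) + K\<^sup>2 / c"
      using c(1) by (simp add: power2_diff power_mult_distrib field_simps power2_eq_square)
    also have "\<dots> \<le> b x x - 2 * l x + K\<^sup>2 / c" using c(2)[of x] K[of x] by simp
    finally show ?thesis by (simp add: q_def)
  qed
  then have bdd: "bdd_below (range q)" by (auto simp: bdd_below_def)
  define I where "I = Inf (range q)"
  have I: "I \<le> q x" for x unfolding I_def by (rule cInf_lower) (auto simp: bdd)
  have "\<exists>x. q x < I + inverse (real (Suc n))" for n
    using cInf_less_iff[of "range q" "I + inverse (real (Suc n))"] bdd by (auto simp: I_def)
  then obtain X where X: "\<And>n. q (X n) < I + inverse (real (Suc n))" by metis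
  have par: "b (x - y) (x - y) \<le> 2 * (q x - I) + 2 * (q y - I)" for x y
  proof -
    have "b (x - y) (x - y) = 2 * q x + 2 * q y - 4 * q ((1/2) *\<^sub>R (x + y))"
      by (simp add: q_def form_simps l.add l.scaleR sym[of y x] field_simps)
    with I[of "(1/2) *\<^sub>R (x + y)"] show ?thesis by simp
  qed
  have "convergent X"
  proof (rule semi_Cauchy_convergent)
    fix \<epsilon> :: real assume \<epsilon>: "\<epsilon> > 0"
    then obtain N where N: "inverse (real (Suc N)) < \<epsilon>\<^sup>2 / 4"
      using reals_Archimedean[of "\<epsilon>\<^sup>2 / 4"] by auto
    have "semi (X m - X n) < \<epsilon>" if "m \<ge> N" "n \<ge> N" for m n
    proof -
      have near: "4 * (q (X k) - I) < \<epsilon>\<^sup>2" if "k \<ge> N" for k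
      proof -
        have "inverse (real (Suc k)) \<le> inverse (real (Suc N))" using that by auto
        with N X[of k] show ?thesis by argo
      qed
      have "(semi (X m - X n))\<^sup>2 < \<epsilon>\<^sup>2"
        using par[of "X m" "X n"] near[OF \<open>m \<ge> N\<close>] near[OF \<open>n \<ge> N\<close>] unfolding semi_sq by argo
      then show ?thesis using \<epsilon> by (simp add: power_less_imp_less_base)
    qed
    then show "\<exists>N. \<forall>m\<ge>N. \<forall>n\<ge>N. semi (X m - X n) < \<epsilon>" by blast
  qed
  then obtain z where z: "X \<longlonglongrightarrow> z" by (auto simp: convergent_def)
  have "(\<lambda>n. q (X n)) \<longlonglongrightarrow> q z"
    unfolding q_def by (intro tendsto_intros bounded_bilinear.tendsto[OF bilinear] l.tendsto z)
  moreover have "(\<lambda>n. I + inverse (real (Suc n))) \<longlonglongrightarrow> I + 0"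
    by (intro tendsto_intros LIMSEQ_inverse_real_of_nat)
  ultimately have "q z \<le> I"
    by (intro LIMSEQ_le[of "\<lambda>n. q (X n)" "q z" "\<lambda>n. I + inverse (real (Suc n))"])
      (use X less_imp_le in auto)
  then have zI: "q z \<le> q x" for x using I order_trans by blast
  have "b z \<phi> = l \<phi>" for \<phi>
  proof -
    have "0 \<le> 0 + 2 * t * (b z \<phi> - l \<phi>) + t\<^sup>2 * b \<phi> \<phi>" for t
      using zI[of "z + t *\<^sub>R \<phi>"] by (simp add: q_def expand_add_scale l.add l.scaleR algebra_simps)
    then have "(b z \<phi> - l \<phi>)\<^sup>2 \<le> 0 * b \<phi> \<phi>" by (rule quadratic_nonneg_imp) (rule nonneg)
    then show ?thesis by simp
  qed
  then show ?thesis by blast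
qed

end

section \<open>Contraction semigroups by Euler's exponential formula\<close>

text \<open>Links right derivatives of orbits to the difference quotients at 0 by which
  \<open>generator\<close> is defined.\<close>

lemma right_derivative_iff:
  fixes f :: "real \<Rightarrow> 'a::real_normed_vector"
  shows "(f has_vector_derivative D) (at_right t) \<longleftrightarrow>
    ((\<lambda>h. (f (t + h) - f t) /\<^sub>R h) \<longlongrightarrow> D) (at_right 0)"
proof -
  have "(f has_vector_derivative D) (at_right t) \<longleftrightarrow>
      ((\<lambda>y. (f y - (f t + (y - t) *\<^sub>R D)) /\<^sub>R norm (y - t)) \<longlongrightarrow> 0) (at_right t)"
    unfolding has_vector_derivative_def has_derivative_within
    by (simp add: bounded_linear_scaleR_left inverse_eq_divide)
  also have "\<dots> \<longleftrightarrow> ((\<lambda>h. (f (t + h) - (f t + h *\<^sub>R D)) /\<^sub>R norm h) \<longlongrightarrow> 0) (at_right 0)"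
    by (subst at_right_to_0) (simp add: filterlim_filtermap add.commute)
  also have "\<dots> \<longleftrightarrow> ((\<lambda>h. (f (t + h) - f t) /\<^sub>R h - D) \<longlongrightarrow> 0) (at_right 0)"
    by (rule tendsto_cong)
      (auto simp: eventually_at_filter algebra_simps scaleR_diff_right scaleR_add_right)
  also have "\<dots> \<longleftrightarrow> ((\<lambda>h. (f (t + h) - f t) /\<^sub>R h) \<longlongrightarrow> D) (at_right 0)"
    by (rule LIM_zero_iff)
  finally show ?thesis .
qed

text \<open>The Lumer-Phillips hypotheses for an operator given by its graph. Dissipativity is
  measured in an inner product equivalent to the norm, and \<open>range\<close> makes the identity
  minus \<open>h\<close> times the operator onto.\<close>

locale dissipative = coercive_form b for b :: "'a::banach \<Rightarrow> 'a \<Rightarrow> real" +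
  fixes G :: "('a \<times> 'a) set"
  assumes subspace_G: "subspace G"
    and dissip: "(x, a) \<in> G \<Longrightarrow> b x a \<le> 0"
    and range: "h > 0 \<Longrightarrow> \<exists>x a. (x, a) \<in> G \<and> x - h *\<^sub>R a = y"
    and dense: "closure (fst ` G) = UNIV"
begin

section \<open>The resolvent of a dissipative operator\<close>

lemma G_add: "(x, a) \<in> G \<Longrightarrow> (y, c) \<in> G \<Longrightarrow> (x + y, a + c) \<in> G"
  using subspace_add[OF subspace_G, of "(x, a)" "(y, c)"] by simp

lemma G_scale: "(x, a) \<in> G \<Longrightarrow> (r *\<^sub>R x, r *\<^sub>R a) \<in> G"
  using subspace_scale[OF subspace_G, of "(x, a)" r] by simp

lemma G_diff: "(x, a) \<in> G \<Longrightarrow> (y, c) \<in> G \<Longrightarrow> (x - y, a - c) \<in> G"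
  using subspace_diff[OF subspace_G, of "(x, a)" "(y, c)"] by simp

text \<open>In the expansion of \<open>b (x - h *\<^sub>R a) (x - h *\<^sub>R a)\<close> the cross
  term is nonnegative by dissipativity.\<close>

lemma G_expansive:
  assumes "(x, a) \<in> G" "h \<ge> 0" shows "semi x \<le> semi (x - h *\<^sub>R a)"
proof -
  have "b x x \<le> b x x + 2 * (- h) * b x a + (- h)\<^sup>2 * b a a"
  proof -
    have "h * b x a \<le> 0" "0 \<le> h\<^sup>2 * b a a"
      using dissip[OF assms(1)] assms(2) nonneg[of a] by (auto simp: mult_nonneg_nonpos)
    then show ?thesis by simp
  qed
  also have "\<dots> = b (x - h *\<^sub>R a) (x - h *\<^sub>R a)"
    using expand_add_scale[of x "- h" a] by simp
  finally show ?thesis by (simp add: semi_def)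
qed

text \<open>The backward Euler step, inverse to the identity minus \<open>h\<close> times the
  operator. At \<open>h = 0\<close> it is the identity by convention, so that time 0 is covered by
  the same Euler approximations.\<close>

definition Res :: "real \<Rightarrow> 'a \<Rightarrow> 'a" where
  "Res h y = (if h = 0 then y else SOME x. \<exists>a. (x, a) \<in> G \<and> x - h *\<^sub>R a = y)"

lemma Res_0 [simp]: "Res 0 y = y"
  by (simp add: Res_def)

lemma Res_ex:
  assumes "h > 0" obtains a where "(Res h y, a) \<in> G" "Res h y - h *\<^sub>R a = y"
  using someI_ex[OF range[OF assms, of y]] assms that by (auto simp: Res_def)

text \<open>\<open>G_expansive\<close>, applied to the difference of two solutions of the resolvent
  equation, bounds it by 0.\<close>

lemma Res_unique:
  assumes "(x, a) \<in> G" "h \<ge> 0" shows "Res h (x - h *\<^sub>R a) = x"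
proof (cases "h = 0")
  case False
  with assms have h: "h > 0" by simp
  obtain c where c: "(Res h (x - h *\<^sub>R a), c) \<in> G" "Res h (x - h *\<^sub>R a) - h *\<^sub>R c = x - h *\<^sub>R a"
    using Res_ex[OF h] by metis
  have "semi (Res h (x - h *\<^sub>R a) - x) \<le> semi ((Res h (x - h *\<^sub>R a) - x) - h *\<^sub>R (c - a))"
    using G_expansive[OF G_diff[OF c(1) assms(1)] assms(2)] .
  also have "(Res h (x - h *\<^sub>R a) - x) - h *\<^sub>R (c - a) = 0"
    using c(2) by (simp add: algebra_simps)
  finally show ?thesis using semi_nonneg[of "Res h (x - h *\<^sub>R a) - x"]
    by (metis antisym eq_iff_diff_eq_0 semi_eq_0 semi_zero)
qed simp

lemma Res_linear: assumes "h \<ge> 0" shows "linear (Res h)"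
proof (cases "h = 0")
  case True then show ?thesis by (simp add: Res_def linear_iff)
next
  case False
  with assms have h: "h > 0" by simp
  show ?thesis
  proof (rule linearI)
    fix x y
    obtain a c where *: "(Res h x, a) \<in> G" "Res h x - h *\<^sub>R a = x"
      "(Res h y, c) \<in> G" "Res h y - h *\<^sub>R c = y" using Res_ex[OF h] by metis
    have "x + y = (Res h x + Res h y) - h *\<^sub>R (a + c)"
      using *(2,4) by (metis add_diff_add scaleR_right_distrib)
    then show "Res h (x + y) = Res h x + Res h y"
      using Res_unique[OF G_add[OF *(1,3)] assms] by simp
  next
    fix r x
    obtain a where *: "(Res h x, a) \<in> G" "Res h x - h *\<^sub>R a = x" using Res_ex[OF h] by metis
    have "r *\<^sub>R x = r *\<^sub>R Res h x - h *\<^sub>R (r *\<^sub>R a)"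
      using *(2) by (metis scaleR_left_commute scaleR_right_diff_distrib)
    then show "Res h (r *\<^sub>R x) = r *\<^sub>R Res h x"
      using Res_unique[OF G_scale[OF *(1), of r] assms] by simp
  qed
qed

lemma Res_semi: assumes "h \<ge> 0" shows "semi (Res h y) \<le> semi y"
proof (cases "h = 0")
  case False
  with assms have h: "h > 0" by simp
  obtain a where "(Res h y, a) \<in> G" "Res h y - h *\<^sub>R a = y" using Res_ex[OF h] by metis
  then show ?thesis using G_expansive[of "Res h y" a h] assms by simp
qed simp

text \<open>The resolvent commutes with the operator: if \<open>c\<close> is the image of
  \<open>Res h x\<close>, then \<open>Res h x - x\<close> equals \<open>h *\<^sub>R c\<close>, which
  puts \<open>c\<close> in the domain and identifies it as \<open>Res h a\<close>.\<close>

lemma Res_G: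
  assumes "(x, a) \<in> G" "h \<ge> 0"
  shows "(Res h x, Res h a) \<in> G" "Res h x - h *\<^sub>R Res h a = x"
proof -
  have "(Res h x, Res h a) \<in> G \<and> Res h x - h *\<^sub>R Res h a = x"
  proof (cases "h = 0")
    case False
    with assms have h: "h > 0" by simp
    obtain c where c: "(Res h x, c) \<in> G" "Res h x - h *\<^sub>R c = x" using Res_ex[OF h] by metis
    have "(inverse h *\<^sub>R (Res h x - x), inverse h *\<^sub>R (c - a)) \<in> G"
      by (intro G_scale G_diff c assms)
    moreover have "inverse h *\<^sub>R (Res h x - x) = c"
      using c(2) h by (metis (no_types, lifting) add_diff_cancel_left' diff_add_cancel
        divideR_right less_irrefl)
    ultimately have "(c, inverse h *\<^sub>R (c - a)) \<in> G" by simp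
    from Res_unique[OF this assms(2)] have "Res h a = c" using h by simp
    with c show ?thesis by simp
  qed (use assms in simp)
  then show "(Res h x, Res h a) \<in> G" "Res h x - h *\<^sub>R Res h a = x" by auto
qed

lemma Res_commute:
  assumes "h \<ge> 0" "k \<ge> 0" shows "Res h (Res k y) = Res k (Res h y)"
proof (cases "k = 0")
  case False
  with assms have k: "k > 0" by simp
  obtain a where a: "(Res k y, a) \<in> G" "Res k y - k *\<^sub>R a = y" using Res_ex[OF k] by metis
  have "Res h y = Res h (Res k y) - k *\<^sub>R Res h a"
    using a(2) linear_diff[OF Res_linear[OF assms(1)], of "Res k y" "k *\<^sub>R a"]
      linear_scale[OF Res_linear[OF assms(1)], of k a] by simp
  then show ?thesis using Res_unique[OF Res_G(1)[OF a(1) assms(1)] assms(2)] by simp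
qed simp

text \<open>Telescoping: every step contributes one copy of \<open>A x - B x\<close>, transported by
  contractions; commutation brings the single difference next to \<open>x\<close>.\<close>

lemma pow_diff:
  assumes "linear A" "linear B" "\<And>y. semi (A y) \<le> semi y" "\<And>y. semi (B y) \<le> semi y"
    and comm: "\<And>y. A (B y) = B (A y)"
  shows "semi ((A ^^ n) x - (B ^^ n) x) \<le> real n * semi (A x - B x)"
proof (induction n)
  case (Suc n)
  have cp: "(A ^^ n) (B x) = B ((A ^^ n) x)" by (induction n) (auto simp: comm)
  have "(A ^^ Suc n) x - (B ^^ Suc n) x = (A ^^ n) (A x - B x) + B ((A ^^ n) x - (B ^^ n) x)"
    using linear_diff[OF linear_funpow[OF assms(1)], of n "A x" "B x"]
      linear_diff[OF assms(2), of "(A ^^ n) x" "(B ^^ n) x"] cp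
    by (simp add: funpow_swap1)
  then have "semi ((A ^^ Suc n) x - (B ^^ Suc n) x)
      \<le> semi ((A ^^ n) (A x - B x)) + semi (B ((A ^^ n) x - (B ^^ n) x))"
    using semi_triangle by metis
  also have "\<dots> \<le> semi (A x - B x) + semi ((A ^^ n) x - (B ^^ n) x)"
    by (intro add_mono pow_semi assms)
  finally show ?case using Suc by (simp add: algebra_simps)
qed simp

lemma Res_pow_semi: "k \<ge> 0 \<Longrightarrow> semi ((Res k ^^ m) x) \<le> semi x"
  by (rule pow_semi) (rule Res_semi)

lemma Res_pow_linear: "k \<ge> 0 \<Longrightarrow> linear (Res k ^^ m)"
  by (rule linear_funpow) (rule Res_linear)

lemma Res_pow_commute: "h \<ge> 0 \<Longrightarrow> k \<ge> 0 \<Longrightarrow> Res h ((Res k ^^ m) y) = (Res k ^^ m) (Res h y)"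
proof (induction m)
  case (Suc m)
  then show ?case using Res_commute[of h k "(Res k ^^ m) y"] by simp
qed simp

text \<open>A vector \<open>a\<close> that may lie outside the domain is replaced by a domain
  element \<open>z\<close>, where each step costs at most \<open>k * semi c\<close>; the replacement
  costs \<open>semi (a - z)\<close> twice.\<close>

lemma Res_pow_near:
  assumes "(z, c) \<in> G" "k \<ge> 0"
  shows "semi ((Res k ^^ m) a - a) \<le> 2 * semi (a - z) + real m * k * semi c"
proof -
  have z: "semi ((Res k ^^ m) z - z) \<le> real m * k * semi c"
  proof (induction m)
    case (Suc m)
    have "(Res k ^^ Suc m) z - z = Res k ((Res k ^^ m) z - z) + k *\<^sub>R Res k c"
      using Res_G(2)[OF assms] linear_diff[OF Res_linear[OF assms(2)], of "(Res k ^^ m) z" z]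
      by (simp add: algebra_simps)
    then have "semi ((Res k ^^ Suc m) z - z) \<le> semi (Res k ((Res k ^^ m) z - z)) + semi (k *\<^sub>R Res k c)"
      using semi_triangle by metis
    also have "\<dots> \<le> semi ((Res k ^^ m) z - z) + k * semi c"
      using assms(2) by (auto simp: semi_scale intro!: add_mono Res_semi mult_left_mono)
    finally show ?case using Suc by (simp add: algebra_simps)
  qed simp
  have "(Res k ^^ m) a - a = (Res k ^^ m) (a - z) + (((Res k ^^ m) z - z) - (a - z))"
    using linear_diff[OF Res_pow_linear[OF assms(2)], of m a z] by simp
  then have "semi ((Res k ^^ m) a - a) \<le> semi ((Res k ^^ m) (a - z)) + (semi ((Res k ^^ m) z - z) + semi (a - z))"
    using semi_triangle semi_triangle_diff by (metis add_left_mono order_trans)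
  then show ?thesis using z Res_pow_semi[OF assms(2), of m "a - z"] by linarith
qed

text \<open>The bound involves number and size of the steps only through the elapsed time
  \<open>real m * k\<close>, so it is the same for one long step and for many short ones. The vector
  \<open>z\<close> enters because the image \<open>a\<close> need not lie in the domain
  again.\<close>

lemma Res_pow_first_order:
  assumes "(x, a) \<in> G" "(z, c) \<in> G" "k \<ge> 0"
  shows "semi ((Res k ^^ m) x - x - (real m * k) *\<^sub>R a)
    \<le> real m * k * (2 * semi (a - z) + real m * k * semi c)"
proof (induction m)
  case (Suc m)
  have "(Res k ^^ Suc m) x = (Res k ^^ m) (x + k *\<^sub>R Res k a)"
    using Res_G(2)[OF assms(1,3)] by (metis add.commute diff_add_cancel funpow_swap1 funpow.simps(2) comp_apply)
  also have "\<dots> = (Res k ^^ m) x + k *\<^sub>R (Res k ^^ Suc m) a"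
    using Res_pow_linear[OF assms(3), of m] by (simp add: linear_add linear_scale funpow_swap1)
  finally have eq: "(Res k ^^ Suc m) x - x - (real (Suc m) * k) *\<^sub>R a
      = ((Res k ^^ m) x - x - (real m * k) *\<^sub>R a) + k *\<^sub>R ((Res k ^^ Suc m) a - a)"
    by (simp add: algebra_simps)
  have "semi ((Res k ^^ Suc m) x - x - (real (Suc m) * k) *\<^sub>R a)
      \<le> semi ((Res k ^^ m) x - x - (real m * k) *\<^sub>R a) + k * semi ((Res k ^^ Suc m) a - a)"
    unfolding eq
    using semi_triangle[of "(Res k ^^ m) x - x - (real m * k) *\<^sub>R a" "k *\<^sub>R ((Res k ^^ Suc m) a - a)"]
    by (simp only: semi_scale abs_of_nonneg[OF assms(3)])
  also have "\<dots> \<le> real m * k * (2 * semi (a - z) + real m * k * semi c)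
      + k * (2 * semi (a - z) + real (Suc m) * k * semi c)"
    by (intro add_mono Suc.IH mult_left_mono Res_pow_near assms)
  also have "\<dots> \<le> real (Suc m) * k * (2 * semi (a - z) + real (Suc m) * k * semi c)"
  proof -
    have "0 \<le> real m * (k * k * semi c)" using assms(3) by simp
    then show ?thesis by (simp add: algebra_simps)
  qed
  finally show ?case .
qed simp

text \<open>One step of length \<open>t / real n\<close> and \<open>m\<close> steps of length
  \<open>t / real (n * m)\<close> agree to first order with the same vector; \<open>pow_diff\<close>
  adds up \<open>n\<close> such defects.\<close>

lemma euler_refine:
  assumes G: "(x, a) \<in> G" "(z, c) \<in> G" and t: "t \<ge> 0" and n: "n > 0" and m: "m > 0"
  shows "semi ((Res (t / real n) ^^ n) x - (Res (t / real (n * m)) ^^ (n * m)) x)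
    \<le> 2 * t * (2 * semi (a - z) + t / real n * semi c)"
proof -
  let ?h = "t / real n" and ?k = "t / real (n * m)"
  have hk: "?h \<ge> 0" "?k \<ge> 0" using t by auto
  have mk: "real m * ?k = ?h" using m n by simp
  let ?B = "?h * (2 * semi (a - z) + ?h * semi c)"
  have 1: "semi (Res ?h x - x - ?h *\<^sub>R a) \<le> ?B"
    using Res_pow_first_order[OF G hk(1), of 1] by simp
  have 2: "semi ((Res ?k ^^ m) x - x - ?h *\<^sub>R a) \<le> ?B"
    using Res_pow_first_order[OF G hk(2), of m] unfolding mk .
  have "Res ?h x - (Res ?k ^^ m) x = (Res ?h x - x - ?h *\<^sub>R a) - ((Res ?k ^^ m) x - x - ?h *\<^sub>R a)"
    by simp
  then have 3: "semi (Res ?h x - (Res ?k ^^ m) x) \<le> 2 * ?B"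
    using semi_triangle_diff 1 2 by (smt (verit, best))
  have "semi ((Res ?h ^^ n) x - ((Res ?k ^^ m) ^^ n) x) \<le> real n * semi (Res ?h x - (Res ?k ^^ m) x)"
    by (rule pow_diff) (use hk in \<open>auto intro: Res_linear Res_pow_linear Res_semi Res_pow_semi Res_pow_commute\<close>)
  also have "\<dots> \<le> real n * (2 * ?B)" using 3 by (rule mult_left_mono) simp
  also have "\<dots> = 2 * t * (2 * semi (a - z) + t / real n * semi c)" using n by simp
  finally show ?thesis by (simp add: funpow_mult mult.commute)
qed

lemma dense_G_sequence: obtains X A where "\<And>n. (X n, A n) \<in> G" "X \<longlonglongrightarrow> x"
proof -
  have "x \<in> closure (fst ` G)" using dense by simp
  then obtain X where X: "\<And>n. X n \<in> fst ` G" "X \<longlonglongrightarrow> x" by (auto simp: closure_sequential)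
  then have "\<forall>n. \<exists>a. (X n, a) \<in> G" by force
  then obtain A where "\<And>n. (X n, A n) \<in> G" by metis
  with X(2) show thesis by (rule that[rotated])
qed

section \<open>Convergence of the backward Euler approximations\<close>

definition euler :: "real \<Rightarrow> nat \<Rightarrow> 'a \<Rightarrow> 'a" where
  "euler t n = Res (t / real (Suc n)) ^^ Suc n"

lemma euler_semi: "t \<ge> 0 \<Longrightarrow> semi (euler t n x) \<le> semi x"
  unfolding euler_def by (rule Res_pow_semi) simp

lemma euler_linear: "t \<ge> 0 \<Longrightarrow> linear (euler t n)"
  unfolding euler_def by (rule Res_pow_linear) simp

text \<open>Both approximations are compared with their common refinement of
  \<open>Suc m * Suc n\<close> steps.\<close>

lemma euler_diff_bound:
  assumes G: "(x, a) \<in> G" "(z, c) \<in> G" and t: "t \<ge> 0" and N: "m \<ge> N" "n \<ge> N"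
  shows "semi (euler t m x - euler t n x) \<le> 8 * t * semi (a - z) + 4 * t * t * semi c / real (Suc N)"
proof -
  let ?y = "(Res (t / real (Suc m * Suc n)) ^^ (Suc m * Suc n)) x"
  define B where "B = 2 * t * (2 * semi (a - z) + t / real (Suc N) * semi c)"
  have le: "2 * t * (2 * semi (a - z) + t / real (Suc k) * semi c) \<le> B" if "k \<ge> N" for k
    using that t unfolding B_def by (intro mult_left_mono add_left_mono mult_right_mono divide_left_mono) auto
  have "semi (euler t m x - ?y) \<le> B"
    using order_trans[OF euler_refine[OF G t, of "Suc m" "Suc n"] le[OF N(1)]] by (simp add: euler_def)
  moreover have "semi (euler t n x - ?y) \<le> B"
    using order_trans[OF euler_refine[OF G t, of "Suc n" "Suc m"] le[OF N(2)]]
    unfolding euler_def by (simp only: mult.commute[of "Suc m" "Suc n"] zero_less_Suc)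
  ultimately have "semi (euler t m x - euler t n x) \<le> 2 * B"
    using semi_triangle3[of "euler t m x" "euler t n x" ?y] semi_commute[of ?y "euler t n x"] by linarith
  then show ?thesis by (simp add: B_def algebra_simps)
qed

lemma dense_G: assumes "\<epsilon> > 0" obtains z c where "(z, c) \<in> G" "semi (z - x) < \<epsilon>"
  using density_semi[OF dense assms, of x] by force

lemma euler_Cauchy_G:
  assumes "(x, a) \<in> G" "t \<ge> 0" "\<epsilon> > 0"
  shows "\<exists>N. \<forall>m\<ge>N. \<forall>n\<ge>N. semi (euler t m x - euler t n x) < \<epsilon>"
proof -
  \<comment> \<open>The factor 16 brings the first term of \<open>euler_diff_bound\<close> below
    \<open>\<epsilon> / 2\<close>. Only then is \<open>N\<close> chosen, because it depends on
    \<open>c\<close>.\<close>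
  obtain z c where z: "(z, c) \<in> G" "semi (z - a) < \<epsilon> / (16 * (t + 1))"
    using dense_G[of "\<epsilon> / (16 * (t + 1))" a] assms by auto
  obtain N where N: "8 * t * t * semi c / \<epsilon> < real N" using reals_Archimedean2 by blast
  have "semi (euler t m x - euler t n x) < \<epsilon>" if "m \<ge> N" "n \<ge> N" for m n
  proof -
    have "8 * t * semi (a - z) \<le> 8 * t * (\<epsilon> / (16 * (t + 1)))"
      using z(2) assms(2) semi_commute[of a z] by (intro mult_left_mono) auto
    also have "\<dots> \<le> \<epsilon> / 2" using assms(2,3) by (simp add: field_simps)
    finally have 1: "8 * t * semi (a - z) \<le> \<epsilon> / 2" .
    have "4 * t * t * semi c / real (Suc N) < \<epsilon> / 2"
      using N assms(3) by (simp add: field_simps)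
    with 1 euler_diff_bound[OF assms(1) z(1) assms(2) that] show ?thesis by linarith
  qed
  then show ?thesis by blast
qed

lemma euler_convergent: assumes "t \<ge> 0" shows "convergent (\<lambda>n. euler t n x)"
proof (rule semi_Cauchy_convergent)
  fix \<epsilon> :: real assume \<epsilon>: "\<epsilon> > 0"
  obtain z c where z: "(z, c) \<in> G" "semi (z - x) < \<epsilon> / 3" using dense_G[of "\<epsilon> / 3" x] \<epsilon> by auto
  obtain N where N: "\<forall>m\<ge>N. \<forall>n\<ge>N. semi (euler t m z - euler t n z) < \<epsilon> / 3"
    using euler_Cauchy_G[OF z(1) assms, of "\<epsilon> / 3"] \<epsilon> by auto
  have d: "semi (euler t m z - euler t m x) < \<epsilon> / 3" for m
    using euler_semi[OF assms, of m "z - x"] z(2) linear_diff[OF euler_linear[OF assms], of m z x] by simp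
  have "semi (euler t m x - euler t n x) < \<epsilon>" if "m \<ge> N" "n \<ge> N" for m n
  proof -
    have "semi (euler t m z - euler t n z) < \<epsilon> / 3" using N that by blast
    then show ?thesis using d[of m] d[of n] semi_triangle3[of "euler t m x" "euler t n x" "euler t m z"]
        semi_triangle3[of "euler t m z" "euler t n x" "euler t n z"] semi_commute[of "euler t m x" "euler t m z"]
      by linarith
  qed
  then show "\<exists>N. \<forall>m\<ge>N. \<forall>n\<ge>N. semi (euler t m x - euler t n x) < \<epsilon>" by blast
qed

section \<open>The limit flow and its semigroup law\<close>

definition flow :: "real \<Rightarrow> 'a \<Rightarrow> 'a" where
  "flow t x = lim (\<lambda>n. euler t n x)"

lemma euler_tendsto: "t \<ge> 0 \<Longrightarrow> (\<lambda>n. euler t n x) \<longlonglongrightarrow> flow t x"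
  unfolding flow_def by (rule convergent_LIMSEQ_iff[THEN iffD1]) (rule euler_convergent)

lemma flow_0 [simp]: "flow 0 x = x"
proof -
  have "(Res 0 ^^ n) x = x" for n by (induction n) auto
  then show ?thesis by (simp add: flow_def euler_def del: funpow.simps)
qed

lemma flow_linear: assumes "t \<ge> 0" shows "linear (flow t)"
proof (rule linearI)
  fix x y
  have "(\<lambda>n. euler t n x + euler t n y) \<longlonglongrightarrow> flow t x + flow t y"
    by (intro tendsto_add euler_tendsto assms)
  then show "flow t (x + y) = flow t x + flow t y"
    using euler_tendsto[OF assms, of "x + y"] LIMSEQ_unique
    by (simp add: linear_add[OF euler_linear[OF assms]])
next
  fix r x
  have "(\<lambda>n. r *\<^sub>R euler t n x) \<longlonglongrightarrow> r *\<^sub>R flow t x"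
    by (intro tendsto_intros euler_tendsto assms)
  then show "flow t (r *\<^sub>R x) = r *\<^sub>R flow t x"
    using euler_tendsto[OF assms, of "r *\<^sub>R x"] LIMSEQ_unique
    by (simp add: linear_scale[OF euler_linear[OF assms]])
qed

lemma flow_semi: assumes "t \<ge> 0" shows "semi (flow t x) \<le> semi x"
  by (rule LIMSEQ_le_const2[OF tendsto_semi[OF euler_tendsto[OF assms]]])
    (use euler_semi[OF assms] in blast)

lemma flow_bounded_linear: "t \<ge> 0 \<Longrightarrow> bounded_linear (flow t)"
  by (intro bounded_linear_of_contraction flow_linear flow_semi)

text \<open>Divided by \<open>t\<close> this gives the right derivative at 0, since \<open>z\<close>
  may be taken arbitrarily close to \<open>a\<close>.\<close>

lemma flow_first_order:
  assumes "(x, a) \<in> G" "(z, c) \<in> G" "t \<ge> 0"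
  shows "semi (flow t x - x - t *\<^sub>R a) \<le> t * (2 * semi (a - z) + t * semi c)"
proof (rule LIMSEQ_le_const2[OF tendsto_semi])
  show "(\<lambda>n. euler t n x - x - t *\<^sub>R a) \<longlonglongrightarrow> flow t x - x - t *\<^sub>R a"
    by (intro tendsto_intros euler_tendsto assms)
  have "semi (euler t n x - x - t *\<^sub>R a) \<le> t * (2 * semi (a - z) + t * semi c)" for n
    using Res_pow_first_order[OF assms(1,2), of "t / real (Suc n)" "Suc n"] assms(3)
    unfolding euler_def by (simp del: funpow.simps of_nat_Suc)
  then show "\<exists>N. \<forall>n\<ge>N. semi (euler t n x - x - t *\<^sub>R a) \<le> t * (2 * semi (a - z) + t * semi c)" by blast
qed

text \<open>Resolvent identity: the difference is
  \<open>(h - k) *\<^sub>R Res k (Res h a)\<close>.\<close>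

lemma Res_diff:
  assumes "(x, a) \<in> G" "h \<ge> 0" "k \<ge> 0"
  shows "semi (Res h x - Res k x) \<le> \<bar>h - k\<bar> * semi a"
proof -
  have "Res h x - k *\<^sub>R Res h a = x + (h - k) *\<^sub>R Res h a"
    using Res_G(2)[OF assms(1,2)] by (simp add: algebra_simps)
  then have "Res h x = Res k (x + (h - k) *\<^sub>R Res h a)"
    using Res_unique[OF Res_G(1)[OF assms(1,2)] assms(3)] by metis
  also have "\<dots> = Res k x + (h - k) *\<^sub>R Res k (Res h a)"
    using Res_linear[OF assms(3)] by (simp add: linear_add linear_scale)
  finally have "semi (Res h x - Res k x) = \<bar>h - k\<bar> * semi (Res k (Res h a))"
    by (simp add: semi_scale)
  also have "\<dots> \<le> \<bar>h - k\<bar> * semi a"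
    using order_trans[OF Res_semi[OF assms(3)] Res_semi[OF assms(2)]] by (intro mult_left_mono) auto
  finally show ?thesis .
qed

lemma flow_lipschitz:
  assumes "(x, a) \<in> G" "t \<ge> 0" "s \<ge> 0"
  shows "semi (flow t x - flow s x) \<le> \<bar>t - s\<bar> * semi a"
proof (rule LIMSEQ_le_const2[OF tendsto_semi])
  show "(\<lambda>n. euler t n x - euler s n x) \<longlonglongrightarrow> flow t x - flow s x"
    by (intro tendsto_intros euler_tendsto assms)
  have "semi (euler t n x - euler s n x) \<le> \<bar>t - s\<bar> * semi a" for n
  proof -
    let ?t = "t / real (Suc n)" and ?s = "s / real (Suc n)"
    have ts: "?t \<ge> 0" "?s \<ge> 0" using assms by auto
    have "semi (euler t n x - euler s n x) \<le> real (Suc n) * semi (Res ?t x - Res ?s x)"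
      unfolding euler_def using ts
      by (intro pow_diff) (auto intro: Res_linear Res_semi Res_commute)
    also have "\<dots> \<le> real (Suc n) * (\<bar>?t - ?s\<bar> * semi a)"
      by (intro mult_left_mono Res_diff assms ts) auto
    also have "\<bar>?t - ?s\<bar> = \<bar>t - s\<bar> / real (Suc n)"
      by (simp add: diff_divide_distrib[symmetric] del: of_nat_Suc)
    finally show ?thesis by (simp del: of_nat_Suc)
  qed
  then show "\<exists>N. \<forall>n\<ge>N. semi (euler t n x - euler s n x) \<le> \<bar>t - s\<bar> * semi a" by blast
qed

lemma flow_continuous: "continuous_on {0..} (\<lambda>t. flow t x)"
proof (unfold continuous_on_def, intro ballI)
  fix t :: real assume "t \<in> {0..}" then have t: "t \<ge> 0" by simp
  show "((\<lambda>t. flow t x) \<longlongrightarrow> flow t x) (at t within {0..})"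
  proof (rule tendsto_of_semi, rule tendstoI)
    fix \<epsilon> :: real assume \<epsilon>: "\<epsilon> > 0"
    obtain z c where z: "(z, c) \<in> G" "semi (z - x) < \<epsilon> / 3" using dense_G[of "\<epsilon> / 3" x] \<epsilon> by auto
    have d: "semi (flow s z - flow s x) < \<epsilon> / 3" if "s \<ge> 0" for s
      using flow_semi[OF that, of "z - x"] z(2) linear_diff[OF flow_linear[OF that], of z x] by simp
    have "((\<lambda>s. \<bar>s - t\<bar> * semi c) \<longlongrightarrow> \<bar>t - t\<bar> * semi c) (at t within {0..})"
      by (intro tendsto_intros)
    then have "\<forall>\<^sub>F s in at t within {0..}. \<bar>s - t\<bar> * semi c < \<epsilon> / 3"
      using order_tendstoD(2)[of "\<lambda>s. \<bar>s - t\<bar> * semi c" 0 _ "\<epsilon> / 3"] \<epsilon> by simp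
    moreover have "\<forall>\<^sub>F s in at t within {0..}. s \<in> {0..}"
      by (simp add: eventually_at_filter)
    ultimately show "\<forall>\<^sub>F s in at t within {0..}. dist (semi (flow s x - flow t x)) 0 < \<epsilon>"
    proof eventually_elim
      case (elim s)
      then have s: "s \<ge> 0" by simp
      show ?case
        using elim(1) d[OF s] d[OF t] flow_lipschitz[OF z(1) s t]
          semi_triangle3[of "flow s x" "flow t x" "flow s z"]
          semi_triangle3[of "flow s z" "flow t x" "flow t z"] semi_commute[of "flow s x" "flow s z"]
        by (simp add: dist_real_def)
    qed
  qed
qed

lemma flow_mult:
  assumes "t \<ge> 0" shows "flow (real k * t) x = (flow t ^^ k) x"
proof (cases "k = 0")
  case False
  then have k: "k > 0" by simp
  \<comment> \<open>The approximation changes with \<open>n\<close> in every factor of the power;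
    the contraction bound allows passing to the limit one factor at a time.\<close>
  have 1: "(\<lambda>n. (euler t n ^^ j) x) \<longlonglongrightarrow> (flow t ^^ j) x" for j
  proof (induction j)
    case (Suc j)
    let ?y = "(flow t ^^ j) x"
    have "(\<lambda>n. semi ((euler t n ^^ j) x - ?y) + semi (euler t n ?y - flow t ?y)) \<longlonglongrightarrow> 0 + 0"
      using tendsto_semi[OF LIM_zero[OF Suc]] tendsto_semi[OF LIM_zero[OF euler_tendsto[OF assms, of ?y]]]
      by (intro tendsto_add) simp_all
    then have lim: "(\<lambda>n. semi ((euler t n ^^ j) x - ?y) + semi (euler t n ?y - flow t ?y)) \<longlonglongrightarrow> 0" by simp
    have "(\<lambda>n. semi ((euler t n ^^ Suc j) x - flow t ?y)) \<longlonglongrightarrow> 0"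
    proof (rule Lim_null_comparison[OF _ lim], intro always_eventually allI)
      fix n
      have "semi (euler t n ((euler t n ^^ j) x) - euler t n ?y) \<le> semi ((euler t n ^^ j) x - ?y)"
        using euler_semi[OF assms, of n "(euler t n ^^ j) x - ?y"]
        by (simp add: linear_diff[OF euler_linear[OF assms]])
      then show "norm (semi ((euler t n ^^ Suc j) x - flow t ?y))
          \<le> semi ((euler t n ^^ j) x - ?y) + semi (euler t n ?y - flow t ?y)"
        using semi_triangle3[of "(euler t n ^^ Suc j) x" "flow t ?y" "euler t n ?y"] by simp
    qed
    then show ?case by (intro tendsto_of_semi) simp
  qed simp
  \<comment> \<open>\<open>euler\<close> with index \<open>i\<close> takes \<open>Suc i\<close>
    steps, hence the index \<open>k * Suc n - 1\<close> for \<open>k * Suc n\<close> steps.\<close>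
  have eq: "euler (real k * t) (k * Suc n - 1) x = (euler t n ^^ k) x" for n
  proof -
    have S: "Suc (k * Suc n - 1) = k * Suc n" using k by simp
    have "real k * t / real (k * Suc n) = t / real (Suc n)"
      using k by (simp only: of_nat_mult) (simp del: of_nat_Suc)
    then show ?thesis unfolding euler_def S by (simp only: funpow_mult mult.commute)
  qed
  have "strict_mono (\<lambda>n. k * Suc n - 1)"
    using k by (auto simp: strict_mono_Suc_iff)
  then have "(\<lambda>n. euler (real k * t) (k * Suc n - 1) x) \<longlonglongrightarrow> flow (real k * t) x"
    using LIMSEQ_subseq_LIMSEQ[OF euler_tendsto[of "real k * t" x]] assms by (simp add: o_def)
  then show ?thesis unfolding eq using 1 LIMSEQ_unique by blast
qed simp

lemma flow_add:
  assumes s: "s \<ge> 0" and t: "t \<ge> 0" shows "flow (s + t) x = flow s (flow t x)"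
proof -
  \<comment> \<open>Both times are rounded down to multiples of the common step
    \<open>inverse (real (Suc n))\<close>, where the law is an identity of powers by
    \<open>flow_mult\<close>; continuity in time does the rest.\<close>
  define a where "a r n = real (nat \<lfloor>r * real (Suc n)\<rfloor>) * inverse (real (Suc n))" for r and n
  have a_ge: "a r n \<ge> 0" for r n by (simp add: a_def)
  have a_lim: "a r \<longlonglongrightarrow> r" if "r \<ge> 0" for r
  proof (rule LIM_zero_cancel, rule Lim_null_comparison[OF _ LIMSEQ_inverse_real_of_nat], intro always_eventually allI)
    fix n
    have "\<bar>real (nat \<lfloor>r * real (Suc n)\<rfloor>) - r * real (Suc n)\<bar> \<le> 1"
      using that by (simp add: abs_le_iff) linarith
    then have "\<bar>real (nat \<lfloor>r * real (Suc n)\<rfloor>) - r * real (Suc n)\<bar> * inverse (real (Suc n)) \<le> 1 * inverse (real (Suc n))"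
      by (rule mult_right_mono) simp
    also have "\<bar>real (nat \<lfloor>r * real (Suc n)\<rfloor>) - r * real (Suc n)\<bar> * inverse (real (Suc n)) = \<bar>a r n - r\<bar>"
    proof -
      have "a r n - r = (real (nat \<lfloor>r * real (Suc n)\<rfloor>) - r * real (Suc n)) * inverse (real (Suc n))"
        unfolding a_def by (simp add: left_diff_distrib del: of_nat_Suc)
      then show ?thesis by (simp only: abs_mult) simp
    qed
    finally show "norm (a r n - r) \<le> inverse (real (Suc n))" by simp
  qed
  have cont: "(\<lambda>n. flow (r n) y) \<longlonglongrightarrow> flow l y" if "r \<longlonglongrightarrow> l" "\<And>n. r n \<ge> 0" "l \<ge> 0" for r l y
    using continuous_on_tendsto_compose[OF flow_continuous that(1)] that by simp
  have "flow (a s n + a t n) x = flow (a s n) (flow (a t n) x)" for n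
    unfolding a_def by (simp add: distrib_right[symmetric] flow_mult funpow_add
      of_nat_add[symmetric] del: of_nat_add of_nat_Suc)
  moreover have "(\<lambda>n. flow (a s n + a t n) x) \<longlonglongrightarrow> flow (s + t) x"
    by (rule cont) (use s t in \<open>auto intro!: tendsto_intros a_lim add_nonneg_nonneg a_ge\<close>)
  moreover have "(\<lambda>n. flow (a s n) (flow (a t n) x)) \<longlonglongrightarrow> flow s (flow t x)"
  proof -
    let ?y = "flow t x"
    have "(\<lambda>n. semi (flow (a t n) x - ?y) + semi (flow (a s n) ?y - flow s ?y)) \<longlonglongrightarrow> 0 + 0"
      using tendsto_semi[OF LIM_zero[OF cont[OF a_lim[OF t] a_ge t, of x]]]
        tendsto_semi[OF LIM_zero[OF cont[OF a_lim[OF s] a_ge s, of ?y]]]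
      by (intro tendsto_add) simp_all
    then have lim: "(\<lambda>n. semi (flow (a t n) x - ?y) + semi (flow (a s n) ?y - flow s ?y)) \<longlonglongrightarrow> 0" by simp
    show ?thesis
    proof (rule tendsto_of_semi, rule Lim_null_comparison[OF _ lim], intro always_eventually allI)
      fix n
      have "semi (flow (a s n) (flow (a t n) x) - flow (a s n) ?y) \<le> semi (flow (a t n) x - ?y)"
        using flow_semi[OF a_ge, of s n "flow (a t n) x - ?y"]
        by (simp add: linear_diff[OF flow_linear[OF a_ge]])
      then show "norm (semi (flow (a s n) (flow (a t n) x) - flow s ?y))
          \<le> semi (flow (a t n) x - ?y) + semi (flow (a s n) ?y - flow s ?y)"
        using semi_triangle3[of "flow (a s n) (flow (a t n) x)" "flow s ?y" "flow (a s n) ?y"] by simp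
    qed
  qed
  ultimately show ?thesis using LIMSEQ_unique by simp
qed

section \<open>The generator of the flow and uniqueness of orbits\<close>

lemma flow_right_limit_0:
  assumes "(x, a) \<in> G" shows "((\<lambda>h. (flow h x - x) /\<^sub>R h) \<longlongrightarrow> a) (at_right 0)"
proof (rule tendsto_of_semi, rule tendstoI)
  fix \<epsilon> :: real assume \<epsilon>: "\<epsilon> > 0"
  obtain z c where z: "(z, c) \<in> G" "semi (z - a) < \<epsilon> / 4" using dense_G[of "\<epsilon> / 4" a] \<epsilon> by auto
  have "((\<lambda>h::real. h * semi c) \<longlongrightarrow> 0 * semi c) (at_right 0)" by (intro tendsto_intros)
  then have "\<forall>\<^sub>F h in at_right 0. h * semi c < \<epsilon> / 2"
    using order_tendstoD(2)[of "\<lambda>h. h * semi c" 0 _ "\<epsilon> / 2"] \<epsilon> by simp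
  moreover have "\<forall>\<^sub>F h in at_right 0. h > (0::real)" by (simp add: eventually_at_filter)
  ultimately show "\<forall>\<^sub>F h in at_right 0. dist (semi ((flow h x - x) /\<^sub>R h - a)) 0 < \<epsilon>"
  proof eventually_elim
    case (elim h)
    then have "h > 0" by simp
    then have "(flow h x - x) /\<^sub>R h - a = inverse h *\<^sub>R (flow h x - x - h *\<^sub>R a)"
      by (simp add: scaleR_right_diff_distrib)
    then have "semi ((flow h x - x) /\<^sub>R h - a) = \<bar>inverse h\<bar> * semi (flow h x - x - h *\<^sub>R a)"
      by (simp only: semi_scale)
    also have "\<dots> = semi (flow h x - x - h *\<^sub>R a) / h"
    proof -
      have "\<bar>inverse h\<bar> = inverse h" using \<open>h > 0\<close> by simp
      then show ?thesis by (simp only: divide_inverse mult.commute)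
    qed
    also have "\<dots> \<le> 2 * semi (a - z) + h * semi c"
      using flow_first_order[OF assms z(1), of h] \<open>h > 0\<close> by (simp add: divide_le_eq mult.commute)
    finally show ?case using elim z(2) semi_commute[of a z] by (simp add: dist_real_def)
  qed
qed

text \<open>Maximality of a dissipative operator with full range: subtracting from \<open>x\<close>
  the domain element that solves the resolvent equation for \<open>x - a\<close> leaves a vector
  \<open>w\<close> whose own right derivative at 0 is \<open>w\<close>, and contraction forces
  \<open>b w w \<le> 0\<close>.\<close>

lemma flow_generator:
  assumes "((\<lambda>h. (flow h x - x) /\<^sub>R h) \<longlongrightarrow> a) (at_right 0)" shows "(x, a) \<in> G"
proof -
  obtain c where c: "(Res 1 (x - a), c) \<in> G" "Res 1 (x - a) - c = x - a"
    using Res_ex[of 1 "x - a"] by auto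
  define w where "w = x - Res 1 (x - a)"
  have w: "w = a - c" using c(2) by (simp add: w_def algebra_simps)
  have "((\<lambda>h. (flow h w - w) /\<^sub>R h) \<longlongrightarrow> a - c) (at_right 0)"
  proof (rule Lim_transform_eventually)
    show "((\<lambda>h. (flow h x - x) /\<^sub>R h - (flow h (Res 1 (x - a)) - Res 1 (x - a)) /\<^sub>R h) \<longlongrightarrow> a - c) (at_right 0)"
      by (intro tendsto_diff assms flow_right_limit_0 c)
    have "\<forall>\<^sub>F h in at_right 0. h > (0::real)" by (simp add: eventually_at_filter)
    then show "\<forall>\<^sub>F h in at_right 0. (flow h x - x) /\<^sub>R h - (flow h (Res 1 (x - a)) - Res 1 (x - a)) /\<^sub>R h
        = (flow h w - w) /\<^sub>R h"
    proof eventually_elim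
      case (elim h)
      then have fw: "flow h w = flow h x - flow h (Res 1 (x - a))"
        unfolding w_def by (intro linear_diff flow_linear) simp
      show ?case unfolding fw by (simp add: w_def scaleR_right_diff_distrib)
    qed
  qed
  then have "((\<lambda>h. b w ((flow h w - w) /\<^sub>R h)) \<longlongrightarrow> b w (a - c)) (at_right 0)"
    by (intro bounded_bilinear.tendsto[OF bilinear] tendsto_const)
  moreover have "\<forall>\<^sub>F h in at_right 0. b w ((flow h w - w) /\<^sub>R h) \<le> 0"
  proof -
    have "\<forall>\<^sub>F h in at_right 0. h > (0::real)" by (simp add: eventually_at_filter)
    then show ?thesis
    proof eventually_elim
      case (elim h)
      have "b w (flow h w) \<le> semi w * semi (flow h w)" using cauchy_schwarz[of w "flow h w"] by simp
      also have "\<dots> \<le> semi w * semi w" using flow_semi[of h w] elim by (intro mult_left_mono) auto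
      finally have "b w (flow h w) \<le> b w w" using semi_sq[of w] by (simp add: power2_eq_square)
      then show ?case using elim by (simp add: form_simps mult_nonneg_nonpos)
    qed
  qed
  ultimately have "b w (a - c) \<le> 0"
    by (rule tendsto_upperbound) simp
  then have "b w w = 0" using w nonneg[of w] by simp
  then have "w = 0" using semi_eq_0[of w] by (simp add: semi_def)
  with w c(1) show ?thesis by (simp add: w_def)
qed

lemma flow_G:
  assumes "(x, a) \<in> G" "t \<ge> 0" shows "(flow t x, flow t a) \<in> G"
proof (rule flow_generator)
  interpret F: bounded_linear "flow t" by (rule flow_bounded_linear[OF assms(2)])
  show "((\<lambda>h. (flow h (flow t x) - flow t x) /\<^sub>R h) \<longlongrightarrow> flow t a) (at_right 0)"
  proof (rule Lim_transform_eventually[OF F.tendsto[OF flow_right_limit_0[OF assms(1)]]])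
    have "\<forall>\<^sub>F h in at_right 0. h > (0::real)" by (simp add: eventually_at_filter)
    then show "\<forall>\<^sub>F h in at_right 0. flow t ((flow h x - x) /\<^sub>R h) = (flow h (flow t x) - flow t x) /\<^sub>R h"
    proof eventually_elim
      case (elim h)
      then have "flow h (flow t x) = flow t (flow h x)"
        using flow_add[of h t x] flow_add[of t h x] assms(2) by (simp add: add.commute)
      then show ?case by (simp add: F.scaleR F.diff)
    qed
  qed
qed

lemma flow_deriv:
  assumes "(x, a) \<in> G" "t \<ge> 0" shows "((\<lambda>s. flow s x) has_vector_derivative flow t a) (at_right t)"
proof -
  have "((\<lambda>h. (flow h (flow t x) - flow t x) /\<^sub>R h) \<longlongrightarrow> flow t a) (at_right 0)"
    by (rule flow_right_limit_0[OF flow_G[OF assms]])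
  moreover have "\<forall>\<^sub>F h in at_right 0. (flow h (flow t x) - flow t x) /\<^sub>R h = (flow (t + h) x - flow t x) /\<^sub>R h"
    using assms(2) by (auto simp: eventually_at_filter add.commute[of t] flow_add)
  ultimately show ?thesis unfolding right_derivative_iff by (rule Lim_transform_eventually)
qed

text \<open>Dissipativity makes the right derivative of \<open>b (d t) (d t)\<close> nonpositive,
  and \<open>d\<close> starts at 0.\<close>

lemma flow_unique:
  assumes cont: "continuous_on {0..} u"
    and der: "\<And>t. t \<ge> 0 \<Longrightarrow> (u has_vector_derivative u' t) (at_right t)"
    and G: "\<And>t. t \<ge> 0 \<Longrightarrow> (u t, u' t) \<in> G"
    and t: "t \<ge> 0"
  shows "u t = flow t (u 0)"
proof -
  define d where "d s = u s - flow s (u 0)" for s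
  have G0: "(u 0, u' 0) \<in> G" by (simp add: G)
  have "b (d t) (d t) \<le> b (d 0) (d 0) + 0 * (t - 0)"
  proof (rule right_derivative_bound[OF t])
    have "continuous_on {0..t} d" unfolding d_def
      by (intro continuous_intros continuous_on_subset[OF cont] continuous_on_subset[OF flow_continuous]) auto
    then show "continuous_on {0..t} (\<lambda>t. b (d t) (d t))"
      by (intro bounded_bilinear.continuous_on[OF bilinear])
    fix s :: real assume s: "0 \<le> s"
    have "(d has_vector_derivative u' s - flow s (u' 0)) (at_right s)"
      unfolding d_def by (intro derivative_intros der flow_deriv G0 s)
    from bounded_bilinear.has_vector_derivative[OF bilinear this this]
    show "((\<lambda>t. b (d t) (d t)) has_vector_derivative
        b (d s) (u' s - flow s (u' 0)) + b (u' s - flow s (u' 0)) (d s)) (at_right s)" .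
    have "b (d s) (u' s - flow s (u' 0)) \<le> 0"
      unfolding d_def by (intro dissip G_diff G s flow_G G0)
    then show "b (d s) (u' s - flow s (u' 0)) + b (u' s - flow s (u' 0)) (d s) \<le> 0"
      using sym by simp
  qed
  then have "b (d t) (d t) \<le> 0" by (simp add: d_def form_simps)
  then have "d t = 0" using semi_eq_0[of "d t"] nonneg[of "d t"] by (simp add: semi_def)
  then show ?thesis by (simp add: d_def)
qed

section \<open>The flow as a strongly continuous semigroup\<close>

definition semigroup :: "real \<Rightarrow> 'a \<Rightarrow>\<^sub>L 'a" where
  "semigroup t = Blinfun (flow t)"

lemma semigroup_apply: "t \<ge> 0 \<Longrightarrow> blinfun_apply (semigroup t) x = flow t x"
  by (simp add: semigroup_def bounded_linear_Blinfun_apply flow_bounded_linear)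

lemma C0_semigroup_semigroup: "C0_semigroup semigroup"
  unfolding C0_semigroup_def
proof (intro conjI allI impI)
  show "semigroup 0 = id_blinfun"
    by (rule blinfun_eqI) (simp add: semigroup_apply)
  show "semigroup (s + t) = semigroup s o\<^sub>L semigroup t" if "0 \<le> s" "0 \<le> t" for s t
    by (rule blinfun_eqI) (simp add: semigroup_apply that flow_add)
  fix x
  have "((\<lambda>t. flow t x) \<longlongrightarrow> flow 0 x) (at 0 within {0..})"
    using bspec[OF flow_continuous[of x, unfolded continuous_on_def], of 0] by simp
  then have "((\<lambda>t. flow t x) \<longlongrightarrow> x) (at_right 0)"
    unfolding flow_0 by (rule tendsto_within_subset) auto
  then show "((\<lambda>t. blinfun_apply (semigroup t) x) \<longlongrightarrow> x) (at_right 0)"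
    by (rule Lim_transform_eventually) (auto simp: eventually_at_filter semigroup_apply)
qed

lemma generator_semigroup: "generator semigroup = G"
proof -
  have "((\<lambda>t. (blinfun_apply (semigroup t) x - x) /\<^sub>R t) \<longlongrightarrow> y) (at_right 0) \<longleftrightarrow> (x, y) \<in> G" for x y
  proof -
    have "((\<lambda>t. (blinfun_apply (semigroup t) x - x) /\<^sub>R t) \<longlongrightarrow> y) (at_right 0)
        \<longleftrightarrow> ((\<lambda>t. (flow t x - x) /\<^sub>R t) \<longlongrightarrow> y) (at_right 0)"
      by (rule tendsto_cong) (auto simp: eventually_at_filter semigroup_apply)
    then show ?thesis using flow_generator flow_right_limit_0 by blast
  qed
  then show ?thesis by (auto simp: generator_def)
qed

text \<open>Continuity of the orbit is assumed, since an arbitrary \<open>C0_semigroup\<close> is not yet known to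
  be bounded on compact time intervals.\<close>

lemma semigroup_unique:
  assumes C0: "C0_semigroup T" and gen: "generator T = G"
    and cont: "continuous_on {0..} (\<lambda>t. blinfun_apply (T t) x)" and xa: "(x, a) \<in> G" and t: "t \<ge> 0"
  shows "blinfun_apply (T t) x = flow t x"
proof -
  have lim: "((\<lambda>h. (blinfun_apply (T h) x - x) /\<^sub>R h) \<longlongrightarrow> a) (at_right 0)"
    using xa gen by (auto simp: generator_def)
  have add: "T (s + r) = T s o\<^sub>L T r" if "s \<ge> 0" "r \<ge> 0" for s r
    using C0 that by (simp add: C0_semigroup_def)
  have T0: "blinfun_apply (T 0) x = x" using C0 by (simp add: C0_semigroup_def)
  have lim2: "((\<lambda>h. blinfun_apply (T t) ((blinfun_apply (T h) x - x) /\<^sub>R h)) \<longlongrightarrow> blinfun_apply (T t) a) (at_right 0)" for t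
    by (intro blinfun.tendsto tendsto_const lim)
  have "blinfun_apply (T t) x = flow t (blinfun_apply (T 0) x)"
  proof (rule flow_unique[OF cont _ _ t])
    fix s :: real assume s: "s \<ge> 0"
    show "((\<lambda>t. blinfun_apply (T t) x) has_vector_derivative blinfun_apply (T s) a) (at_right s)"
      unfolding right_derivative_iff
      by (rule Lim_transform_eventually[OF lim2])
        (use s in \<open>auto simp: eventually_at_filter add blinfun.bilinear_simps\<close>)
    have "((\<lambda>h. (blinfun_apply (T h) (blinfun_apply (T s) x) - blinfun_apply (T s) x) /\<^sub>R h) \<longlongrightarrow> blinfun_apply (T s) a) (at_right 0)"
    proof (rule Lim_transform_eventually[OF lim2])
      have "blinfun_apply (T h) (blinfun_apply (T s) x) = blinfun_apply (T s) (blinfun_apply (T h) x)"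
        if "h > 0" for h
        using add[of h s] add[of s h] s that
        by (metis add.commute blinfun_apply_blinfun_compose less_imp_le)
      then show "\<forall>\<^sub>F h in at_right 0. blinfun_apply (T s) ((blinfun_apply (T h) x - x) /\<^sub>R h)
          = (blinfun_apply (T h) (blinfun_apply (T s) x) - blinfun_apply (T s) x) /\<^sub>R h"
        by (auto simp: eventually_at_filter blinfun.bilinear_simps)
    qed
    then show "(blinfun_apply (T s) x, blinfun_apply (T s) a) \<in> G"
      using gen by (auto simp: generator_def)
  qed
  then show ?thesis by (simp add: T0)
qed

end

text \<open>On the domain the image of an orbit solves the second equation, so uniqueness applies;
  density extends this to all data. It serves both for the projection of the system and for the
  coordinates of decoupled copies.\<close>

lemma flow_intertwine:
  fixes b1 :: "'a::banach \<Rightarrow> 'a \<Rightarrow> real" and b2 :: "'c::banach \<Rightarrow> 'c \<Rightarrow> real"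
  assumes d1: "dissipative b1 G1" and d2: "dissipative b2 G2" and P: "bounded_linear P"
    and G: "\<And>x a. (x, a) \<in> G1 \<Longrightarrow> (P x, P a) \<in> G2" and t: "t \<ge> 0"
  shows "P (dissipative.flow G1 t x) = dissipative.flow G2 t (P x)"
proof -
  interpret A: dissipative b1 G1 by (rule d1)
  interpret B: dissipative b2 G2 by (rule d2)
  interpret P: bounded_linear P by (rule P)
  have dom: "P (A.flow t x) = B.flow t (P x)" if xa: "(x, a) \<in> G1" for x a
  proof -
    have "P (A.flow t x) = B.flow t (P (A.flow 0 x))"
    proof (rule B.flow_unique[OF _ _ _ t])
      show "continuous_on {0..} (\<lambda>t. P (A.flow t x))"
        by (intro P.continuous_on A.flow_continuous)
      show "((\<lambda>t. P (A.flow t x)) has_vector_derivative P (A.flow s a)) (at_right s)" if "s \<ge> 0" for s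
        by (intro P.has_vector_derivative A.flow_deriv xa that)
      show "(P (A.flow s x), P (A.flow s a)) \<in> G2" if "s \<ge> 0" for s
        by (intro G A.flow_G xa that)
    qed
    then show ?thesis by simp
  qed
  interpret F1: bounded_linear "A.flow t" by (rule A.flow_bounded_linear[OF t])
  interpret F2: bounded_linear "B.flow t" by (rule B.flow_bounded_linear[OF t])
  obtain X Y where X: "\<And>n. (X n, Y n) \<in> G1" "X \<longlonglongrightarrow> x"
    using A.dense_G_sequence by blast
  have "P (A.flow t (X n)) = B.flow t (P (X n))" for n by (rule dom) (rule X)
  moreover have "(\<lambda>n. P (A.flow t (X n))) \<longlonglongrightarrow> P (A.flow t x)"
    by (intro P.tendsto F1.tendsto X)
  moreover have "(\<lambda>n. B.flow t (P (X n))) \<longlonglongrightarrow> B.flow t (P x)"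
    by (intro P.tendsto F2.tendsto X)
  ultimately show ?thesis using LIMSEQ_unique by simp
qed

section \<open>Contractions up to a compact seminorm\<close>

definition Cauchy_wrt :: "('a::minus \<Rightarrow> real) \<Rightarrow> (nat \<Rightarrow> 'a) \<Rightarrow> bool" where
  "Cauchy_wrt k X \<longleftrightarrow> (\<forall>\<epsilon>>0. \<exists>N. \<forall>m\<ge>N. \<forall>n\<ge>N. k (X m - X n) < \<epsilon>)"

text \<open>Compactness of an operator, expressed through a function \<open>k\<close> alone: for
  \<open>k x = norm (f x)\<close>, bounded sequences have subsequences with Cauchy images. Since no
  target space is named, finite sums of such functions stay in the class.\<close>

definition precompact_wrt :: "('a::minus \<Rightarrow> real) \<Rightarrow> ('a \<Rightarrow> real) \<Rightarrow> bool" where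
  "precompact_wrt s k \<longleftrightarrow>
     (\<forall>B X. (\<forall>n::nat. s (X n) \<le> B) \<longrightarrow> (\<exists>r::nat \<Rightarrow> nat. strict_mono r \<and> Cauchy_wrt k (X \<circ> r)))"

lemma Cauchy_wrtD: "Cauchy_wrt k X \<Longrightarrow> \<epsilon> > 0 \<Longrightarrow> \<exists>N. \<forall>m\<ge>N. \<forall>n\<ge>N. k (X m - X n) < \<epsilon>"
  by (simp add: Cauchy_wrt_def)

lemma precompact_wrtD:
  assumes "precompact_wrt s k" "\<And>n. s (X n) \<le> B"
  obtains r :: "nat \<Rightarrow> nat" where "strict_mono r" "Cauchy_wrt k (X \<circ> r)"
  using assms unfolding precompact_wrt_def by blast

lemma Cauchy_wrt_subseq:
  assumes "Cauchy_wrt k X" "strict_mono r" shows "Cauchy_wrt k (X \<circ> r)"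
  unfolding Cauchy_wrt_def o_def
proof (intro allI impI)
  fix \<epsilon> :: real assume "\<epsilon> > 0"
  then obtain N where "\<forall>m\<ge>N. \<forall>n\<ge>N. k (X m - X n) < \<epsilon>" using Cauchy_wrtD[OF assms(1)] by blast
  then show "\<exists>N. \<forall>m\<ge>N. \<forall>n\<ge>N. k (X (r m) - X (r n)) < \<epsilon>"
    using seq_suble[OF assms(2)] by (meson order_trans)
qed

lemma Cauchy_wrt_add:
  assumes "Cauchy_wrt k X" "Cauchy_wrt l X" shows "Cauchy_wrt (\<lambda>x. k x + l x) X"
  unfolding Cauchy_wrt_def
proof (intro allI impI)
  fix \<epsilon> :: real assume "\<epsilon> > 0"
  then have "\<epsilon> / 2 > 0" by simp
  then obtain N N' where "\<forall>m\<ge>N. \<forall>n\<ge>N. k (X m - X n) < \<epsilon> / 2" "\<forall>m\<ge>N'. \<forall>n\<ge>N'. l (X m - X n) < \<epsilon> / 2"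
    using assms Cauchy_wrtD by metis
  then have "\<forall>m\<ge>max N N'. \<forall>n\<ge>max N N'. k (X m - X n) + l (X m - X n) < \<epsilon>"
    by (metis add_strict_mono field_sum_of_halves max.bounded_iff)
  then show "\<exists>N. \<forall>m\<ge>N. \<forall>n\<ge>N. k (X m - X n) + l (X m - X n) < \<epsilon>" by blast
qed

lemma precompact_wrt_add:
  assumes "precompact_wrt s k" "precompact_wrt s l" shows "precompact_wrt s (\<lambda>x. k x + l x)"
  unfolding precompact_wrt_def
proof (intro allI impI)
  fix B X assume B: "\<forall>n::nat. s (X n) \<le> B"
  then obtain r where r: "strict_mono r" "Cauchy_wrt k (X \<circ> r)"
    using precompact_wrtD[OF assms(1), of X B] by blast
  obtain r' where r': "strict_mono r'" "Cauchy_wrt l (X \<circ> r \<circ> r')"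
    using precompact_wrtD[OF assms(2), of "X \<circ> r" B] B by auto
  have "Cauchy_wrt (\<lambda>x. k x + l x) (X \<circ> r \<circ> r')"
    by (intro Cauchy_wrt_add r' Cauchy_wrt_subseq r)
  then show "\<exists>r. strict_mono r \<and> Cauchy_wrt (\<lambda>x. k x + l x) (X \<circ> r)"
    using strict_mono_o[OF r(1) r'(1)] by (metis comp_assoc)
qed

lemma Cauchy_wrt_scale:
  assumes "Cauchy_wrt k X" "c \<ge> 0" shows "Cauchy_wrt (\<lambda>x. c * k x) X"
  unfolding Cauchy_wrt_def
proof (intro allI impI)
  fix \<epsilon> :: real assume \<epsilon>: "\<epsilon> > 0"
  then have "\<epsilon> / (c + 1) > 0" using assms(2) by simp
  then obtain N where N: "\<forall>m\<ge>N. \<forall>n\<ge>N. k (X m - X n) < \<epsilon> / (c + 1)"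
    using Cauchy_wrtD[OF assms(1)] by blast
  have "c * k (X m - X n) < \<epsilon>" if "m \<ge> N" "n \<ge> N" for m n
  proof -
    have "c * k (X m - X n) \<le> c * (\<epsilon> / (c + 1))"
      using N that assms(2) by (intro mult_left_mono) (auto simp: less_imp_le)
    also have "\<dots> < \<epsilon>" using \<epsilon> assms(2) by (simp add: field_simps)
    finally show ?thesis .
  qed
  then show "\<exists>N. \<forall>m\<ge>N. \<forall>n\<ge>N. c * k (X m - X n) < \<epsilon>" by blast
qed

lemma precompact_wrt_scale:
  "precompact_wrt s k \<Longrightarrow> c \<ge> 0 \<Longrightarrow> precompact_wrt s (\<lambda>x. c * k x)"
  unfolding precompact_wrt_def using Cauchy_wrt_scale by blast

lemma precompact_wrt_sum:
  fixes s :: "'a::ab_group_add \<Rightarrow> real"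
  assumes "finite I" "\<And>i. i \<in> I \<Longrightarrow> precompact_wrt s (k i)"
  shows "precompact_wrt s (\<lambda>x. \<Sum>i\<in>I. k i x)"
  using assms
proof (induction I)
  case empty
  have "Cauchy_wrt (\<lambda>x. 0) (X \<circ> id)" for X :: "nat \<Rightarrow> 'a" by (simp add: Cauchy_wrt_def)
  then show ?case unfolding precompact_wrt_def sum.empty using strict_mono_id by blast
next
  case (insert i I)
  then show ?case by (simp add: precompact_wrt_add)
qed

lemma precompact_wrt_compose:
  assumes "precompact_wrt s k" and diff: "\<And>x y. P (x - y) = P x - P y"
    and le: "\<And>x. s (P x) \<le> c * s' x" and c: "c \<ge> 0"
  shows "precompact_wrt s' (\<lambda>x. k (P x))"
  unfolding precompact_wrt_def
proof (intro allI impI)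
  fix B X assume "\<forall>n::nat. s' (X n) \<le> B"
  then have "\<forall>n. s (P (X n)) \<le> c * B" using le c by (meson mult_left_mono order_trans)
  then obtain r where "strict_mono r" "Cauchy_wrt k ((\<lambda>n. P (X n)) \<circ> r)"
    using precompact_wrtD[OF assms(1), of "\<lambda>n. P (X n)"] by blast
  then show "\<exists>r. strict_mono r \<and> Cauchy_wrt (\<lambda>x. k (P x)) (X \<circ> r)"
    by (auto simp: Cauchy_wrt_def diff)
qed

context coercive_form
begin

text \<open>If no power of \<open>T\<close> is a strict contraction, almost normalised vectors \<open>T\<^sup>n x\<^sub>n\<close> with
  \<open>semi (T\<^sup>2\<^sup>n x\<^sub>n) \<rightarrow> 1\<close> exist; the contraction up to the seminorm \<open>k\<close> makes them precompact.\<close>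

lemma contraction_dichotomy:
  fixes T :: "'a \<Rightarrow> 'a"
  assumes lin: "linear T" and contr: "\<And>x. semi (T x) \<le> semi x"
    and q: "0 \<le> q" "q < 1" and Tk: "\<And>x. semi (T x) \<le> q * semi x + k x"
    and comp: "precompact_wrt semi k"
  shows "(\<exists>n r. r < 1 \<and> (\<forall>x. semi ((T ^^ n) x) \<le> r * semi x)) \<or>
    (\<exists>y. y \<noteq> 0 \<and> (\<forall>n. semi ((T ^^ n) y) = semi y))"
proof (cases "\<exists>n r. r < 1 \<and> (\<forall>x. semi ((T ^^ n) x) \<le> r * semi x)")
  case False
  note * = this
  have pc: "semi ((T ^^ n) x) \<le> semi x" for n x by (rule pow_semi) (rule contr)
  have pl: "linear (T ^^ n)" for n by (rule linear_funpow) (rule lin)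
  \<comment> \<open>The exponent \<open>2 * n\<close> leaves \<open>n\<close> steps before and
    \<open>n\<close> steps after \<open>(T ^^ n) x\<close>: the earlier ones provide compactness,
    the later ones keep its size near 1.\<close>
  have "\<exists>x. semi x = 1 \<and> semi ((T ^^ (2 * n)) x) > 1 - inverse (real (Suc n))" for n
  proof -
    have "1 - inverse (real (Suc n)) < 1" by simp
    then obtain x where x: "semi ((T ^^ (2 * n)) x) > (1 - inverse (real (Suc n))) * semi x"
      using * by (meson not_le)
    have "semi x \<noteq> 0"
    proof
      assume "semi x = 0"
      with x pc[of "2 * n" x] show False by simp
    qed
    then have pos: "semi x > 0" using semi_nonneg[of x] by linarith
    let ?x = "inverse (semi x) *\<^sub>R x"
    have "semi ((T ^^ (2 * n)) ?x) = inverse (semi x) * semi ((T ^^ (2 * n)) x)"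
      using pos by (simp add: linear_scale[OF pl] semi_scale)
    also have "\<dots> > inverse (semi x) * ((1 - inverse (real (Suc n))) * semi x)"
      using x pos by (intro mult_strict_left_mono) auto
    also have "inverse (semi x) * ((1 - inverse (real (Suc n))) * semi x) = 1 - inverse (real (Suc n))"
    proof -
      have "inverse u * (c * u) = c" if "u > 0" for u c :: real using that by simp
      from this[OF pos] show ?thesis .
    qed
    finally have "semi ((T ^^ (2 * n)) ?x) > 1 - inverse (real (Suc n))" .
    moreover have "semi ?x = 1" using \<open>semi x \<noteq> 0\<close> by (simp add: semi_scale)
    ultimately show ?thesis by blast
  qed
  then obtain x where x: "\<And>n. semi (x n) = 1"
    "\<And>n. semi ((T ^^ (2 * n)) (x n)) > 1 - inverse (real (Suc n))" by metis
  \<comment> \<open>For \<open>i \<le> n\<close> the vector \<open>Y i n\<close> lies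
    \<open>i\<close> steps before the candidate \<open>Y 0 n\<close> on the same orbit.\<close>
  define Y where "Y i n = (T ^^ (n - i)) (x n)" for i n
  have Y1: "semi (Y i n) \<le> 1" for i n using pc[of "n - i" "x n"] x(1)[of n] by (simp add: Y_def)
  have YS: "Y i n = T (Y (Suc i) n)" if "n \<ge> Suc i" for i n
  proof -
    have "n - i = Suc (n - Suc i)" using that by simp
    then show ?thesis by (simp add: Y_def)
  qed
  \<comment> \<open>One diagonal subsequence serves all depths \<open>i\<close>.\<close>
  interpret S: subseqs "\<lambda>i s. Cauchy_wrt k (Y (Suc i) \<circ> s)"
  proof
    fix i and s :: "nat \<Rightarrow> nat"
    have "\<forall>n. semi ((Y (Suc i) \<circ> s) n) \<le> 1" using Y1 by simp
    then show "\<exists>r'. strict_mono r' \<and> Cauchy_wrt k (Y (Suc i) \<circ> (s \<circ> r'))"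
      using comp unfolding precompact_wrt_def by (metis comp_assoc)
  qed
  define d where "d = S.diagseq"
  have d_mono: "strict_mono d" unfolding d_def by (rule S.subseq_diagseq)
  have d_ge: "n \<le> d n" for n by (rule seq_suble[OF d_mono])
  have kC: "\<exists>N. \<forall>m\<ge>N. \<forall>n\<ge>N. k (Y (Suc i) (d m) - Y (Suc i) (d n)) < \<epsilon>" if "\<epsilon> > 0" for i \<epsilon>
  proof -
    \<comment> \<open>The diagonal sequence is a subsequence of the choice made at stage
      \<open>i\<close> only from index \<open>Suc i\<close> on.\<close>
    have "Cauchy_wrt k (Y (Suc i) \<circ> (d \<circ> (+) (Suc i)))" unfolding d_def
      by (rule S.diagseq_holds) (metis Cauchy_wrt_subseq comp_assoc)
    from Cauchy_wrtD[OF this that] obtain N where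
      N: "\<forall>m\<ge>N. \<forall>n\<ge>N. k (Y (Suc i) (d (Suc i + m)) - Y (Suc i) (d (Suc i + n))) < \<epsilon>"
      by (auto simp: o_def)
    have "k (Y (Suc i) (d m) - Y (Suc i) (d n)) < \<epsilon>" if "m \<ge> Suc i + N" "n \<ge> Suc i + N" for m n
      using N[rule_format, of "m - Suc i" "n - Suc i"] that by simp
    then show ?thesis by blast
  qed
  \<comment> \<open>Going back \<open>I\<close> steps gains the factor \<open>q ^ I\<close>, while
    the values of \<open>k\<close> met on the way become small along the diagonal.\<close>
  have chain: "\<exists>N. \<forall>m\<ge>N. \<forall>n\<ge>N. semi (Y 0 (d m) - Y 0 (d n)) \<le> q ^ I * semi (Y I (d m) - Y I (d n)) + \<delta>"
    if "\<delta> > 0" for I \<delta>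
    using that
  proof (induction I arbitrary: \<delta>)
    case (Suc I)
    then have "\<delta> / 2 > 0" by simp
    from Suc.IH[OF this] kC[OF this, of I] obtain N N' where
      N: "\<And>m n. m \<ge> N \<Longrightarrow> n \<ge> N \<Longrightarrow> semi (Y 0 (d m) - Y 0 (d n)) \<le> q ^ I * semi (Y I (d m) - Y I (d n)) + \<delta> / 2"
      and N': "\<And>m n. m \<ge> N' \<Longrightarrow> n \<ge> N' \<Longrightarrow> k (Y (Suc I) (d m) - Y (Suc I) (d n)) < \<delta> / 2" by blast
    have "semi (Y 0 (d m) - Y 0 (d n)) \<le> q ^ Suc I * semi (Y (Suc I) (d m) - Y (Suc I) (d n)) + \<delta>"
      if "m \<ge> N + N' + Suc I" "n \<ge> N + N' + Suc I" for m n
    proof -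
      let ?u = "Y (Suc I) (d m) - Y (Suc I) (d n)"
      have "Y I (d m) - Y I (d n) = T ?u"
        using YS[of I "d m"] YS[of I "d n"] d_ge[of m] d_ge[of n] that linear_diff[OF lin] by simp
      then have "semi (Y I (d m) - Y I (d n)) \<le> q * semi ?u + k ?u" using Tk by simp
      then have "q ^ I * semi (Y I (d m) - Y I (d n)) \<le> q ^ I * (q * semi ?u + k ?u)"
        using q by (intro mult_left_mono) auto
      also have "\<dots> = q ^ Suc I * semi ?u + q ^ I * k ?u" by (simp add: algebra_simps)
      also have "q ^ I * k ?u \<le> \<delta> / 2"
      proof -
        have "q ^ I \<le> 1" "0 \<le> q ^ I" using q by (auto intro: power_le_one)
        moreover have "k ?u < \<delta> / 2" using N'[of m n] that by simp
        ultimately show ?thesis using \<open>\<delta> / 2 > 0\<close>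
          by (smt (verit, best) mult_left_le_one_le mult_nonneg_nonpos)
      qed
      finally show ?thesis using N[of m n] that by simp
    qed
    then show ?case by blast
  qed (auto simp: less_imp_le)
  have "convergent (\<lambda>n. Y 0 (d n))"
  proof (rule semi_Cauchy_convergent)
    fix \<epsilon> :: real assume \<epsilon>: "\<epsilon> > 0"
    obtain I where I: "q ^ I < \<epsilon> / 4" using real_arch_pow_inv[of "\<epsilon> / 4" q] q \<epsilon> by auto
    obtain N where N: "\<And>m n. m \<ge> N \<Longrightarrow> n \<ge> N \<Longrightarrow> semi (Y 0 (d m) - Y 0 (d n)) \<le> q ^ I * semi (Y I (d m) - Y I (d n)) + \<epsilon> / 2"
      using chain[of "\<epsilon> / 2" I] \<epsilon> by auto
    have "semi (Y 0 (d m) - Y 0 (d n)) < \<epsilon>" if "m \<ge> N" "n \<ge> N" for m n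
    proof -
      have "semi (Y I (d m) - Y I (d n)) \<le> 2"
        using semi_triangle_diff[of "Y I (d m)" "Y I (d n)"] Y1[of I "d m"] Y1[of I "d n"] by simp
      then have "q ^ I * semi (Y I (d m) - Y I (d n)) \<le> q ^ I * 2"
        using q by (intro mult_left_mono) auto
      then show ?thesis using N[OF that] I by simp
    qed
    then show "\<exists>N. \<forall>m\<ge>N. \<forall>n\<ge>N. semi (Y 0 (d m) - Y 0 (d n)) < \<epsilon>" by blast
  qed
  then obtain y where y: "(\<lambda>n. Y 0 (d n)) \<longlonglongrightarrow> y" by (auto simp: convergent_def)
  have "1 \<le> semi ((T ^^ j) y)" for j
  proof -
    have l: "(\<lambda>n. semi (Y 0 (d n) - y)) \<longlonglongrightarrow> 0" using tendsto_semi[OF LIM_zero[OF y]] by simp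
    have "(\<lambda>n. 1 - inverse (real (Suc n)) - semi (Y 0 (d n) - y)) \<longlonglongrightarrow> 1 - 0 - 0"
      by (intro tendsto_intros l LIMSEQ_inverse_real_of_nat)
    then have lim: "(\<lambda>n. 1 - inverse (real (Suc n)) - semi (Y 0 (d n) - y)) \<longlonglongrightarrow> 1" by simp
    have "1 - inverse (real (Suc n)) - semi (Y 0 (d n) - y) \<le> semi ((T ^^ j) y)" if "n \<ge> j" for n
    proof -
      have dn: "d n \<ge> n" "d n \<ge> j" using d_ge[of n] that by auto
      \<comment> \<open>Only \<open>d n - j\<close> of the steps come after
        \<open>(T ^^ j) (Y 0 (d n))\<close>, and these do not increase \<open>semi\<close>.\<close>
      have "(T ^^ (2 * d n)) (x (d n)) = (T ^^ (d n - j)) ((T ^^ j) (Y 0 (d n)))"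
      proof -
        have "2 * d n = (d n - j) + (j + d n)" using dn by simp
        then show ?thesis by (simp only: Y_def funpow_add comp_apply diff_zero)
      qed
      then have "semi ((T ^^ (2 * d n)) (x (d n))) \<le> semi ((T ^^ j) (Y 0 (d n)))" using pc by simp
      also have "(T ^^ j) (Y 0 (d n)) = (T ^^ j) y + (T ^^ j) (Y 0 (d n) - y)"
        using linear_diff[OF pl, of j "Y 0 (d n)" y] by simp
      also have "semi \<dots> \<le> semi ((T ^^ j) y) + semi (Y 0 (d n) - y)"
        using semi_triangle pc by (meson add_left_mono order_trans)
      finally have "semi ((T ^^ (2 * d n)) (x (d n))) \<le> semi ((T ^^ j) y) + semi (Y 0 (d n) - y)" .
      moreover have "inverse (real (Suc (d n))) \<le> inverse (real (Suc n))" using dn by auto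
      ultimately show ?thesis using x(2)[of "d n"] by linarith
    qed
    then show ?thesis by (intro LIMSEQ_le_const2[OF lim]) blast
  qed
  moreover have "semi y \<le> 1"
    by (rule LIMSEQ_le_const2[OF tendsto_semi[OF y]]) (use Y1 in blast)
  ultimately have "semi ((T ^^ j) y) = semi y" "semi y = 1" for j
    using pc[of j y] order_trans by (smt (verit, best) pc)+
  then have "y \<noteq> 0 \<and> (\<forall>n. semi ((T ^^ n) y) = semi y)" by force
  then show ?thesis by blast
qed blast

end

context dissipative
begin

text \<open>The form \<open>\<beta>\<close> is kept separate from \<open>b\<close>, because the
  strict contraction will be obtained in a graph norm.\<close>

lemma exponential_decay:
  fixes \<beta> :: "'a \<Rightarrow> 'a \<Rightarrow> real"
  assumes \<beta>: "coercive_form \<beta>"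
    and contr: "\<And>t x. t \<ge> 0 \<Longrightarrow> \<beta> (flow t x) (flow t x) \<le> \<beta> x x"
    and \<tau>: "\<tau> > 0" and r: "r < 1" and dec: "\<And>x. \<beta> (flow \<tau> x) (flow \<tau> x) \<le> r * \<beta> x x"
  shows "\<exists>M \<omega>. 1 \<le> M \<and> 0 < \<omega> \<and> (\<forall>t\<ge>0. \<forall>x. norm (flow t x) \<le> M * exp (- \<omega> * t) * norm x)"
proof -
  interpret B: coercive_form \<beta> by (rule \<beta>)
  \<comment> \<open>The lower bound 1/2 keeps \<open>ln \<rho>\<close> meaningful when
    \<open>r\<close> is not positive.\<close>
  define \<rho> where "\<rho> = max r (1 / 2)"
  have \<rho>: "0 < \<rho>" "\<rho> < 1" "r \<le> \<rho>" using r by (auto simp: \<rho>_def)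
  \<comment> \<open>The 2 is there because \<open>\<beta>\<close> is quadratic, so its rate is twice
    that of the norm.\<close>
  define \<omega> where "\<omega> = - ln \<rho> / (2 * \<tau>)"
  have \<omega>: "\<omega> > 0" using \<rho> \<tau> by (simp add: \<omega>_def divide_neg_pos)
  obtain K where K: "K > 0" "\<And>x. norm x \<le> K * B.semi x" using B.norm_le_semi by blast
  obtain K' where K': "K' > 0" "\<And>x. B.semi x \<le> K' * norm x" using B.semi_bound by blast
  have step: "\<beta> (flow (real k * \<tau>) x) (flow (real k * \<tau>) x) \<le> \<rho> ^ k * \<beta> x x" for k x
  proof (induction k)
    case (Suc k)
    have "flow (real (Suc k) * \<tau>) x = flow \<tau> (flow (real k * \<tau>) x)"
      using flow_add[of \<tau> "real k * \<tau>" x] \<tau> by (simp add: algebra_simps)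
    then have "\<beta> (flow (real (Suc k) * \<tau>) x) (flow (real (Suc k) * \<tau>) x)
        \<le> r * \<beta> (flow (real k * \<tau>) x) (flow (real k * \<tau>) x)" using dec by simp
    also have "\<dots> \<le> \<rho> * \<beta> (flow (real k * \<tau>) x) (flow (real k * \<tau>) x)"
      using \<rho>(3) B.nonneg by (intro mult_right_mono) auto
    also have "\<dots> \<le> \<rho> * (\<rho> ^ k * \<beta> x x)" using Suc \<rho> by (intro mult_left_mono) auto
    finally show ?case by simp
  qed simp
  have main: "norm (flow t x) \<le> (K * K' / sqrt \<rho>) * exp (- \<omega> * t) * norm x" if t: "t \<ge> 0" for t x
  proof -
    define k where "k = nat \<lfloor>t / \<tau>\<rfloor>"
    have k: "real k \<le> t / \<tau>" "t / \<tau> < real k + 1" using t \<tau> unfolding k_def by auto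
    then have kt: "real k * \<tau> \<le> t" using \<tau> by (simp add: field_simps)
    have "flow t x = flow (t - real k * \<tau>) (flow (real k * \<tau>) x)"
      using flow_add[of "t - real k * \<tau>" "real k * \<tau>" x] kt \<tau> by simp
    then have "\<beta> (flow t x) (flow t x) \<le> \<rho> ^ k * \<beta> x x"
      using order_trans[OF contr[of "t - real k * \<tau>" "flow (real k * \<tau>) x"] step] kt by simp
    \<comment> \<open>Rounding \<open>t / \<tau>\<close> down loses at most one period, which costs
      the factor \<open>1 / \<rho>\<close>.\<close>
    also have "\<rho> ^ k \<le> exp (- \<omega> * t) * exp (- \<omega> * t) / \<rho>"
    proof -
      have "exp (- \<omega> * t) * exp (- \<omega> * t) = exp (ln \<rho> * (t / \<tau>))"
        by (simp add: \<omega>_def exp_add[symmetric] field_simps)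
      moreover have "ln \<rho> * (real k + 1) \<le> ln \<rho> * (t / \<tau>)"
        using k(2) \<rho> by (intro mult_left_mono_neg) auto
      ultimately have "exp (ln \<rho> * real (Suc k)) \<le> exp (- \<omega> * t) * exp (- \<omega> * t)" by (simp add: add.commute)
      also have "exp (ln \<rho> * real (Suc k)) = \<rho> ^ Suc k"
        using \<rho> exp_of_nat_mult[of "Suc k" "ln \<rho>"] by (simp add: mult.commute)
      finally show ?thesis using \<rho> by (simp add: field_simps)
    qed
    finally have "\<beta> (flow t x) (flow t x) \<le> (exp (- \<omega> * t) * exp (- \<omega> * t) / \<rho>) * \<beta> x x"
      using B.nonneg by (simp add: mult_right_mono)
    then have "B.semi (flow t x) \<le> sqrt ((exp (- \<omega> * t) * exp (- \<omega> * t) / \<rho>) * \<beta> x x)"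
      by (simp add: B.semi_def)
    also have "\<dots> = exp (- \<omega> * t) / sqrt \<rho> * B.semi x"
      by (simp add: B.semi_def real_sqrt_mult real_sqrt_divide)
    finally have 1: "B.semi (flow t x) \<le> exp (- \<omega> * t) / sqrt \<rho> * B.semi x" .
    have "norm (flow t x) \<le> K * B.semi (flow t x)" by (rule K(2))
    also have "\<dots> \<le> K * (exp (- \<omega> * t) / sqrt \<rho> * B.semi x)" using K 1 by (intro mult_left_mono) auto
    also have "\<dots> \<le> K * (exp (- \<omega> * t) / sqrt \<rho> * (K' * norm x))"
      using K K' \<rho> by (intro mult_left_mono) auto
    finally show ?thesis by (simp add: algebra_simps)
  qed
  show ?thesis
  proof (rule exI[of _ "max 1 (K * K' / sqrt \<rho>)"], rule exI[of _ \<omega>], intro conjI allI impI)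
    fix t x assume "t \<ge> (0::real)"
    then have "norm (flow t x) \<le> (K * K' / sqrt \<rho>) * exp (- \<omega> * t) * norm x" by (rule main)
    also have "\<dots> \<le> max 1 (K * K' / sqrt \<rho>) * exp (- \<omega> * t) * norm x"
      by (intro mult_right_mono) auto
    finally show "norm (flow t x) \<le> max 1 (K * K' / sqrt \<rho>) * exp (- \<omega> * t) * norm x" .
  qed (use \<omega> in auto)
qed

end

section \<open>Abstract damped wave equations\<close>

lemma sym_form_inner: "sym_form ((\<bullet>) :: 'a::real_inner \<Rightarrow> 'a \<Rightarrow> real)"
  by (auto simp: sym_form_def bounded_bilinear_inner intro: inner_commute)

lemma bounded_bilinear_add:
  assumes "bounded_bilinear b" "bounded_bilinear c"
  shows "bounded_bilinear (\<lambda>x y. b x y + c x y)"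
proof -
  interpret b: bounded_bilinear b by fact
  interpret c: bounded_bilinear c by fact
  obtain K where K: "\<And>x y. norm (b x y) \<le> norm x * norm y * K" using b.bounded by blast
  obtain L where L: "\<And>x y. norm (c x y) \<le> norm x * norm y * L" using c.bounded by blast
  show ?thesis
  proof
    show "\<exists>K. \<forall>x y. norm (b x y + c x y) \<le> norm x * norm y * K"
    proof (intro exI allI)
      fix x y
      have "norm (b x y + c x y) \<le> norm (b x y) + norm (c x y)" by (rule norm_triangle_ineq)
      also have "\<dots> \<le> norm x * norm y * K + norm x * norm y * L" by (intro add_mono K L)
      finally show "norm (b x y + c x y) \<le> norm x * norm y * (K + L)" by (simp add: distrib_left)
    qed
  qed (simp_all add: b.add_left b.add_right c.add_left c.add_right b.scaleR_left b.scaleR_right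
      c.scaleR_left c.scaleR_right scaleR_add_right)
qed

lemma bounded_bilinear_scale:
  fixes b :: "'a::real_normed_vector \<Rightarrow> 'c::real_normed_vector \<Rightarrow> real"
  assumes "bounded_bilinear b" shows "bounded_bilinear (\<lambda>x y. r * b x y)"
proof -
  interpret b: bounded_bilinear b by fact
  obtain K where K: "\<And>x y. norm (b x y) \<le> norm x * norm y * K" using b.bounded by blast
  show ?thesis
  proof
    show "\<exists>K. \<forall>x y. norm (r * b x y) \<le> norm x * norm y * K"
    proof (intro exI allI)
      fix x y
      have "norm (r * b x y) \<le> \<bar>r\<bar> * (norm x * norm y * K)"
        using K[of x y] by (simp add: abs_mult mult_left_mono)
      then show "norm (r * b x y) \<le> norm x * norm y * (\<bar>r\<bar> * K)" by (simp add: algebra_simps)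
    qed
  qed (simp_all add: b.add_left b.add_right b.scaleR_left b.scaleR_right algebra_simps)
qed

lemma sym_form_add:
  assumes "sym_form b" "sym_form c" shows "sym_form (\<lambda>x y. b x y + c x y)"
  using assms by (auto simp: sym_form_def intro: bounded_bilinear_add)

lemma sym_form_scale:
  assumes "sym_form b" "0 \<le> r" shows "sym_form (\<lambda>x y. r * b x y)"
  using assms by (auto simp: sym_form_def intro: bounded_bilinear_scale)

lemma sym_form_compose:
  assumes "sym_form b" "bounded_linear P" shows "sym_form (\<lambda>x y. b (P x) (P y))"
  using assms by (auto simp: sym_form_def intro: bounded_bilinear.comp)

lemma coercive_formI:
  assumes "sym_form b" "c > 0" "\<And>x. c * (norm x)\<^sup>2 \<le> b x x" shows "coercive_form b"
  using assms by (auto simp: coercive_form_def coercive_form_axioms_def)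

lemma has_vector_derivative_scaleR_left:
  assumes "(f has_real_derivative d) F"
  shows "((\<lambda>t. f t *\<^sub>R v) has_vector_derivative d *\<^sub>R v) F"
  using bounded_linear.has_vector_derivative[OF bounded_linear_scaleR_left] assms
  unfolding has_real_derivative_iff_has_vector_derivative by blast

text \<open>A pair lies in the graph exactly when the bounded operator \<open>Res 1\<close> maps
  \<open>x - a\<close> to \<open>x\<close>, and this condition passes to limits.\<close>

lemma (in dissipative) G_closed:
  assumes "\<And>n. (X n, A n) \<in> G" "X \<longlonglongrightarrow> x" "A \<longlonglongrightarrow> a" shows "(x, a) \<in> G"
proof -
  have R: "bounded_linear (Res 1)"
    by (intro bounded_linear_of_contraction Res_linear Res_semi) simp_all
  have "(\<lambda>n. Res 1 (X n - A n)) \<longlonglongrightarrow> Res 1 (x - a)"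
    by (intro bounded_linear.tendsto[OF R] tendsto_diff assms)
  moreover have "Res 1 (X n - A n) = X n" for n using Res_unique[OF assms(1), of 1] by simp
  ultimately have x: "Res 1 (x - a) = x" using assms(2) LIMSEQ_unique by simp
  obtain c where "(Res 1 (x - a), c) \<in> G" "Res 1 (x - a) - 1 *\<^sub>R c = x - a"
    using Res_ex[of 1 "x - a"] by auto
  with x show ?thesis by simp
qed

lemma (in dissipative) Res_1_G: "(Res 1 v, Res 1 v - v) \<in> G"
proof -
  obtain c where "(Res 1 v, c) \<in> G" "Res 1 v - 1 *\<^sub>R c = v" using Res_ex[of 1 v] by auto
  moreover from this(2) have "c = Res 1 v - v" by (simp add: algebra_simps)
  ultimately show ?thesis by simp
qed

text \<open>\<open>J\<close> stands for the embedding of V^N in H^N, and \<open>J_dual_dense\<close>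
  expresses density of H^N in the dual of V^N by functionals. The form \<open>\<alpha>\<close> lives
  on \<open>'b\<close>, since \<open>A\<close> is a term of order zero, whereas
  \<open>\<gamma>\<close> lives on \<open>'a\<close>, since the damping maps V only into its
  dual.\<close>

locale wave =
  fixes J :: "'a::{real_inner,banach} \<Rightarrow> 'b::{real_inner,banach}"
    and \<alpha> :: "'b \<Rightarrow> 'b \<Rightarrow> real" and \<gamma> :: "'a \<Rightarrow> 'a \<Rightarrow> real"
  assumes J_linear: "bounded_linear J"
    and J_dense: "closure (range J) = UNIV"
    and J_dual_dense: "bounded_linear l \<Longrightarrow> \<epsilon> > 0 \<Longrightarrow> \<exists>F. \<forall>\<phi>. \<bar>l \<phi> - F \<bullet> J \<phi>\<bar> \<le> \<epsilon> * norm \<phi>"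
    and J_compact: "precompact_wrt norm (\<lambda>u. norm (J u))"
    and \<alpha>_form: "sym_form \<alpha>" and \<gamma>_form: "sym_form \<gamma>"
begin

interpretation J: bounded_linear J by (rule J_linear)
interpretation A: sym_form \<alpha> by (rule \<alpha>_form)
interpretation C: sym_form \<gamma> by (rule \<gamma>_form)

definition energy :: "'a \<times> 'b \<Rightarrow> 'a \<times> 'b \<Rightarrow> real" where
  "energy x y = x \<bullet> y + \<alpha> (J (fst x)) (J (fst y))"

text \<open>The equation in the dual space is tested against all \<open>\<phi>\<close>, which is the
  shape that \<open>lax_milgram\<close> solves.\<close>

definition wave_op :: "(('a \<times> 'b) \<times> ('a \<times> 'b)) set" where
  "wave_op = {((U, J Z), (Z, - F)) | U Z F. \<forall>\<phi>. U \<bullet> \<phi> + \<alpha> (J U) (J \<phi>) + \<gamma> Z \<phi> = F \<bullet> J \<phi>}"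

lemma wave_opI:
  assumes "\<And>\<phi>. U \<bullet> \<phi> + \<alpha> (J U) (J \<phi>) + \<gamma> Z \<phi> = F \<bullet> J \<phi>"
  shows "((U, J Z), (Z, - F)) \<in> wave_op"
  using assms by (auto simp: wave_op_def)

lemma wave_opE:
  assumes "(x, a) \<in> wave_op"
  obtains U Z F where "x = (U, J Z)" "a = (Z, - F)" "\<And>\<phi>. U \<bullet> \<phi> + \<alpha> (J U) (J \<phi>) + \<gamma> Z \<phi> = F \<bullet> J \<phi>"
  using assms unfolding wave_op_def by blast

text \<open>The equation is tested with the velocity \<open>Z\<close>, which cancels the elastic
  terms.\<close>

lemma energy_dissipation:
  assumes "(x, a) \<in> wave_op" shows "energy x a = - \<gamma> (fst a) (fst a)"
proof -
  obtain U Z F where *: "x = (U, J Z)" "a = (Z, - F)" "\<And>\<phi>. U \<bullet> \<phi> + \<alpha> (J U) (J \<phi>) + \<gamma> Z \<phi> = F \<bullet> J \<phi>"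
    using wave_opE[OF assms] by blast
  then show ?thesis using *(3)[of Z] by (simp add: energy_def inner_commute)
qed

lemma energy_coercive: "coercive_form energy"
proof (rule coercive_formI)
  show "sym_form energy"
    unfolding energy_def
    by (intro sym_form_add sym_form_inner sym_form_compose[OF \<alpha>_form]
        bounded_linear_compose[OF J_linear] bounded_linear_fst)
  show "1 * (norm x)\<^sup>2 \<le> energy x x" for x
    using A.nonneg by (simp add: energy_def power2_norm_eq_inner)
qed simp

lemma dissipative_wave_op: "dissipative energy wave_op"
proof -
  interpret E: coercive_form energy by (rule energy_coercive)
  have b0: "sym_form (\<lambda>U \<phi>. U \<bullet> \<phi> + \<alpha> (J U) (J \<phi>))"
    by (intro sym_form_add sym_form_inner sym_form_compose[OF \<alpha>_form] J_linear)
  have lJ: "bounded_linear (\<lambda>\<phi>. k \<bullet> J \<phi>)" for k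
    using bounded_linear_compose[OF bounded_linear_inner_right J_linear] .
  have l\<alpha>: "bounded_linear (\<lambda>\<phi>. \<alpha> k (J \<phi>))" for k
    using bounded_linear_compose[OF bounded_bilinear.bounded_linear_right[OF A.bilinear] J_linear] .
  have l\<gamma>: "bounded_linear (\<gamma> Z)" for Z
    by (rule bounded_bilinear.bounded_linear_right[OF C.bilinear])
  show ?thesis
  proof
    show "subspace wave_op"
      unfolding subspace_def
    proof (intro conjI ballI allI)
      show "0 \<in> wave_op"
        using wave_opI[of 0 0 0] by (simp add: J.zero A.form_simps C.form_simps zero_prod_def)
      fix p q assume "p \<in> wave_op" "q \<in> wave_op"
      then obtain U Z F U' Z' F' where
        p: "p = ((U, J Z), (Z, - F))" "\<And>\<phi>. U \<bullet> \<phi> + \<alpha> (J U) (J \<phi>) + \<gamma> Z \<phi> = F \<bullet> J \<phi>" and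
        q: "q = ((U', J Z'), (Z', - F'))" "\<And>\<phi>. U' \<bullet> \<phi> + \<alpha> (J U') (J \<phi>) + \<gamma> Z' \<phi> = F' \<bullet> J \<phi>"
        unfolding wave_op_def by blast
      have "((U + U', J (Z + Z')), (Z + Z', - (F + F'))) \<in> wave_op"
        by (rule wave_opI) (simp add: J.add A.form_simps C.form_simps inner_add_left flip: p(2) q(2))
      then show "p + q \<in> wave_op" by (simp add: p q J.add)
      fix c
      have "((c *\<^sub>R U, J (c *\<^sub>R Z)), (c *\<^sub>R Z, - (c *\<^sub>R F))) \<in> wave_op"
        by (rule wave_opI) (simp add: J.scaleR A.form_simps C.form_simps flip: p(2) distrib_left)
      then show "c *\<^sub>R p \<in> wave_op" by (simp add: p J.scaleR)
    qed
    show "energy x a \<le> 0" if "(x, a) \<in> wave_op" for x a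
      using energy_dissipation[OF that] C.nonneg by simp
    show "\<exists>x a. (x, a) \<in> wave_op \<and> x - h *\<^sub>R a = y" if h: "h > 0" for h y
    proof -
      obtain f k where y: "y = (f, k)" by fastforce
      \<comment> \<open>Eliminating \<open>U = f + h *\<^sub>R Z\<close> from the resolvent equation
        and multiplying by \<open>h\<close> leaves an equation for \<open>Z\<close> with this form,
        which is coercive through \<open>h\<^sup>2 * (Z \<bullet> \<phi>)\<close>.\<close>
      define b2 where "b2 Z \<phi> = J Z \<bullet> J \<phi> + (h\<^sup>2 * (Z \<bullet> \<phi> + \<alpha> (J Z) (J \<phi>)) + h * \<gamma> Z \<phi>)" for Z \<phi>
      define l where "l \<phi> = k \<bullet> J \<phi> - h * (f \<bullet> \<phi> + \<alpha> (J f) (J \<phi>))" for \<phi>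
      have "coercive_form b2"
      proof (rule coercive_formI)
        show "sym_form b2" unfolding b2_def
          by (intro sym_form_add sym_form_scale sym_form_compose[OF sym_form_inner] b0 J_linear \<gamma>_form)
            (use h in auto)
        show "0 < h\<^sup>2" using h by simp
        show "h\<^sup>2 * (norm x)\<^sup>2 \<le> b2 x x" for x
          unfolding b2_def power2_norm_eq_inner
          using h A.nonneg[of "J x"] C.nonneg[of x] inner_ge_zero[of "J x"]
            mult_nonneg_nonneg[of "h\<^sup>2" "\<alpha> (J x) (J x)"] mult_nonneg_nonneg[of h "\<gamma> x x"]
          by (simp add: distrib_left)
      qed
      moreover have "bounded_linear l" unfolding l_def
        by (intro bounded_linear_sub bounded_linear_const_mult bounded_linear_add lJ l\<alpha> bounded_linear_inner_right)
      ultimately obtain Z where Z: "\<And>\<phi>. b2 Z \<phi> = l \<phi>"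
        using coercive_form.lax_milgram by blast
      define F where "F = (k - J Z) /\<^sub>R h"
      have hF: "h * (F \<bullet> y) = (k - J Z) \<bullet> y" for y using h by (simp add: F_def)
      have "((f + h *\<^sub>R Z, J Z), (Z, - F)) \<in> wave_op"
      proof (rule wave_opI)
        fix \<phi>
        have "h * ((f + h *\<^sub>R Z) \<bullet> \<phi> + \<alpha> (J (f + h *\<^sub>R Z)) (J \<phi>) + \<gamma> Z \<phi>) = h * (F \<bullet> J \<phi>)"
          unfolding hF using Z[of \<phi>]
          by (simp add: b2_def l_def J.add J.scaleR A.form_simps inner_add_left inner_diff_left
              algebra_simps power2_eq_square)
        then show "(f + h *\<^sub>R Z) \<bullet> \<phi> + \<alpha> (J (f + h *\<^sub>R Z)) (J \<phi>) + \<gamma> Z \<phi> = F \<bullet> J \<phi>" using h by simp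
      qed
      moreover have "(f + h *\<^sub>R Z, J Z) - h *\<^sub>R (Z, - F) = y" using h by (simp add: y F_def)
      ultimately show ?thesis by blast
    qed
    show "closure (fst ` wave_op) = UNIV"
    proof (intro equalityI subsetI)
      fix y :: "'a \<times> 'b"
      obtain f k where y: "y = (f, k)" by fastforce
      show "y \<in> closure (fst ` wave_op)"
        unfolding closure_approachable
      proof (intro allI impI)
        fix \<epsilon> :: real assume \<epsilon>: "\<epsilon> > 0"
        have "k \<in> closure (range J)" using J_dense by simp
        then obtain Z where Z: "norm (J Z - k) < \<epsilon> / 2"
          using \<epsilon> unfolding closure_approachable dist_norm by (metis half_gt_zero rangeE)
        \<comment> \<open>The functional that \<open>F\<close> would have to represent if the first
          component were exactly \<open>f\<close>. It is replaced by a nearby functional that comes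
          from H^N, and the first component is then solved for again.\<close>
        define l where "l \<phi> = (f \<bullet> \<phi> + \<alpha> (J f) (J \<phi>)) + \<gamma> Z \<phi>" for \<phi>
        have "bounded_linear l" unfolding l_def
          by (intro bounded_linear_add l\<alpha> l\<gamma> bounded_linear_inner_right)
        then obtain F where F: "\<And>\<phi>. \<bar>l \<phi> - F \<bullet> J \<phi>\<bar> \<le> \<epsilon> / 3 * norm \<phi>"
          using J_dual_dense[of l "\<epsilon> / 3"] \<epsilon> by auto
        have "coercive_form (\<lambda>U \<phi>. U \<bullet> \<phi> + \<alpha> (J U) (J \<phi>))"
          by (rule coercive_formI[OF b0, of 1]) (use A.nonneg in \<open>auto simp: power2_norm_eq_inner\<close>)
        moreover have "bounded_linear (\<lambda>\<phi>. F \<bullet> J \<phi> - \<gamma> Z \<phi>)"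
          by (intro bounded_linear_sub lJ l\<gamma>)
        ultimately obtain U where U: "\<And>\<phi>. U \<bullet> \<phi> + \<alpha> (J U) (J \<phi>) = F \<bullet> J \<phi> - \<gamma> Z \<phi>"
          using coercive_form.lax_milgram by blast
        have in_W: "((U, J Z), (Z, - F)) \<in> wave_op" by (rule wave_opI) (simp add: U)
        have "norm (U - f) * norm (U - f) \<le> (U - f) \<bullet> (U - f) + \<alpha> (J (U - f)) (J (U - f))"
          using A.nonneg by (simp flip: power2_norm_eq_inner power2_eq_square)
        also have "\<dots> = (U \<bullet> (U - f) + \<alpha> (J U) (J (U - f))) - (f \<bullet> (U - f) + \<alpha> (J f) (J (U - f)))"
          by (simp add: J.diff A.form_simps inner_diff_left)
        also have "\<dots> = F \<bullet> J (U - f) - l (U - f)" by (simp only: U l_def)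
        also have "\<dots> \<le> \<epsilon> / 3 * norm (U - f)" using F[of "U - f"] by (simp only: abs_le_iff) argo
        finally have "norm (U - f) \<le> \<epsilon> / 3"
          by (metis \<epsilon> less_eq_real_def mult_right_le_imp_le norm_ge_zero zero_less_divide_iff zero_less_numeral)
        have "dist (U, J Z) y \<le> norm (U - f) + norm (J Z - k)"
          unfolding y dist_norm by (simp add: norm_Pair sqrt_sum_squares_le_sum)
        also have "\<dots> < \<epsilon>" using Z \<open>norm (U - f) \<le> \<epsilon> / 3\<close> \<epsilon> by simp
        finally show "\<exists>x\<in>fst ` wave_op. dist x y < \<epsilon>" using in_W by force
      qed
    qed simp
  qed
qed

end

sublocale wave \<subseteq> dissipative energy wave_op
  by (rule dissipative_wave_op)

context wave
begin

interpretation J: bounded_linear J by (rule J_linear)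
interpretation A: sym_form \<alpha> by (rule \<alpha>_form)
interpretation C: sym_form \<gamma> by (rule \<gamma>_form)

section \<open>Time regularity of mild orbits\<close>

lemma norm_le_energy: "norm x \<le> semi x"
proof -
  have "(norm x)\<^sup>2 \<le> (semi x)\<^sup>2"
    using A.nonneg by (simp add: semi_sq energy_def power2_norm_eq_inner)
  then show ?thesis by (rule power2_le_imp_le) simp
qed

lemma norm_fst_semi: "norm (fst x) \<le> semi x"
  using order_trans[OF norm_fst_le[of "fst x" "snd x"]] norm_le_energy[of x] by simp

lemma norm_snd_semi: "norm (snd x) \<le> semi x"
  using order_trans[OF norm_snd_le[of "snd x" "fst x"]] norm_le_energy[of x] by simp

lemma wave_op_snd: "(x, a) \<in> wave_op \<Longrightarrow> snd x = J (fst a)"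
  by (auto elim!: wave_opE)

lemma bounded_linear_J_flow: "t \<ge> 0 \<Longrightarrow> bounded_linear (\<lambda>x. J (fst (flow t x)))"
  by (intro bounded_linear_compose[OF J_linear] bounded_linear_compose[OF bounded_linear_fst] flow_bounded_linear)

text \<open>Comparison with motion at a constant velocity \<open>\<eta>\<close>:
  \<open>\<eta> = 0\<close> yields the Lipschitz bound, the velocity at a given time yields the
  derivative. As the bound survives approximation by orbits in the domain, it covers orbits that are
  merely continuous in the state space.\<close>

lemma J_flow_increment:
  assumes st: "0 \<le> s" "s \<le> t" and bd: "\<And>r. s \<le> r \<Longrightarrow> r \<le> t \<Longrightarrow> norm (snd (flow r x) - \<eta>) \<le> \<delta>"
  shows "norm (J (fst (flow t x)) - J (fst (flow s x)) - (t - s) *\<^sub>R \<eta>) \<le> \<delta> * (t - s)"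
proof -
  have dom: "norm (J (fst (flow t x)) - J (fst (flow s x)) - (t - s) *\<^sub>R \<eta>) \<le> \<delta> * (t - s)"
    if xa: "(x, a) \<in> wave_op" and bd: "\<And>r. s \<le> r \<Longrightarrow> r \<le> t \<Longrightarrow> norm (snd (flow r x) - \<eta>) \<le> \<delta>" for x a \<delta>
  proof -
    \<comment> \<open>Testing with the increment itself reduces the vector estimate to a scalar
      one.\<close>
    define v where "v = J (fst (flow t x)) - J (fst (flow s x)) - (t - s) *\<^sub>R \<eta>"
    have t0: "t \<ge> 0" using st by simp
    have "(J (fst (flow t x)) - t *\<^sub>R \<eta>) \<bullet> v \<le> (J (fst (flow s x)) - s *\<^sub>R \<eta>) \<bullet> v + (\<delta> * norm v) * (t - s)"
    proof (rule right_derivative_bound[OF st(2)])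
      show "continuous_on {s..t} (\<lambda>r. (J (fst (flow r x)) - r *\<^sub>R \<eta>) \<bullet> v)"
        by (intro continuous_intros J.continuous_on continuous_on_subset[OF flow_continuous]) (use st in auto)
      fix r assume r: "s \<le> r" "r < t"
      with st have r0: "r \<ge> 0" by simp
      have "((\<lambda>r. J (fst (flow r x))) has_vector_derivative J (fst (flow r a))) (at_right r)"
        by (intro J.has_vector_derivative bounded_linear.has_vector_derivative[OF bounded_linear_fst]
            flow_deriv[OF xa r0])
      then have "((\<lambda>r. J (fst (flow r x))) has_vector_derivative snd (flow r x)) (at_right r)"
        using wave_op_snd[OF flow_G[OF xa r0]] by simp
      then have "((\<lambda>r. J (fst (flow r x)) - r *\<^sub>R \<eta>) has_vector_derivative snd (flow r x) - 1 *\<^sub>R \<eta>) (at_right r)"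
        by (intro has_vector_derivative_diff bounded_linear.has_vector_derivative[OF bounded_linear_scaleR_left]
            has_vector_derivative_id)
      then show "((\<lambda>r. (J (fst (flow r x)) - r *\<^sub>R \<eta>) \<bullet> v) has_vector_derivative (snd (flow r x) - \<eta>) \<bullet> v) (at_right r)"
        using bounded_linear.has_vector_derivative[OF bounded_linear_inner_left] by simp
      have "(snd (flow r x) - \<eta>) \<bullet> v \<le> norm (snd (flow r x) - \<eta>) * norm v" by (rule norm_cauchy_schwarz)
      also have "\<dots> \<le> \<delta> * norm v" using bd r by (intro mult_right_mono) auto
      finally show "(snd (flow r x) - \<eta>) \<bullet> v \<le> \<delta> * norm v" .
    qed
    then have "v \<bullet> v \<le> (\<delta> * norm v) * (t - s)"
      unfolding v_def by (simp add: inner_diff_left algebra_simps)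
    then have le: "norm v * norm v \<le> (\<delta> * (t - s)) * norm v"
      by (simp add: algebra_simps flip: power2_norm_eq_inner power2_eq_square)
    have "0 \<le> \<delta>" using bd[of s] st norm_ge_zero order_trans by blast
    then have "0 \<le> \<delta> * (t - s)" using st by simp
    with le show ?thesis unfolding v_def[symmetric]
      by (cases "norm v = 0") (auto simp: mult_le_cancel_right)
  qed
  obtain X A where X: "\<And>n. (X n, A n) \<in> wave_op" "X \<longlonglongrightarrow> x"
    using dense_G_sequence by blast
  have "norm (J (fst (flow t (X n))) - J (fst (flow s (X n))) - (t - s) *\<^sub>R \<eta>)
      \<le> (\<delta> + semi (X n - x)) * (t - s)" for n
  proof -
    show ?thesis
    proof (rule dom[OF X(1)])
      fix r assume r: "s \<le> r" "r \<le> t"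
      then have r0: "r \<ge> 0" using st by simp
      have eq: "snd (flow r (X n)) - \<eta> = (snd (flow r x) - \<eta>) + snd (flow r (X n - x))"
        using linear_diff[OF flow_linear[OF r0], of "X n" x] by simp
      have "norm (snd (flow r (X n)) - \<eta>) \<le> norm (snd (flow r x) - \<eta>) + norm (snd (flow r (X n - x)))"
        unfolding eq by (rule norm_triangle_ineq)
      then show "norm (snd (flow r (X n)) - \<eta>) \<le> \<delta> + semi (X n - x)"
        using bd[OF r] norm_snd_semi[of "flow r (X n - x)"] flow_semi[OF r0, of "X n - x"] by simp
    qed
  qed
  moreover have "(\<lambda>n. norm (J (fst (flow t (X n))) - J (fst (flow s (X n))) - (t - s) *\<^sub>R \<eta>))
      \<longlonglongrightarrow> norm (J (fst (flow t x)) - J (fst (flow s x)) - (t - s) *\<^sub>R \<eta>)"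
    using st by (intro tendsto_intros bounded_linear.tendsto[OF bounded_linear_J_flow] X) auto
  moreover have "(\<lambda>n. (\<delta> + semi (X n - x)) * (t - s)) \<longlonglongrightarrow> (\<delta> + semi 0) * (t - s)"
    by (intro tendsto_intros tendsto_semi LIM_zero X)
  ultimately have "norm (J (fst (flow t x)) - J (fst (flow s x)) - (t - s) *\<^sub>R \<eta>) \<le> (\<delta> + semi 0) * (t - s)"
    by (intro LIMSEQ_le) auto
  then show ?thesis by simp
qed

lemma J_flow_lipschitz:
  assumes "0 \<le> s" "0 \<le> t"
  shows "norm (J (fst (flow t x)) - J (fst (flow s x))) \<le> \<bar>t - s\<bar> * semi x"
proof -
  have *: "norm (J (fst (flow t x)) - J (fst (flow s x))) \<le> (t - s) * semi x" if "0 \<le> s" "s \<le> t" for s t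
    using J_flow_increment[OF that, of x 0 "semi x"] that order_trans[OF norm_snd_semi flow_semi]
    by (simp add: mult.commute)
  show ?thesis using *[of s t] *[of t s] assms by (cases "s \<le> t") (auto simp: norm_minus_commute)
qed

lemma J_flow_deriv:
  assumes t: "0 \<le> t"
  shows "((\<lambda>s. J (fst (flow s x))) has_vector_derivative snd (flow t x)) (at t within {0..})"
  unfolding has_vector_derivative_def has_derivative_within_alt
proof (intro conjI allI impI)
  show "bounded_linear (\<lambda>h. h *\<^sub>R snd (flow t x))" by (rule bounded_linear_scaleR_left)
  fix \<epsilon> :: real assume \<epsilon>: "\<epsilon> > 0"
  have "continuous_on {0..} (\<lambda>s. snd (flow s x))" by (intro continuous_intros flow_continuous)
  then obtain d where d: "d > 0" "\<And>s. s \<ge> 0 \<Longrightarrow> \<bar>s - t\<bar> < d \<Longrightarrow> norm (snd (flow s x) - snd (flow t x)) < \<epsilon>"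
    using t \<epsilon> unfolding continuous_on_iff dist_norm by (metis atLeast_iff real_norm_def)
  show "\<exists>d>0. \<forall>y\<in>{0..}. norm (y - t) < d \<longrightarrow>
      norm (J (fst (flow y x)) - J (fst (flow t x)) - (y - t) *\<^sub>R snd (flow t x)) \<le> \<epsilon> * norm (y - t)"
  proof (intro exI conjI ballI impI)
    fix y :: real assume y: "y \<in> {0..}" "norm (y - t) < d"
    let ?\<eta> = "snd (flow t x)"
    show "norm (J (fst (flow y x)) - J (fst (flow t x)) - (y - t) *\<^sub>R ?\<eta>) \<le> \<epsilon> * norm (y - t)"
    proof (cases "t \<le> y")
      case True
      have "norm (snd (flow r x) - ?\<eta>) \<le> \<epsilon>" if "t \<le> r" "r \<le> y" for r
        using d(2)[of r] y that t by simp
      from J_flow_increment[OF t True this] True show ?thesis by simp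
    next
      case False
      have "norm (snd (flow r x) - ?\<eta>) \<le> \<epsilon>" if "y \<le> r" "r \<le> t" for r
        using d(2)[of r] y that t by simp
      from J_flow_increment[of y t, OF _ _ this] False y
      have "norm (J (fst (flow t x)) - J (fst (flow y x)) - (t - y) *\<^sub>R ?\<eta>) \<le> \<epsilon> * (t - y)" by simp
      moreover have "J (fst (flow t x)) - J (fst (flow y x)) - (t - y) *\<^sub>R ?\<eta>
          = - (J (fst (flow y x)) - J (fst (flow t x)) - (y - t) *\<^sub>R ?\<eta>)" by (simp add: algebra_simps)
      ultimately show ?thesis using False by (simp only: norm_minus_cancel) simp
    qed
  qed (rule d)
qed

text \<open>The damping does not see \<open>U\<close>, so the undamped oscillation through
  \<open>U\<close> solves the damped equation; it returns to its initial state after every period,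
  against exponential decay.\<close>

lemma no_undamped_mode:
  assumes M: "0 < \<omega>" and decay: "\<And>t x. t \<ge> 0 \<Longrightarrow> norm (flow t x) \<le> M * exp (- \<omega> * t) * norm x"
    and mode: "\<And>\<phi>. U \<bullet> \<phi> + \<alpha> (J U) (J \<phi>) = \<mu> * (J U \<bullet> J \<phi>)" and undamped: "\<And>\<phi>. \<gamma> U \<phi> = 0"
  shows "U = 0"
proof (rule ccontr)
  assume U: "U \<noteq> 0"
  have "0 < U \<bullet> U + \<alpha> (J U) (J U)" using U A.nonneg[of "J U"] by (simp add: add_pos_nonneg)
  then have "0 < \<mu> * (J U \<bullet> J U)" using mode by simp
  then have \<mu>: "\<mu> > 0" using inner_ge_zero[of "J U"] by (metis zero_less_mult_pos2 less_eq_real_def mult_zero_right)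
  define \<nu> where "\<nu> = sqrt \<mu>"
  have \<nu>: "\<nu> > 0" "\<nu> * \<nu> = \<mu>" using \<mu> by (auto simp: \<nu>_def)
  have flow: "flow t (U, 0) = (cos (\<nu> * t) *\<^sub>R U, - (\<nu> * sin (\<nu> * t)) *\<^sub>R J U)" if t: "t \<ge> 0" for t
  proof -
    let ?u = "\<lambda>t. (cos (\<nu> * t) *\<^sub>R U, - (\<nu> * sin (\<nu> * t)) *\<^sub>R J U)"
    have "?u t = flow t (?u 0)"
    proof (rule flow_unique[OF _ _ _ t])
      show "continuous_on {0..} ?u" by (intro continuous_intros)
      show "(?u has_vector_derivative (- (\<nu> * sin (\<nu> * s)) *\<^sub>R U, - (\<mu> * cos (\<nu> * s)) *\<^sub>R J U)) (at_right s)" for s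
      proof (rule has_vector_derivative_Pair)
        have "((\<lambda>t. cos (\<nu> * t)) has_real_derivative - (\<nu> * sin (\<nu> * s))) (at_right s)"
          by (auto intro!: derivative_eq_intros)
        then show "((\<lambda>t. cos (\<nu> * t) *\<^sub>R U) has_vector_derivative - (\<nu> * sin (\<nu> * s)) *\<^sub>R U) (at_right s)"
          by (rule has_vector_derivative_scaleR_left)
        have "((\<lambda>t. - (\<nu> * sin (\<nu> * t))) has_real_derivative - (\<mu> * cos (\<nu> * s))) (at_right s)"
          using \<nu> by (auto intro!: derivative_eq_intros)
        then show "((\<lambda>t. - (\<nu> * sin (\<nu> * t)) *\<^sub>R J U) has_vector_derivative - (\<mu> * cos (\<nu> * s)) *\<^sub>R J U) (at_right s)"
          by (rule has_vector_derivative_scaleR_left)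
      qed
      show "(?u s, (- (\<nu> * sin (\<nu> * s)) *\<^sub>R U, - (\<mu> * cos (\<nu> * s)) *\<^sub>R J U)) \<in> wave_op" for s
      proof -
        have "((cos (\<nu> * s) *\<^sub>R U, J (- (\<nu> * sin (\<nu> * s)) *\<^sub>R U)),
            (- (\<nu> * sin (\<nu> * s)) *\<^sub>R U, - ((\<mu> * cos (\<nu> * s)) *\<^sub>R J U))) \<in> wave_op"
        proof (rule wave_opI)
          fix \<phi>
          have "(cos (\<nu> * s) *\<^sub>R U) \<bullet> \<phi> + \<alpha> (J (cos (\<nu> * s) *\<^sub>R U)) (J \<phi>) = cos (\<nu> * s) * (U \<bullet> \<phi> + \<alpha> (J U) (J \<phi>))"
            by (simp add: J.scaleR A.form_simps distrib_left)
          then show "(cos (\<nu> * s) *\<^sub>R U) \<bullet> \<phi> + \<alpha> (J (cos (\<nu> * s) *\<^sub>R U)) (J \<phi>) + \<gamma> (- (\<nu> * sin (\<nu> * s)) *\<^sub>R U) \<phi>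
              = ((\<mu> * cos (\<nu> * s)) *\<^sub>R J U) \<bullet> J \<phi>"
            unfolding mode by (simp only: C.form_simps undamped) simp
        qed
        then show ?thesis by (simp only: J.scaleR J.neg scaleR_minus_left)
      qed
    qed
    then show ?thesis by simp
  qed
  \<comment> \<open>A whole number of periods, so long that
    \<open>exp (\<omega> * t) > \<omega> * t > M\<close>.\<close>
  obtain k :: nat where k: "real k > M / (\<omega> * (2 * pi / \<nu>))" using reals_Archimedean2 by blast
  define t where "t = real k * (2 * pi / \<nu>)"
  have wt: "\<omega> * t > M"
    using k M \<nu> unfolding t_def by (simp add: field_simps)
  have t: "t \<ge> 0" using \<nu> by (simp add: t_def)
  have "\<nu> * t = 2 * pi * real k" using \<nu> by (simp add: t_def)
  then have "cos (\<nu> * t) = 1" "sin (\<nu> * t) = 0" using cos_2npi sin_2npi by (metis mult.commute mult.left_commute)+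
  then have "flow t (U, 0) = (U, 0)" using flow[OF t] by simp
  with decay[OF t, of "(U, 0)"] have "norm U \<le> M * exp (- \<omega> * t) * norm U" by simp
  then have "1 \<le> M * exp (- \<omega> * t)" using U by (simp add: mult_le_cancel_right2 mult.commute)
  then have "exp (\<omega> * t) \<le> M" by (simp add: exp_minus field_simps)
  moreover have "exp (\<omega> * t) > \<omega> * t" using exp_ge_add_one_self[of "\<omega> * t"] by linarith
  ultimately show False using wt by linarith
qed

end

section \<open>Comparison with a stable wave equation\<close>

lemma absorb_linear_term:
  fixes s k \<theta> L :: real
  assumes "0 < \<theta>" shows "L * k * s \<le> \<theta> / 2 * s\<^sup>2 + L\<^sup>2 / (2 * \<theta>) * k\<^sup>2"
proof -
  have "0 \<le> (\<theta> * s - L * k)\<^sup>2 / (2 * \<theta>)" using assms by simp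
  also have "\<dots> = \<theta> / 2 * s\<^sup>2 + L\<^sup>2 / (2 * \<theta>) * k\<^sup>2 - L * k * s"
    using assms by (simp add: power2_eq_square field_simps)
  finally show ?thesis by simp
qed

text \<open>The comparison equation drops \<open>\<alpha>\<close>; the two equations are tied only
  by the equivalence of their dampings. \<open>unique_continuation\<close> excludes eigenvectors
  that the damping does not see.\<close>

locale wave_comparison = wave J \<alpha> \<gamma> + S: wave J "\<lambda>_ _. 0" \<gamma>'
  for J :: "'a::{real_inner,banach} \<Rightarrow> 'b::{real_inner,banach}" and \<alpha> \<gamma> \<gamma>' +
  fixes c\<^sub>0 C\<^sub>0 M\<^sub>0 \<omega>\<^sub>0 :: real
  assumes c\<^sub>0: "0 < c\<^sub>0" and C\<^sub>0: "0 < C\<^sub>0"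
    and lower: "c\<^sub>0 * \<gamma>' z z \<le> \<gamma> z z" and upper: "\<gamma> z z \<le> C\<^sub>0 * \<gamma>' z z"
    and \<omega>\<^sub>0: "0 < \<omega>\<^sub>0" and decay: "t \<ge> 0 \<Longrightarrow> norm (S.flow t y) \<le> M\<^sub>0 * exp (- \<omega>\<^sub>0 * t) * norm y"
    and unique_continuation:
      "(\<And>\<phi>. U \<bullet> \<phi> + \<alpha> (J U) (J \<phi>) = \<mu> * (J U \<bullet> J \<phi>)) \<Longrightarrow> (\<And>\<phi>. \<gamma>' U \<phi> = 0) \<Longrightarrow> U = 0"
begin

interpretation J: bounded_linear J by (rule J_linear)
interpretation A: sym_form \<alpha> by (rule \<alpha>_form)
interpretation C: sym_form \<gamma> by (rule \<gamma>_form)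
interpretation C': sym_form \<gamma>' by (rule S.\<gamma>_form)

definition C\<^sub>2 :: real where "C\<^sub>2 = 6 / c\<^sub>0 + 4 * C\<^sub>0"

lemma C\<^sub>2_pos: "0 < C\<^sub>2"
  using c\<^sub>0 C\<^sub>0 by (simp add: C\<^sub>2_def add_pos_pos)

lemma S_energy: "S.energy x y = x \<bullet> y"
  by (simp add: S.energy_def)

lemma S_semi: "S.semi x = norm x"
  by (simp add: S.semi_def S_energy norm_eq_sqrt_inner)

text \<open>The weights 4 and \<open>C\<^sub>2\<close> are chosen so that all quadratic terms in \<open>W = Z - Y\<close> and \<open>Y\<close> cancel
  in the time derivative of \<open>norm u\<^sup>2 / 2 - 2 * norm (u - v)\<^sup>2 - C\<^sub>2 * energy v v / 2\<close>.\<close>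

lemma comparison_density:
  assumes u: "(u, u') \<in> S.wave_op" and v: "(v, v') \<in> wave_op"
    and K: "\<And>p q. \<bar>\<alpha> p q\<bar> \<le> K * norm p * norm q"
  shows "- (u \<bullet> u' - 4 * ((u - v) \<bullet> (u' - v')) - C\<^sub>2 * energy v v')
    \<le> 4 * (K * norm (J (fst v)) * norm (snd u - snd v))"
proof -
  obtain U Z F where u_eq: "u = (U, J Z)" "u' = (Z, - F)" and F: "\<And>\<phi>. U \<bullet> \<phi> + \<gamma>' Z \<phi> = F \<bullet> J \<phi>"
    using S.wave_opE[OF u] by (metis add.right_neutral)
  obtain V Y H where v_eq: "v = (V, J Y)" "v' = (Y, - H)"
    and H: "\<And>\<phi>. V \<bullet> \<phi> + \<alpha> (J V) (J \<phi>) + \<gamma> Y \<phi> = H \<bullet> J \<phi>"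
    using wave_opE[OF v] by blast
  define W where "W = Z - Y"
  have Z: "Z = W + Y" by (simp add: W_def)
  have 1: "u \<bullet> u' = - \<gamma>' Z Z" using S.energy_dissipation[OF u] by (simp add: S_energy u_eq)
  have 2: "energy v v' = - \<gamma> Y Y" using energy_dissipation[OF v] by (simp add: v_eq)
  have "(u - v) \<bullet> (u' - v') = (U - V) \<bullet> W - (F \<bullet> J W - H \<bullet> J W)"
    by (simp add: u_eq v_eq W_def J.diff inner_diff_left inner_diff_right inner_commute)
  also have "\<dots> = - \<gamma>' Z W + \<gamma> Y W + \<alpha> (J V) (J W)"
    using F[of W] H[of W] by (simp add: inner_diff_left)
  finally have 3: "(u - v) \<bullet> (u' - v') = - \<gamma>' W W - \<gamma>' Y W + \<gamma> Y W + \<alpha> (J V) (J W)"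
    by (simp add: Z C'.form_simps)
  \<comment> \<open>In total the coefficients of \<open>\<gamma>' W W\<close> are 2 - 4 + 1 + 1 = 0.
    There remains \<open>6 * \<gamma>' Y Y + 4 * (C\<^sub>0 * \<gamma> Y Y)\<close>, whence the
    value of \<open>C\<^sub>2\<close>.\<close>
  have 4: "\<gamma>' Z Z \<le> 2 * \<gamma>' W W + 2 * \<gamma>' Y Y"
    using C'.nonneg[of "W - Y"] by (simp add: Z C'.form_simps C'.sym[of Y W])
  have 5: "\<bar>\<gamma>' Y W\<bar> \<le> \<gamma>' W W / 4 + \<gamma>' Y Y"
    using C'.young[of "1 / 4" W Y] by (simp add: C'.sym[of Y W])
  have 6: "\<bar>\<gamma> Y W\<bar> \<le> \<gamma>' W W / 4 + C\<^sub>0 * \<gamma> Y Y"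
  proof -
    have "\<bar>\<gamma> Y W\<bar> \<le> 1 / (4 * C\<^sub>0) * \<gamma> W W + C\<^sub>0 * \<gamma> Y Y"
      using C.young[of "1 / (4 * C\<^sub>0)" W Y] C\<^sub>0 by (simp add: C.sym[of Y W] mult.commute)
    also have "1 / (4 * C\<^sub>0) * \<gamma> W W \<le> 1 / (4 * C\<^sub>0) * (C\<^sub>0 * \<gamma>' W W)"
      using upper C\<^sub>0 by (intro mult_left_mono) auto
    finally show ?thesis using C\<^sub>0 by simp
  qed
  have 7: "C\<^sub>2 * \<gamma> Y Y \<ge> 6 * \<gamma>' Y Y + 4 * (C\<^sub>0 * \<gamma> Y Y)"
  proof -
    have "\<gamma>' Y Y \<le> \<gamma> Y Y / c\<^sub>0" using lower[of Y] c\<^sub>0 by (simp add: field_simps)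
    then show ?thesis by (simp add: C\<^sub>2_def distrib_right)
  qed
  have 8: "\<bar>\<alpha> (J V) (J W)\<bar> \<le> K * norm (J V) * norm (J W)" by (rule K)
  have "- (u \<bullet> u' - 4 * ((u - v) \<bullet> (u' - v')) - C\<^sub>2 * energy v v')
      = \<gamma>' Z Z - 4 * \<gamma>' W W - 4 * \<gamma>' Y W + 4 * \<gamma> Y W + 4 * \<alpha> (J V) (J W) - C\<^sub>2 * \<gamma> Y Y"
    unfolding 1 2 3 by (simp add: algebra_simps)
  also have "\<dots> \<le> 4 * (K * norm (J V) * norm (J W))"
    using 4 5 6 7 8 unfolding abs_le_iff by argo
  also have "J W = snd u - snd v" by (simp add: u_eq v_eq W_def J.diff)
  finally show ?thesis by (simp add: v_eq)
qed

text \<open>The initial data \<open>y\<close> and \<open>x\<close> are kept apart because the two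
  generators have different domains in general; equal data are reached later by density. At the
  final time the squared distance of the orbits has a favourable sign and is dropped.\<close>

lemma comparison_integrated:
  assumes y: "(y, c) \<in> S.wave_op" and x: "(x, a) \<in> wave_op" and \<tau>: "0 \<le> \<tau>"
    and \<kappa>: "\<And>t. 0 \<le> t \<Longrightarrow> t \<le> \<tau> \<Longrightarrow> norm (J (fst (flow t x))) \<le> \<kappa>"
    and K0: "0 \<le> K" and K: "\<And>p q. \<bar>\<alpha> p q\<bar> \<le> K * norm p * norm q"
  shows "1 / 2 * (y \<bullet> y) - 2 * ((y - x) \<bullet> (y - x)) - C\<^sub>2 / 2 * energy x x
    \<le> 1 / 2 * (S.flow \<tau> y \<bullet> S.flow \<tau> y) - C\<^sub>2 / 2 * energy (flow \<tau> x) (flow \<tau> x)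
      + 4 * (K * \<kappa> * (norm y + semi x)) * \<tau>"
proof -
  define f where "f t = - (1 / 2 * (S.flow t y \<bullet> S.flow t y)
    - 2 * ((S.flow t y - flow t x) \<bullet> (S.flow t y - flow t x))
    - C\<^sub>2 / 2 * energy (flow t x) (flow t x))" for t
  have bi: "bounded_bilinear energy" by (rule bilinear)
  have "f \<tau> \<le> f 0 + 4 * (K * \<kappa> * (norm y + semi x)) * (\<tau> - 0)"
  proof (rule right_derivative_bound[OF \<tau>])
    show "continuous_on {0..\<tau>} f"
      unfolding f_def
      by (intro continuous_intros bounded_bilinear.continuous_on[OF bi]
          continuous_on_subset[OF flow_continuous] continuous_on_subset[OF S.flow_continuous]) auto
    fix t :: real assume t: "0 \<le> t" "t < \<tau>"
    let ?u = "S.flow t y" and ?v = "flow t x" and ?u' = "S.flow t c" and ?v' = "flow t a"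
    have du: "((\<lambda>t. S.flow t y) has_vector_derivative ?u') (at_right t)"
      by (rule S.flow_deriv[OF y t(1)])
    have dv: "((\<lambda>t. flow t x) has_vector_derivative ?v') (at_right t)"
      by (rule flow_deriv[OF x t(1)])
    have dw: "((\<lambda>t. S.flow t y - flow t x) has_vector_derivative ?u' - ?v') (at_right t)"
      by (rule has_vector_derivative_diff[OF du dv])
    have "(f has_vector_derivative - (1 / 2 * (?u \<bullet> ?u' + ?u' \<bullet> ?u)
        - 2 * ((?u - ?v) \<bullet> (?u' - ?v') + (?u' - ?v') \<bullet> (?u - ?v))
        - C\<^sub>2 / 2 * (energy ?v ?v' + energy ?v' ?v))) (at_right t)"
      unfolding f_def
      by (intro has_vector_derivative_minus has_vector_derivative_diff has_vector_derivative_mult_right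
          bounded_bilinear.has_vector_derivative[OF bounded_bilinear_inner]
          bounded_bilinear.has_vector_derivative[OF bi] du dv dw)
    moreover have "- (1 / 2 * (?u \<bullet> ?u' + ?u' \<bullet> ?u)
        - 2 * ((?u - ?v) \<bullet> (?u' - ?v') + (?u' - ?v') \<bullet> (?u - ?v))
        - C\<^sub>2 / 2 * (energy ?v ?v' + energy ?v' ?v))
      = - (?u \<bullet> ?u' - 4 * ((?u - ?v) \<bullet> (?u' - ?v')) - C\<^sub>2 * energy ?v ?v')"
      by (simp only: inner_commute[of ?u' ?u] inner_commute[of "?u' - ?v'" "?u - ?v"] sym[of ?v' ?v]) argo
    ultimately show "(f has_vector_derivative - (?u \<bullet> ?u' - 4 * ((?u - ?v) \<bullet> (?u' - ?v')) - C\<^sub>2 * energy ?v ?v')) (at_right t)"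
      by (rule has_vector_derivative_eq_rhs)
    have "- (?u \<bullet> ?u' - 4 * ((?u - ?v) \<bullet> (?u' - ?v')) - C\<^sub>2 * energy ?v ?v')
        \<le> 4 * (K * norm (J (fst ?v)) * norm (snd ?u - snd ?v))"
      by (rule comparison_density[OF S.flow_G[OF y t(1)] flow_G[OF x t(1)] K])
    also have "\<dots> \<le> 4 * (K * \<kappa> * (norm y + semi x))"
    proof -
      have "norm (snd ?u - snd ?v) \<le> norm (snd ?u) + norm (snd ?v)" by (rule norm_triangle_ineq4)
      also have "norm (snd ?u) \<le> norm y"
        using S.norm_snd_semi[of ?u] S.flow_semi[OF t(1), of y] unfolding S_semi by linarith
      also have "norm (snd ?v) \<le> semi x"
        using norm_snd_semi[of ?v] flow_semi[OF t(1), of x] by linarith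
      finally have "norm (snd ?u - snd ?v) \<le> norm y + semi x" by simp
      moreover have Jv: "norm (J (fst ?v)) \<le> \<kappa>" using \<kappa>[OF t(1)] t(2) by simp
      moreover have "0 \<le> \<kappa>" by (rule order_trans[OF norm_ge_zero Jv])
      ultimately show ?thesis
        using K0 by (intro mult_mono mult_nonneg_nonneg order_refl) auto
    qed
    finally show "- (?u \<bullet> ?u' - 4 * ((?u - ?v) \<bullet> (?u' - ?v')) - C\<^sub>2 * energy ?v ?v')
        \<le> 4 * (K * \<kappa> * (norm y + semi x))" .
  qed
  moreover have "0 \<le> (S.flow \<tau> y - flow \<tau> x) \<bullet> (S.flow \<tau> y - flow \<tau> x)" by simp
  ultimately show ?thesis unfolding f_def by (simp add: algebra_simps)
qed

text \<open>With \<open>y\<close> tending to \<open>x\<close> and the comparison orbit halved, 1/2 -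
  1/4 of the squared norm stays on the left. It is bounded by the energy lost up to
  \<open>\<tau>\<close> and a term that only sees the orbit through \<open>J\<close>.\<close>

lemma energy_decrease:
  assumes x: "(x, a) \<in> wave_op" and \<tau>: "0 \<le> \<tau>"
    and half: "\<And>y. S.flow \<tau> y \<bullet> S.flow \<tau> y \<le> 1 / 2 * (y \<bullet> y)"
    and \<kappa>: "\<And>t. 0 \<le> t \<Longrightarrow> t \<le> \<tau> \<Longrightarrow> norm (J (fst (flow t x))) \<le> \<kappa>"
    and K0: "0 \<le> K" and K: "\<And>p q. \<bar>\<alpha> p q\<bar> \<le> K * norm p * norm q"
  shows "1 / 4 * (x \<bullet> x) \<le> C\<^sub>2 / 2 * (energy x x - energy (flow \<tau> x) (flow \<tau> x))
    + 4 * (K * \<kappa> * (norm x + semi x)) * \<tau>"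
proof -
  obtain Y C where Y: "\<And>n. (Y n, C n) \<in> S.wave_op" "Y \<longlonglongrightarrow> x"
    using S.dense_G_sequence by blast
  let ?D = "C\<^sub>2 / 2 * (energy x x - energy (flow \<tau> x) (flow \<tau> x))"
  have "1 / 4 * (Y n \<bullet> Y n) - 2 * ((Y n - x) \<bullet> (Y n - x)) \<le> ?D + 4 * (K * \<kappa> * (norm (Y n) + semi x)) * \<tau>" for n
  proof -
    have "1 / 2 * (Y n \<bullet> Y n) - 2 * ((Y n - x) \<bullet> (Y n - x)) - C\<^sub>2 / 2 * energy x x
        \<le> 1 / 2 * (S.flow \<tau> (Y n) \<bullet> S.flow \<tau> (Y n)) - C\<^sub>2 / 2 * energy (flow \<tau> x) (flow \<tau> x)
          + 4 * (K * \<kappa> * (norm (Y n) + semi x)) * \<tau>"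
      by (rule comparison_integrated[OF Y(1) x \<tau> _ K0 K]) (rule \<kappa>)
    then show ?thesis using half[of "Y n"]
      by (simp only: right_diff_distrib)
  qed
  moreover have "(\<lambda>n. 1 / 4 * (Y n \<bullet> Y n) - 2 * ((Y n - x) \<bullet> (Y n - x)))
      \<longlonglongrightarrow> 1 / 4 * (x \<bullet> x) - 2 * ((x - x) \<bullet> (x - x))"
    by (intro tendsto_intros Y)
  moreover have "(\<lambda>n. ?D + 4 * (K * \<kappa> * (norm (Y n) + semi x)) * \<tau>)
      \<longlonglongrightarrow> ?D + 4 * (K * \<kappa> * (norm x + semi x)) * \<tau>"
    by (intro tendsto_intros Y)
  ultimately have "1 / 4 * (x \<bullet> x) - 2 * ((x - x) \<bullet> (x - x)) \<le> ?D + 4 * (K * \<kappa> * (norm x + semi x)) * \<tau>"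
    by (intro LIMSEQ_le) auto
  then show ?thesis by simp
qed

section \<open>From the energy estimate to a contraction up to a compact term\<close>

lemma half_time: "\<exists>\<tau>>0. \<forall>y. S.flow \<tau> y \<bullet> S.flow \<tau> y \<le> 1 / 2 * (y \<bullet> y)"
proof -
  \<comment> \<open>Makes \<open>exp (\<omega>\<^sub>0 * \<tau>)\<close> at least
    \<open>2 * \<bar>M\<^sub>0\<bar>\<close>; the summand 1 keeps \<open>\<tau>\<close>
    positive.\<close>
  define \<tau> where "\<tau> = (1 + 2 * \<bar>M\<^sub>0\<bar>) / \<omega>\<^sub>0"
  have \<tau>: "\<tau> > 0" using \<omega>\<^sub>0 by (simp add: \<tau>_def add_pos_nonneg)
  have "exp (\<omega>\<^sub>0 * \<tau>) \<ge> 2 * \<bar>M\<^sub>0\<bar>"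
    using exp_ge_add_one_self[of "\<omega>\<^sub>0 * \<tau>"] \<omega>\<^sub>0 by (simp add: \<tau>_def)
  then have Me: "\<bar>M\<^sub>0\<bar> * exp (- \<omega>\<^sub>0 * \<tau>) \<le> 1 / 2" by (simp add: exp_minus field_simps)
  have "S.flow \<tau> y \<bullet> S.flow \<tau> y \<le> 1 / 2 * (y \<bullet> y)" for y
  proof -
    have "M\<^sub>0 * exp (- \<omega>\<^sub>0 * \<tau>) \<le> \<bar>M\<^sub>0\<bar> * exp (- \<omega>\<^sub>0 * \<tau>)" by (intro mult_right_mono) auto
    from mult_right_mono[OF order_trans[OF this Me]]
    have "M\<^sub>0 * exp (- \<omega>\<^sub>0 * \<tau>) * norm y \<le> 1 / 2 * norm y" by simp
    then have "norm (S.flow \<tau> y) \<le> 1 / 2 * norm y" using decay[of \<tau> y] \<tau> by linarith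
    then have "(norm (S.flow \<tau> y))\<^sup>2 \<le> (1 / 2 * norm y)\<^sup>2" by (intro power_mono) auto
    then have "4 * (S.flow \<tau> y \<bullet> S.flow \<tau> y) \<le> y \<bullet> y"
      unfolding power_mult_distrib power2_norm_eq_inner by (simp add: power2_eq_square)
    then show ?thesis using inner_ge_zero[of y] by linarith
  qed
  with \<tau> show ?thesis by blast
qed

text \<open>Finitely many sample times replace a supremum over the time interval: a finite sum of
  compact seminorms is compact, and by the Lipschitz bound the sampling error is at most
  \<open>\<tau> / real n * semi x\<close>.\<close>

definition grid :: "real \<Rightarrow> nat \<Rightarrow> 'a \<times> 'b \<Rightarrow> real" where
  "grid \<tau> n x = (\<Sum>i\<le>n. norm (J (fst (flow (real i * (\<tau> / real n)) x))))"

lemma grid_bound: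
  assumes "0 < \<tau>" "0 < n" "0 \<le> t" "t \<le> \<tau>"
  shows "norm (J (fst (flow t x))) \<le> grid \<tau> n x + \<tau> / real n * semi x"
proof -
  define \<delta> where "\<delta> = \<tau> / real n"
  have \<delta>: "\<delta> > 0" "real n * \<delta> = \<tau>" using assms by (auto simp: \<delta>_def)
  define i where "i = nat \<lfloor>t / \<delta>\<rfloor>"
  have i: "real i \<le> t / \<delta>" "t / \<delta> < real i + 1" using assms \<delta> unfolding i_def by auto
  have "t / \<delta> \<le> real n" using assms \<delta> by (simp add: divide_le_eq)
  then have "i \<le> n" using i by linarith
  have it: "real i * \<delta> \<le> t" "t < real i * \<delta> + \<delta>" using i \<delta> by (auto simp: field_simps)
  have "norm (J (fst (flow t x)) - J (fst (flow (real i * \<delta>) x))) \<le> \<bar>t - real i * \<delta>\<bar> * semi x"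
    using assms \<delta> by (intro J_flow_lipschitz) auto
  also have "\<dots> \<le> \<delta> * semi x" using it by (intro mult_right_mono) auto
  finally have "norm (J (fst (flow t x))) \<le> norm (J (fst (flow (real i * \<delta>) x))) + \<delta> * semi x"
    using norm_triangle_sub[of "J (fst (flow t x))" "J (fst (flow (real i * \<delta>) x))"] by linarith
  also have "norm (J (fst (flow (real i * \<delta>) x))) \<le> grid \<tau> n x"
    unfolding grid_def \<delta>_def using \<open>i \<le> n\<close> by (intro member_le_sum) auto
  finally show ?thesis by (simp add: \<delta>_def)
qed

lemma grid_nonneg: "0 \<le> grid \<tau> n x"
  by (simp add: grid_def sum_nonneg)

lemma grid_precompact: assumes "0 \<le> \<tau>" shows "precompact_wrt semi (grid \<tau> n)"
  unfolding grid_def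
proof (intro precompact_wrt_sum)
  fix i
  have t: "real i * (\<tau> / real n) \<ge> 0" using assms by simp
  show "precompact_wrt semi (\<lambda>x. norm (J (fst (flow (real i * (\<tau> / real n)) x))))"
  proof (rule precompact_wrt_compose[OF J_compact, where c = 1])
    show "fst (flow (real i * (\<tau> / real n)) (x - y))
        = fst (flow (real i * (\<tau> / real n)) x) - fst (flow (real i * (\<tau> / real n)) y)" for x y
      using linear_diff[OF flow_linear[OF t], of x y] by simp
    show "norm (fst (flow (real i * (\<tau> / real n)) x)) \<le> 1 * semi x" for x
      using order_trans[OF norm_fst_semi flow_semi[OF t]] by simp
  qed simp
qed simp

lemma contraction_up_to_compact:
  "\<exists>\<tau> q k. 0 < \<tau> \<and> 0 \<le> q \<and> q < 1 \<and> precompact_wrt semi k \<and>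
    (\<forall>x. 0 \<le> k x) \<and> (\<forall>x. energy (flow \<tau> x) (flow \<tau> x) \<le> q\<^sup>2 * energy x x + (k x)\<^sup>2)"
proof -
  obtain \<tau> where \<tau>: "0 < \<tau>" "\<And>y. S.flow \<tau> y \<bullet> S.flow \<tau> y \<le> 1 / 2 * (y \<bullet> y)" using half_time by blast
  obtain K where K: "K > 0" "\<And>p q. \<bar>\<alpha> p q\<bar> \<le> K * norm p * norm q"
    using bounded_bilinear.pos_bounded[OF A.bilinear] by (auto simp: mult.commute mult.left_commute)
  obtain m where m: "m > 0" "\<And>x. semi x \<le> m * norm x" using semi_bound by blast
  \<comment> \<open>The factor \<open>4 * K * \<tau>\<close> of \<open>energy_decrease\<close>,
    doubled by \<open>norm x + semi x \<le> 2 * s\<close> and multiplied by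
    \<open>2 / C\<^sub>2\<close>.\<close>
  define L where "L = 16 * K * \<tau> / C\<^sub>2"
  \<comment> \<open>A gain of \<open>2 * \<theta>\<close> is available: one \<open>\<theta>\<close>
    pays for the sampling error, half of the other for the term linear in \<open>grid\<close>, which
    leaves the factor \<open>1 - \<theta> / 2\<close>. The cap 1 keeps this factor positive.\<close>
  define \<theta> where "\<theta> = min (1 / (4 * C\<^sub>2 * m\<^sup>2)) 1"
  have L: "L > 0" using K \<tau> C\<^sub>2_pos by (simp add: L_def)
  have \<theta>: "0 < \<theta>" "\<theta> \<le> 1" "2 * \<theta> \<le> 1 / (2 * C\<^sub>2 * m\<^sup>2)"
    using C\<^sub>2_pos m by (auto simp: \<theta>_def min_def field_simps)
  obtain n :: nat where n: "L * \<tau> / \<theta> < real n" using reals_Archimedean2 by blast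
  have n0: "n > 0" using n L \<tau> \<theta> by (metis divide_pos_pos gr0I mult_pos_pos not_less_iff_gr_or_eq of_nat_0 order_less_trans)
  have Ln: "L * (\<tau> / real n) \<le> \<theta>" using n n0 \<theta> by (simp add: field_simps)
  let ?E = "\<lambda>x. energy (flow \<tau> x) (flow \<tau> x)" and ?k = "grid \<tau> n"
  have dom: "?E x \<le> (1 - \<theta> / 2) * energy x x + L\<^sup>2 / (2 * \<theta>) * (?k x)\<^sup>2" if x: "(x, a) \<in> wave_op" for x a
  proof -
    define s where "s = semi x"
    define \<kappa> where "\<kappa> = ?k x + \<tau> / real n * s"
    have s: "s \<ge> 0" "energy x x = s\<^sup>2" by (auto simp: s_def semi_sq)
    have \<kappa>0: "\<kappa> \<ge> 0" using s \<tau> by (simp add: \<kappa>_def grid_nonneg)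
    have "1 / 4 * (x \<bullet> x) \<le> C\<^sub>2 / 2 * (energy x x - ?E x) + 4 * (K * \<kappa> * (norm x + semi x)) * \<tau>"
      by (rule energy_decrease[OF x _ \<tau>(2) _ _ K(2)])
        (use \<tau> K n0 grid_bound[of \<tau> n _ x] in \<open>auto simp: \<kappa>_def s_def\<close>)
    also have "4 * (K * \<kappa> * (norm x + semi x)) * \<tau> \<le> 4 * (K * \<kappa> * (2 * s)) * \<tau>"
      using K \<kappa>0 \<tau> norm_le_energy[of x] unfolding s_def by (intro mult_right_mono mult_left_mono) auto
    finally have 1: "1 / 4 * (x \<bullet> x) \<le> C\<^sub>2 / 2 * (s\<^sup>2 - ?E x) + 8 * (K * \<kappa> * s) * \<tau>" by (simp add: s)
    have "s\<^sup>2 \<le> (m * norm x)\<^sup>2" using m(2)[of x] s unfolding s_def by (intro power_mono) auto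
    then have "s\<^sup>2 / m\<^sup>2 \<le> x \<bullet> x"
      using m(1) by (simp add: power_mult_distrib power2_norm_eq_inner divide_le_eq mult.commute)
    with 1 have "1 / 4 * (s\<^sup>2 / m\<^sup>2) \<le> C\<^sub>2 / 2 * (s\<^sup>2 - ?E x) + 8 * (K * \<kappa> * s) * \<tau>" by argo
    then have "2 / C\<^sub>2 * (1 / 4 * (s\<^sup>2 / m\<^sup>2)) \<le> 2 / C\<^sub>2 * (C\<^sub>2 / 2 * (s\<^sup>2 - ?E x) + 8 * (K * \<kappa> * s) * \<tau>)"
      using C\<^sub>2_pos by (intro mult_left_mono) auto
    then have "1 / (2 * C\<^sub>2 * m\<^sup>2) * s\<^sup>2 \<le> s\<^sup>2 - ?E x + L * \<kappa> * s"
      using C\<^sub>2_pos by (simp add: L_def distrib_left algebra_simps)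
    moreover have "2 * \<theta> * s\<^sup>2 \<le> 1 / (2 * C\<^sub>2 * m\<^sup>2) * s\<^sup>2" using \<theta> by (intro mult_right_mono) auto
    moreover have "L * \<kappa> * s \<le> L * ?k x * s + \<theta> * s\<^sup>2"
    proof -
      have "L * \<kappa> * s = L * ?k x * s + (L * (\<tau> / real n)) * s\<^sup>2"
        by (simp add: \<kappa>_def distrib_left distrib_right power2_eq_square)
      moreover have "(L * (\<tau> / real n)) * s\<^sup>2 \<le> \<theta> * s\<^sup>2" using Ln by (intro mult_right_mono) auto
      ultimately show ?thesis by linarith
    qed
    ultimately have "?E x \<le> (1 - \<theta>) * s\<^sup>2 + L * ?k x * s" by (simp add: left_diff_distrib)
    also have "L * ?k x * s \<le> \<theta> / 2 * s\<^sup>2 + L\<^sup>2 / (2 * \<theta>) * (?k x)\<^sup>2"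
      by (rule absorb_linear_term) (rule \<theta>)
    finally show ?thesis by (simp add: s left_diff_distrib)
  qed
  have all: "?E x \<le> (1 - \<theta> / 2) * energy x x + L\<^sup>2 / (2 * \<theta>) * (?k x)\<^sup>2" for x
  proof -
    obtain X A where X: "\<And>n. (X n, A n) \<in> wave_op" "X \<longlonglongrightarrow> x"
      using dense_G_sequence by blast
    have f: "(\<lambda>i. flow \<tau> (X i)) \<longlonglongrightarrow> flow \<tau> x"
      using \<tau> by (intro bounded_linear.tendsto[OF flow_bounded_linear] X) simp
    have g: "(\<lambda>i. ?k (X i)) \<longlonglongrightarrow> ?k x"
      unfolding grid_def using \<tau>
      by (intro tendsto_sum tendsto_norm bounded_linear.tendsto[OF bounded_linear_J_flow] X) simp
    have l: "(\<lambda>i. ?E (X i)) \<longlonglongrightarrow> ?E x" by (intro bounded_bilinear.tendsto[OF bilinear] f)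
    have r: "(\<lambda>i. (1 - \<theta> / 2) * energy (X i) (X i) + L\<^sup>2 / (2 * \<theta>) * (?k (X i))\<^sup>2)
        \<longlonglongrightarrow> (1 - \<theta> / 2) * energy x x + L\<^sup>2 / (2 * \<theta>) * (?k x)\<^sup>2"
      by (intro tendsto_add tendsto_mult tendsto_const tendsto_power g bounded_bilinear.tendsto[OF bilinear] X)
    have "?E (X i) \<le> (1 - \<theta> / 2) * energy (X i) (X i) + L\<^sup>2 / (2 * \<theta>) * (?k (X i))\<^sup>2" for i
      by (rule dom) (rule X)
    then show ?thesis by (intro LIMSEQ_le[OF l r]) auto
  qed
  define q where "q = sqrt (1 - \<theta> / 2)"
  define k where "k x = L / sqrt (2 * \<theta>) * ?k x" for x
  have "q\<^sup>2 = 1 - \<theta> / 2" "0 \<le> q" "q < 1" using \<theta> by (auto simp: q_def)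
  moreover have "(k x)\<^sup>2 = L\<^sup>2 / (2 * \<theta>) * (?k x)\<^sup>2" for x
    using \<theta> by (simp add: k_def power_mult_distrib power_divide)
  moreover have "precompact_wrt semi k"
    unfolding k_def using L \<theta> \<tau> by (intro precompact_wrt_scale grid_precompact) auto
  moreover have "0 \<le> k x" for x using L \<theta> by (simp add: k_def grid_nonneg)
  ultimately show ?thesis using \<tau>(1) all by (intro exI[of _ \<tau>] exI[of _ q] exI[of _ k]) auto
qed

end

section \<open>Isometric orbits and exponential stability\<close>

context dissipative
begin

interpretation b: bounded_bilinear b by (rule bilinear)

definition isometric :: "'a set" where
  "isometric = {x. \<forall>t\<ge>0. b (flow t x) (flow t x) = b x x}"

text \<open>The energy lost by time \<open>t\<close> is a semidefinite form in the initial data, and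
  isometric vectors are null for it, hence in its radical. This is what makes
  \<open>isometric\<close> a linear space.\<close>

lemma isometric_form:
  assumes "x \<in> isometric" "t \<ge> 0" shows "b (flow t x) (flow t y) = b x y"
proof -
  have F: "bounded_linear (flow t)" by (rule flow_bounded_linear) fact
  have "sym_form (\<lambda>x y. b x y + (- 1) * b (flow t x) (flow t y))"
    unfolding sym_form_def
  proof (intro conjI allI)
    show "bounded_bilinear (\<lambda>x y. b x y + (- 1) * b (flow t x) (flow t y))"
      by (rule bounded_bilinear_add[OF bilinear bounded_bilinear_scale[OF
            bounded_bilinear.comp[OF bilinear F F]]])
    show "b x y + (- 1) * b (flow t x) (flow t y) = b y x + (- 1) * b (flow t y) (flow t x)" for x y
      using sym by simp
    show "0 \<le> b x x + (- 1) * b (flow t x) (flow t x)" for x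
      using power_mono[OF flow_semi[OF assms(2), of x], of 2] by (simp add: semi_sq)
  qed
  from sym_form.eq_0_of_diag[OF this, of x y] show ?thesis
    using assms by (simp add: isometric_def)
qed

lemma isometric_add_scale:
  assumes "x \<in> isometric" "y \<in> isometric" shows "x + r *\<^sub>R y \<in> isometric"
proof -
  have "b (flow t (x + r *\<^sub>R y)) (flow t (x + r *\<^sub>R y)) = b (x + r *\<^sub>R y) (x + r *\<^sub>R y)" if "t \<ge> 0" for t
  proof -
    have "flow t (x + r *\<^sub>R y) = flow t x + r *\<^sub>R flow t y"
      using flow_linear[OF that] by (simp add: linear_add linear_scale)
    then show ?thesis
      using isometric_form[OF assms(1) that, of x] isometric_form[OF assms(1) that, of y]
        isometric_form[OF assms(2) that, of y] by (simp only: expand_add_scale)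
  qed
  then show ?thesis by (simp add: isometric_def)
qed

lemma isometric_diff: "x \<in> isometric \<Longrightarrow> y \<in> isometric \<Longrightarrow> x - y \<in> isometric"
  using isometric_add_scale[of x y "- 1"] by simp

lemma isometric_scale: "y \<in> isometric \<Longrightarrow> r *\<^sub>R y \<in> isometric"
  using isometric_add_scale[of "y - y" y r] isometric_diff[of y y] by simp

lemma isometric_flow: assumes "x \<in> isometric" "t \<ge> 0" shows "flow t x \<in> isometric"
proof -
  have "b (flow s (flow t x)) (flow s (flow t x)) = b (flow t x) (flow t x)" if "s \<ge> 0" for s
    using isometric_form[OF assms(1), of "s + t" x] isometric_form[OF assms, of x] that assms(2)
    by (simp add: flow_add)
  then show ?thesis by (simp add: isometric_def)
qed

lemma isometric_closed:
  assumes "\<And>n. X n \<in> isometric" "X \<longlonglongrightarrow> x" shows "x \<in> isometric"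
proof -
  have "b (flow t x) (flow t x) = b x x" if "t \<ge> 0" for t
  proof -
    have "(\<lambda>n. flow t (X n)) \<longlonglongrightarrow> flow t x"
      by (rule bounded_linear.tendsto[OF flow_bounded_linear[OF that] assms(2)])
    then have "(\<lambda>n. b (flow t (X n)) (flow t (X n))) \<longlonglongrightarrow> b (flow t x) (flow t x)" by (rule b.tendsto) fact
    moreover have "(\<lambda>n. b (X n) (X n)) \<longlonglongrightarrow> b x x" by (rule b.tendsto) (rule assms)+
    moreover have "b (flow t (X n)) (flow t (X n)) = b (X n) (X n)" for n
      by (rule isometric_form) (rule assms that)+
    ultimately show ?thesis using LIMSEQ_unique by simp
  qed
  then show ?thesis by (simp add: isometric_def)
qed

lemma isometric_skew_diag:
  assumes "(x, a) \<in> G" "x \<in> isometric" shows "b x a = 0"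
proof -
  have "((\<lambda>t. flow t x) has_vector_derivative flow 0 a) (at_right 0)"
    by (rule flow_deriv[OF assms(1)]) simp
  from b.has_vector_derivative[OF this this]
  have "((\<lambda>h. (b (flow h x) (flow h x) - b x x) /\<^sub>R h) \<longlongrightarrow> b x a + b a x) (at_right 0)"
    by (simp add: right_derivative_iff)
  moreover have "((\<lambda>h. (b (flow h x) (flow h x) - b x x) /\<^sub>R h) \<longlongrightarrow> 0) (at_right 0)"
    by (rule tendsto_eventually) (use assms(2) in \<open>auto simp: eventually_at_filter isometric_def\<close>)
  ultimately have "b x a + b a x = 0" by (rule tendsto_unique[rotated]) simp
  then show ?thesis using sym[of a x] by simp
qed

lemma isometric_skew:
  assumes "(x, a) \<in> G" "x \<in> isometric" "(y, c) \<in> G" "y \<in> isometric" shows "b x c = - b a y"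
proof -
  have "b (x + y) (a + c) = 0"
    using isometric_skew_diag[OF G_add[OF assms(1,3)]] isometric_add_scale[OF assms(2,4), of 1] by simp
  then show ?thesis
    using isometric_skew_diag[OF assms(1,2)] isometric_skew_diag[OF assms(3,4)] sym[of y a]
    by (simp add: b.add_left b.add_right)
qed

text \<open>Minimises the Rayleigh quotient \<open>b a a / b x x\<close> over the graph of the generator restricted
  to \<open>isometric\<close>. The Euler equation and skewness turn \<open>b x (flow t x)\<close> into a cosine, which
  forces the orbit of the minimiser to be harmonic.\<close>

lemma isometric_oscillation:
  assumes comp: "precompact_wrt semi k" and B: "0 \<le> B" "\<And>x. x \<in> isometric \<Longrightarrow> semi x \<le> B * k x"
    and x0: "(x0, a0) \<in> G" "x0 \<in> isometric" "a0 \<in> isometric" "x0 \<noteq> 0"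
  shows "\<exists>x a I. (x, a) \<in> G \<and> (a, - (I *\<^sub>R x)) \<in> G \<and> x \<in> isometric \<and> a \<in> isometric \<and> x \<noteq> 0 \<and> 0 \<le> I"
proof -
  define N where "N = {(x, a). (x, a) \<in> G \<and> x \<in> isometric \<and> a \<in> isometric}"
  have N_comb: "(x + r *\<^sub>R y, a + r *\<^sub>R c) \<in> N" if "(x, a) \<in> N" "(y, c) \<in> N" for x a y c r
    using that by (auto simp: N_def intro: G_add G_scale isometric_add_scale)
  have N_scale: "(r *\<^sub>R x, r *\<^sub>R a) \<in> N" if "(x, a) \<in> N" for x a r
    using that by (auto simp: N_def intro: G_scale isometric_scale)
  have N_diff: "(x - y, a - c) \<in> N" if "(x, a) \<in> N" "(y, c) \<in> N" for x a y c
    using that by (auto simp: N_def intro: G_diff isometric_diff)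
  define Q where "Q = {b a a | x a. (x, a) \<in> N \<and> b x x = 1}"
  define I where "I = Inf Q"
  have pos: "b x x > 0" if "x \<noteq> 0" for x
    using that semi_eq_0[of x] nonneg[of x] by (metis less_eq_real_def real_sqrt_zero semi_def)
  have normalise: "(inverse (semi x) *\<^sub>R x, inverse (semi x) *\<^sub>R a) \<in> N"
    "b (inverse (semi x) *\<^sub>R x) (inverse (semi x) *\<^sub>R x) = 1"
    "b (inverse (semi x) *\<^sub>R a) (inverse (semi x) *\<^sub>R a) = b a a / b x x" if "(x, a) \<in> N" "x \<noteq> 0" for x a
  proof -
    show "(inverse (semi x) *\<^sub>R x, inverse (semi x) *\<^sub>R a) \<in> N" by (rule N_scale) fact
    have s: "inverse (semi x) * inverse (semi x) = inverse (b x x)"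
      by (simp flip: semi_sq add: power2_eq_square)
    have sc: "b (inverse (semi x) *\<^sub>R z) (inverse (semi x) *\<^sub>R z) = inverse (b x x) * b z z" for z
      by (simp only: b.scaleR_left b.scaleR_right real_scaleR_def mult.assoc[symmetric] s)
    show "b (inverse (semi x) *\<^sub>R x) (inverse (semi x) *\<^sub>R x) = 1"
      unfolding sc using pos[OF that(2)] by simp
    show "b (inverse (semi x) *\<^sub>R a) (inverse (semi x) *\<^sub>R a) = b a a / b x x"
      unfolding sc by (simp add: divide_inverse)
  qed
  have "(x0, a0) \<in> N" using x0 by (simp add: N_def)
  from normalise[OF this x0(4)] have Q_ne: "Q \<noteq> {}" unfolding Q_def by blast
  have Q_bdd: "bdd_below Q" unfolding Q_def by (rule bdd_belowI[of _ 0]) (auto simp: nonneg)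
  have I0: "0 \<le> I" unfolding I_def by (rule cInf_greatest[OF Q_ne]) (auto simp: Q_def nonneg)
  have I_le: "I * b x x \<le> b a a" if "(x, a) \<in> N" for x a
  proof (cases "x = 0")
    case True then show ?thesis by (simp add: b.zero_left nonneg)
  next
    case False
    have "b a a / b x x \<in> Q" unfolding Q_def using normalise[OF that False] by force
    then have "I \<le> b a a / b x x" unfolding I_def by (rule cInf_lower) (rule Q_bdd)
    then show ?thesis using pos[OF False] by (simp add: field_simps)
  qed
  have "\<exists>x a. (x, a) \<in> N \<and> b x x = 1 \<and> b a a < I + inverse (real (Suc n))" for n
  proof -
    have "\<exists>y\<in>Q. y < I + inverse (real (Suc n))"
      using cInf_less_iff[OF Q_ne Q_bdd, of "I + inverse (real (Suc n))"] by (simp add: I_def)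
    then show ?thesis unfolding Q_def by blast
  qed
  then obtain X' A' where XA': "\<And>n. (X' n, A' n) \<in> N" "\<And>n. b (X' n) (X' n) = 1"
    "\<And>n. b (A' n) (A' n) < I + inverse (real (Suc n))" by metis
  have "semi (X' n) \<le> 1" for n using XA'(2)[of n] by (simp add: semi_def)
  then obtain r :: "nat \<Rightarrow> nat" where r: "strict_mono r" "Cauchy_wrt k (X' \<circ> r)"
    using precompact_wrtD[OF comp, of X' 1] by blast
  define X where "X n = X' (r n)" for n
  define A where "A n = A' (r n)" for n
  have XA: "(X n, A n) \<in> N" "b (X n) (X n) = 1" for n using XA' by (auto simp: X_def A_def)
  have A_lt: "b (A n) (A n) < I + inverse (real (Suc n))" for n
  proof -
    have "inverse (real (Suc (r n))) \<le> inverse (real (Suc n))"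
      using seq_suble[OF r(1), of n] by auto
    then show ?thesis using XA'(3)[of "r n"] unfolding A_def by linarith
  qed
  \<comment> \<open>On isometric vectors the compact \<open>k\<close> controls \<open>semi\<close>,
    so a \<open>k\<close>-Cauchy minimising sequence converges in norm.\<close>
  have X_Cauchy: "\<exists>M. \<forall>m\<ge>M. \<forall>n\<ge>M. semi (X m - X n) < \<epsilon>" if "\<epsilon> > 0" for \<epsilon>
  proof -
    obtain M where M: "\<forall>m\<ge>M. \<forall>n\<ge>M. k ((X' \<circ> r) m - (X' \<circ> r) n) < \<epsilon> / (B + 1)"
      using Cauchy_wrtD[OF r(2), of "\<epsilon> / (B + 1)"] \<open>\<epsilon> > 0\<close> B(1) by auto
    have "semi (X m - X n) < \<epsilon>" if "m \<ge> M" "n \<ge> M" for m n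
    proof -
      have "semi (X m - X n) \<le> B * k (X m - X n)"
        using XA(1)[of m] XA(1)[of n] by (intro B isometric_diff) (auto simp: N_def)
      also have "\<dots> \<le> B * (\<epsilon> / (B + 1))"
        using M that B(1) by (intro mult_left_mono) (auto simp: X_def less_imp_le)
      also have "\<dots> < \<epsilon>" using \<open>\<epsilon> > 0\<close> B(1) by (simp add: field_simps)
      finally show ?thesis .
    qed
    then show ?thesis by blast
  qed
  then obtain x where x: "X \<longlonglongrightarrow> x" using semi_Cauchy_convergent unfolding convergent_def by blast
  \<comment> \<open>The lower bound \<open>I_le\<close> at the sum of two members and the
    parallelogram law make the images converge too, so that the infimum is attained at a pair in the
    graph.\<close>
  have A_diff: "b (A m - A n) (A m - A n) \<le> 2 * inverse (real (Suc m)) + 2 * inverse (real (Suc n))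
      + I * b (X m - X n) (X m - X n)" for m n
  proof -
    have "I * b (X m + 1 *\<^sub>R X n) (X m + 1 *\<^sub>R X n) \<le> b (A m + 1 *\<^sub>R A n) (A m + 1 *\<^sub>R A n)"
      by (rule I_le[OF N_comb]) (rule XA)+
    moreover have "b (z + 1 *\<^sub>R w) (z + 1 *\<^sub>R w) = 2 * b z z + 2 * b w w - b (z - w) (z - w)" for z w
      by (simp add: form_simps sym[of w z])
    ultimately have "I * (4 - b (X m - X n) (X m - X n)) \<le> 2 * b (A m) (A m) + 2 * b (A n) (A n) - b (A m - A n) (A m - A n)"
      using XA(2)[of m] XA(2)[of n] by simp
    then show ?thesis using A_lt[of m] A_lt[of n] by (simp only: right_diff_distrib)
  qed
  have "convergent A"
  proof (rule semi_Cauchy_convergent)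
    fix \<epsilon> :: real assume \<epsilon>: "\<epsilon> > 0"
    obtain M1 where M1: "inverse (real (Suc M1)) < \<epsilon>\<^sup>2 / 8" using reals_Archimedean[of "\<epsilon>\<^sup>2 / 8"] \<epsilon> by auto
    have "\<epsilon> / (2 * sqrt (I + 1)) > 0" using \<epsilon> I0 by simp
    then obtain M2 where M2: "\<And>m n. m \<ge> M2 \<Longrightarrow> n \<ge> M2 \<Longrightarrow> semi (X m - X n) < \<epsilon> / (2 * sqrt (I + 1))"
      using X_Cauchy by meson
    have "semi (A m - A n) < \<epsilon>" if mn: "m \<ge> M1 + M2" "n \<ge> M1 + M2" for m n
    proof -
      have i: "inverse (real (Suc j)) < \<epsilon>\<^sup>2 / 8" if "j \<ge> M1 + M2" for j
      proof -
        have "inverse (real (Suc j)) \<le> inverse (real (Suc M1))" using that by auto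
        with M1 show ?thesis by linarith
      qed
      have "(semi (X m - X n))\<^sup>2 \<le> (\<epsilon> / (2 * sqrt (I + 1)))\<^sup>2"
        using M2[of m n] mn by (intro power_mono) auto
      also have "\<dots> = \<epsilon>\<^sup>2 / (4 * (I + 1))" using I0 by (simp add: power_divide power_mult_distrib)
      finally have "I * b (X m - X n) (X m - X n) \<le> I * (\<epsilon>\<^sup>2 / (4 * (I + 1)))"
        unfolding semi_sq using I0 by (rule mult_left_mono)
      also have "\<dots> \<le> \<epsilon>\<^sup>2 / 4" using I0 by (simp add: field_simps)
      finally have "(semi (A m - A n))\<^sup>2 < \<epsilon>\<^sup>2"
        using A_diff[of m n] i[OF mn(1)] i[OF mn(2)] zero_le_power2[of \<epsilon>] unfolding semi_sq by argo
      then show ?thesis using \<epsilon> by (simp add: power_less_imp_less_base)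
    qed
    then show "\<exists>M. \<forall>m\<ge>M. \<forall>n\<ge>M. semi (A m - A n) < \<epsilon>" by blast
  qed
  then obtain a where a: "A \<longlonglongrightarrow> a" by (auto simp: convergent_def)
  have xaN: "(x, a) \<in> N"
    using XA(1) G_closed[OF _ x a] isometric_closed[OF _ x] isometric_closed[OF _ a] by (simp add: N_def)
  have bx: "b x x = 1"
    using LIMSEQ_unique[OF b.tendsto[OF x x]] XA(2) by simp
  have ba: "b a a = I"
  proof (rule antisym)
    have "(\<lambda>n. I + inverse (real (Suc n))) \<longlonglongrightarrow> I + 0"
      by (intro tendsto_intros LIMSEQ_inverse_real_of_nat)
    then show "b a a \<le> I"
      by (intro LIMSEQ_le[OF b.tendsto[OF a a], of "\<lambda>n. I + inverse (real (Suc n))"])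
        (use A_lt less_imp_le in auto)
    show "I \<le> b a a" using I_le[OF xaN] bx by simp
  qed
  \<comment> \<open>First variation of \<open>b a a - I * b x x\<close>, which is nonnegative on
    \<open>N\<close> and vanishes at the minimiser.\<close>
  have euler: "b a c = I * b x y" if "(y, c) \<in> N" for y c
  proof -
    have "0 \<le> 0 + 2 * t * (b a c - I * b x y) + t\<^sup>2 * (b c c - I * b y y)" for t
      using I_le[OF N_comb[OF xaN that, of t]] unfolding expand_add_scale ba bx
      by (simp add: algebra_simps)
    then have "(b a c - I * b x y)\<^sup>2 \<le> 0 * (b c c - I * b y y)"
      by (rule quadratic_nonneg_imp) (use I_le[OF that] in simp)
    then show ?thesis by simp
  qed
  have xa: "(x, a) \<in> G" "x \<in> isometric" "a \<in> isometric" using xaN by (auto simp: N_def)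
  have "(a, - (I *\<^sub>R x)) \<in> G"
  proof (cases "I = 0")
    case True
    then have "a = 0" using ba pos[of a] by force
    then show ?thesis using True subspace_0[OF subspace_G] by (simp add: zero_prod_def)
  next
    case False
    define \<nu> where "\<nu> = sqrt I"
    have \<nu>: "\<nu> > 0" "\<nu> * \<nu> = I" using False I0 by (auto simp: \<nu>_def)
    define p where "p t = cos (\<nu> * t) *\<^sub>R x + (sin (\<nu> * t) / \<nu>) *\<^sub>R a" for t
    have flow_p: "flow t x = p t" if t: "t \<ge> 0" for t
    proof -
      \<comment> \<open>\<open>f s\<close> equals \<open>b (p s) (flow s x)\<close>. Skewness and
        the Euler equation make its derivative vanish, so it stays 1; as \<open>p s\<close> and
        \<open>flow s x\<close> are unit vectors, they coincide.\<close>
      define f where "f s = cos (\<nu> * s) * b x (flow s x) + (sin (\<nu> * s) / \<nu>) * b a (flow s x)" for s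
      have df: "(f has_vector_derivative 0) (at_right s)" if s: "s \<ge> 0" for s
      proof -
        have N_flow: "(flow s x, flow s a) \<in> N"
          using xa s by (auto simp: N_def intro: flow_G isometric_flow)
        have d1: "((\<lambda>s. b z (flow s x)) has_real_derivative b z (flow s a)) (at_right s)" for z
          using bounded_linear.has_vector_derivative[OF b.bounded_linear_right flow_deriv[OF xa(1) s]]
          by (simp add: has_real_derivative_iff_has_vector_derivative)
        have e1: "b x (flow s a) = - b a (flow s x)"
          using isometric_skew[OF xa(1,2)] N_flow by (auto simp: N_def)
        have e2: "b a (flow s a) = I * b x (flow s x)" by (rule euler[OF N_flow])
        have "(f has_real_derivative
            (- (sin (\<nu> * s) * \<nu>)) * b x (flow s x) + cos (\<nu> * s) * b x (flow s a)
            + ((cos (\<nu> * s) * \<nu> / \<nu>) * b a (flow s x) + sin (\<nu> * s) / \<nu> * b a (flow s a))) (at_right s)"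
          unfolding f_def using \<nu>(1)
          by (auto intro!: derivative_eq_intros d1 simp: add_divide_distrib)
        moreover have "(- (sin (\<nu> * s) * \<nu>)) * b x (flow s x) + cos (\<nu> * s) * b x (flow s a)
            + ((cos (\<nu> * s) * \<nu> / \<nu>) * b a (flow s x) + sin (\<nu> * s) / \<nu> * b a (flow s a)) = 0"
          unfolding e1 e2 \<nu>(2)[symmetric] using \<nu>(1) by simp
        ultimately show ?thesis by (simp add: has_real_derivative_iff_has_vector_derivative)
      qed
      have cf: "continuous_on {0..t} f"
        unfolding f_def
        by (intro continuous_intros b.continuous_on continuous_on_subset[OF flow_continuous]) (use \<nu> in auto)
      have "f t \<le> f 0 + 0 * (t - 0)"
        by (rule right_derivative_bound[OF t cf, where f' = "\<lambda>_. 0"]) (use df in auto)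
      moreover have "- f t \<le> - f 0 + 0 * (t - 0)"
        by (rule right_derivative_bound[OF t, where f' = "\<lambda>_. - 0"])
          (use df cf in \<open>auto intro!: continuous_intros has_vector_derivative_minus simp del: minus_zero\<close>)
      moreover have "f 0 = 1" by (simp add: f_def bx)
      moreover have "b (flow t x) (p t) = f t"
        unfolding f_def p_def
        by (simp only: b.add_right b.scaleR_right real_scaleR_def sym[of "flow t x" x] sym[of "flow t x" a])
      ultimately have ft: "b (flow t x) (p t) = 1" by simp
      have "b (p t) (p t) = (cos (\<nu> * t))\<^sup>2 * b x x + (sin (\<nu> * t) / \<nu>)\<^sup>2 * b a a"
        using isometric_skew_diag[OF xa(1,2)] sym[of a x]
        by (simp add: p_def form_simps power2_eq_square)
      also have "\<dots> = (cos (\<nu> * t))\<^sup>2 + (sin (\<nu> * t))\<^sup>2"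
        using \<nu> False by (simp add: bx ba power_divide power2_eq_square)
      finally have pp: "b (p t) (p t) = 1" by simp
      have "b (flow t x) (flow t x) = 1" using isometric_form[OF xa(2) t, of x] bx by simp
      then have "b (flow t x - p t) (flow t x - p t) = 0"
        using ft pp sym[of "p t" "flow t x"] by (simp add: form_simps)
      then show ?thesis using pos[of "flow t x - p t"] by force
    qed
    have dp: "(p has_vector_derivative cos (\<nu> * t) *\<^sub>R a - (\<nu> * sin (\<nu> * t)) *\<^sub>R x) (at_right t)" for t
    proof -
      have "((\<lambda>t. cos (\<nu> * t)) has_real_derivative - (\<nu> * sin (\<nu> * t))) (at_right t)"
        by (auto intro!: derivative_eq_intros)
      moreover have "((\<lambda>t. sin (\<nu> * t) / \<nu>) has_real_derivative cos (\<nu> * t)) (at_right t)"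
        using \<nu> by (auto intro!: derivative_eq_intros)
      ultimately have "(p has_vector_derivative (- (\<nu> * sin (\<nu> * t))) *\<^sub>R x + cos (\<nu> * t) *\<^sub>R a) (at_right t)"
        unfolding p_def by (intro has_vector_derivative_add has_vector_derivative_scaleR_left)
      then show ?thesis by simp
    qed
    \<comment> \<open>The orbit of \<open>a\<close> is the derivative of the harmonic orbit of
      \<open>x\<close>; one more derivative at 0 then gives
      \<open>- (I *\<^sub>R x)\<close>.\<close>
    have flow_a: "flow t a = cos (\<nu> * t) *\<^sub>R a - (\<nu> * sin (\<nu> * t)) *\<^sub>R x" if t: "t \<ge> 0" for t
    proof -
      have "((\<lambda>h. (flow (t + h) x - flow t x) /\<^sub>R h) \<longlongrightarrow> flow t a) (at_right 0)"
        using flow_deriv[OF xa(1) t] by (simp add: right_derivative_iff)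
      moreover have "((\<lambda>h. (flow (t + h) x - flow t x) /\<^sub>R h) \<longlongrightarrow> cos (\<nu> * t) *\<^sub>R a - (\<nu> * sin (\<nu> * t)) *\<^sub>R x) (at_right 0)"
        by (rule Lim_transform_eventually[OF dp[of t, unfolded right_derivative_iff]])
          (use t flow_p in \<open>auto simp: eventually_at_filter\<close>)
      ultimately show ?thesis by (rule tendsto_unique[rotated]) simp
    qed
    show ?thesis
    proof (rule flow_generator)
      have "((\<lambda>t. cos (\<nu> * t)) has_real_derivative 0) (at_right 0)"
        by (auto intro!: derivative_eq_intros)
      moreover have "((\<lambda>t. \<nu> * sin (\<nu> * t)) has_real_derivative I) (at_right 0)"
        using \<nu> by (auto intro!: derivative_eq_intros)
      ultimately have "((\<lambda>t. cos (\<nu> * t) *\<^sub>R a - (\<nu> * sin (\<nu> * t)) *\<^sub>R x) has_vector_derivative 0 *\<^sub>R a - I *\<^sub>R x) (at_right 0)"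
        by (intro has_vector_derivative_diff has_vector_derivative_scaleR_left)
      then have "((\<lambda>h. (cos (\<nu> * h) *\<^sub>R a - (\<nu> * sin (\<nu> * h)) *\<^sub>R x - a) /\<^sub>R h) \<longlongrightarrow> - (I *\<^sub>R x)) (at_right 0)"
        by (simp add: right_derivative_iff)
      then show "((\<lambda>h. (flow h a - a) /\<^sub>R h) \<longlongrightarrow> - (I *\<^sub>R x)) (at_right 0)"
        by (rule Lim_transform_eventually) (use flow_a in \<open>auto simp: eventually_at_filter\<close>)
    qed
  qed
  moreover have "x \<noteq> 0" using bx by (auto simp: b.zero_left)
  ultimately show ?thesis using xa I0 by blast
qed

end

text \<open>Read by components, the pairs \<open>(x, a)\<close> and
  \<open>(a, - (I *\<^sub>R x))\<close> of the generator say that \<open>U\<close> and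
  \<open>Z\<close> both solve the eigenvalue equation once the damping terms vanish, and one of the
  two is nonzero.\<close>

lemma (in wave) isometric_eigenmode:
  assumes comp: "precompact_wrt semi k" and B: "0 \<le> B" "\<And>x. x \<in> isometric \<Longrightarrow> semi x \<le> B * k x"
    and x0: "(x0, a0) \<in> wave_op" "x0 \<in> isometric" "a0 \<in> isometric" "x0 \<noteq> 0"
  shows "\<exists>U \<mu>. U \<noteq> 0 \<and> (\<forall>\<phi>. U \<bullet> \<phi> + \<alpha> (J U) (J \<phi>) = \<mu> * (J U \<bullet> J \<phi>)) \<and> \<gamma> U U = 0"
proof -
  interpret J: bounded_linear J by (rule J_linear)
  interpret A: sym_form \<alpha> by (rule \<alpha>_form)
  interpret C: sym_form \<gamma> by (rule \<gamma>_form)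
  obtain x a I where xa: "(x, a) \<in> wave_op" "(a, - (I *\<^sub>R x)) \<in> wave_op"
    "x \<in> isometric" "a \<in> isometric" "x \<noteq> 0" "0 \<le> I"
    using isometric_oscillation[OF comp B x0] by blast
  obtain U Z F where 1: "x = (U, J Z)" "a = (Z, - F)" "\<And>\<phi>. U \<bullet> \<phi> + \<alpha> (J U) (J \<phi>) + \<gamma> Z \<phi> = F \<bullet> J \<phi>"
    using wave_opE[OF xa(1)] by blast
  obtain U' Z' F' where 2: "a = (U', J Z')" "- (I *\<^sub>R x) = (Z', - F')"
    "\<And>\<phi>. U' \<bullet> \<phi> + \<alpha> (J U') (J \<phi>) + \<gamma> Z' \<phi> = F' \<bullet> J \<phi>"
    using wave_opE[OF xa(2)] by blast
  have eqs: "U' = Z" "Z' = - (I *\<^sub>R U)" "F = I *\<^sub>R J U" "F' = I *\<^sub>R J Z"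
    using 1(1,2) 2(1,2) by (auto simp: J.neg J.scaleR minus_equation_iff[of _ F])
  have ZZ: "\<gamma> Z Z = 0"
    using energy_dissipation[OF xa(1)] isometric_skew_diag[OF xa(1,3)] by (simp add: 1)
  have "\<gamma> Z' Z' = 0"
    using energy_dissipation[OF xa(2)] isometric_skew_diag[OF xa(2,4)] by (simp add: 2)
  then have UU: "I * (I * \<gamma> U U) = 0" by (simp add: eqs C.form_simps)
  have U: "U \<bullet> \<phi> + \<alpha> (J U) (J \<phi>) = I * (J U \<bullet> J \<phi>)" for \<phi>
    using 1(3)[of \<phi>] C.eq_0_of_diag[OF ZZ] by (simp add: eqs)
  have Z: "Z \<bullet> \<phi> + \<alpha> (J Z) (J \<phi>) = I * (J Z \<bullet> J \<phi>)" for \<phi>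
    using 2(3)[of \<phi>] C.eq_0_of_diag[OF \<open>\<gamma> Z' Z' = 0\<close>] by (simp add: eqs)
  show ?thesis
  proof (cases "Z = 0")
    case False
    then show ?thesis using Z ZZ by blast
  next
    case True
    then have "U \<noteq> 0" using xa(5) 1 by (auto simp: J.zero zero_prod_def)
    \<comment> \<open>For \<open>U\<close> only \<open>I * (I * \<gamma> U U) = 0\<close> is known,
      so \<open>I\<close> has to be cancelled.\<close>
    moreover from this have "I \<noteq> 0" using U[of U] A.nonneg[of "J U"]
      by (auto simp: add_nonneg_eq_0_iff)
    ultimately show ?thesis using U UU by auto
  qed
qed

theorem (in wave_comparison) exponentially_stable:
  "\<exists>M \<omega>. 1 \<le> M \<and> 0 < \<omega> \<and> (\<forall>t\<ge>0. \<forall>x. norm (flow t x) \<le> M * exp (- \<omega> * t) * norm x)"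
proof -
  interpret C: sym_form \<gamma> by (rule \<gamma>_form)
  interpret C': sym_form \<gamma>' by (rule S.\<gamma>_form)
  obtain \<tau> q k where \<tau>: "0 < \<tau>" and q: "0 \<le> q" "q < 1" and k: "precompact_wrt semi k" "\<And>x. 0 \<le> k x"
    and dec: "\<And>x. energy (flow \<tau> x) (flow \<tau> x) \<le> q\<^sup>2 * energy x x + (k x)\<^sup>2"
    using contraction_up_to_compact by blast
  txt \<open>The dichotomy is applied in the graph norm, transported to the whole space by the resolvent
    \<open>R\<close>: a vector that does not decay then yields a pair in the generator both of whose
    entries have isometric orbits.\<close>
  define R where "R = Res 1"
  define \<beta> where "\<beta> v w = energy (R v) (R w) + energy (R v - v) (R w - w)" for v w
  have R_lin: "linear R" unfolding R_def by (rule Res_linear) simp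
  have R_bd: "bounded_linear R"
    unfolding R_def by (intro bounded_linear_of_contraction Res_linear Res_semi) simp_all
  have R_G: "(R v, R v - v) \<in> wave_op" for v unfolding R_def by (rule Res_1_G)
  have R_flow: "R (flow t v) = flow t (R v)" "R (flow t v) - flow t v = flow t (R v - v)" if "t \<ge> 0" for t v
  proof -
    have "R (flow t (R v) - 1 *\<^sub>R flow t (R v - v)) = flow t (R v)"
      unfolding R_def by (rule Res_unique[OF flow_G[OF R_G[unfolded R_def] that]]) simp
    then show "R (flow t v) = flow t (R v)" using linear_diff[OF flow_linear[OF that]] by simp
    then show "R (flow t v) - flow t v = flow t (R v - v)" using linear_diff[OF flow_linear[OF that]] by simp
  qed
  have "coercive_form \<beta>"
  proof (rule coercive_formI)
    show "sym_form \<beta>" unfolding \<beta>_def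
      by (rule sym_form_add[OF sym_form_compose[OF sym_form_axioms R_bd]
            sym_form_compose[OF sym_form_axioms bounded_linear_sub[OF R_bd bounded_linear_ident]]])
    show "1 / 2 * (norm v)\<^sup>2 \<le> \<beta> v v" for v
    proof -
      have "norm v \<le> norm (R v) + norm (R v - v)"
        using norm_triangle_ineq4[of "R v" "R v - v"] by simp
      then have "norm v \<le> semi (R v) + semi (R v - v)"
        using norm_le_energy[of "R v"] norm_le_energy[of "R v - v"] by linarith
      then have "(norm v)\<^sup>2 \<le> (semi (R v) + semi (R v - v))\<^sup>2" by (intro power_mono) auto
      also have "\<dots> \<le> 2 * ((semi (R v))\<^sup>2 + (semi (R v - v))\<^sup>2)"
        using zero_le_power2[of "semi (R v) - semi (R v - v)"] by (simp add: power2_sum power2_diff)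
      finally show ?thesis by (simp add: \<beta>_def semi_sq)
    qed
  qed simp
  then interpret \<beta>: coercive_form \<beta> .
  have \<beta>_flow: "\<beta> (flow t v) (flow t v)
      = energy (flow t (R v)) (flow t (R v)) + energy (flow t (R v - v)) (flow t (R v - v))"
    if "t \<ge> 0" for t v using R_flow[OF that] by (simp add: \<beta>_def)
  have e_contr: "energy (flow t x) (flow t x) \<le> energy x x" if "t \<ge> 0" for t x
    using power_mono[OF flow_semi[OF that, of x], of 2] by (simp add: semi_sq)
  have \<beta>_contr: "\<beta> (flow t v) (flow t v) \<le> \<beta> v v" if "t \<ge> 0" for t v
    unfolding \<beta>_flow[OF that] \<beta>_def[of v v] by (intro add_mono e_contr that)
  have Tpow: "(flow \<tau> ^^ n) v = flow (real n * \<tau>) v" for n v using flow_mult[of \<tau> n v] \<tau> by simp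
  let ?k = "\<lambda>v. k (R v) + k (R v - v)"
  have "(\<exists>n r. r < 1 \<and> (\<forall>x. \<beta>.semi ((flow \<tau> ^^ n) x) \<le> r * \<beta>.semi x)) \<or>
    (\<exists>y. y \<noteq> 0 \<and> (\<forall>n. \<beta>.semi ((flow \<tau> ^^ n) y) = \<beta>.semi y))"
  proof (rule \<beta>.contraction_dichotomy)
    show "linear (flow \<tau>)" using \<tau> by (intro flow_linear) simp
    show "\<beta>.semi (flow \<tau> x) \<le> \<beta>.semi x" for x
      unfolding \<beta>.semi_def using \<beta>_contr[of \<tau> x] \<tau> by simp
    show "0 \<le> q" "q < 1" by fact+
    show "\<beta>.semi (flow \<tau> v) \<le> q * \<beta>.semi v + ?k v" for v
    proof (rule power2_le_imp_le)
      have "(\<beta>.semi (flow \<tau> v))\<^sup>2 = \<beta> (flow \<tau> v) (flow \<tau> v)" by (rule \<beta>.semi_sq)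
      also have "\<dots> \<le> (q\<^sup>2 * energy (R v) (R v) + (k (R v))\<^sup>2) + (q\<^sup>2 * energy (R v - v) (R v - v) + (k (R v - v))\<^sup>2)"
        using \<tau> by (subst \<beta>_flow) (auto intro!: add_mono dec)
      also have "\<dots> = q\<^sup>2 * (\<beta>.semi v)\<^sup>2 + ((k (R v))\<^sup>2 + (k (R v - v))\<^sup>2)"
        by (simp add: \<beta>.semi_sq \<beta>_def distrib_left)
      also have "\<dots> \<le> (q * \<beta>.semi v + ?k v)\<^sup>2"
      proof -
        have "0 \<le> 2 * (q * \<beta>.semi v * ?k v) + 2 * (k (R v) * k (R v - v))"
          using q k(2) by (intro add_nonneg_nonneg mult_nonneg_nonneg) auto
        then show ?thesis by (simp add: power2_sum power_mult_distrib)
      qed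
      finally show "(\<beta>.semi (flow \<tau> v))\<^sup>2 \<le> (q * \<beta>.semi v + ?k v)\<^sup>2" .
      show "0 \<le> q * \<beta>.semi v + ?k v" using q k(2) by (intro add_nonneg_nonneg mult_nonneg_nonneg) auto
    qed
    have "semi (R v) \<le> 1 * \<beta>.semi v" "semi (R v - v) \<le> 1 * \<beta>.semi v" for v
      using nonneg by (auto simp: semi_def \<beta>.semi_def \<beta>_def)
    then show "precompact_wrt \<beta>.semi ?k"
      by (intro precompact_wrt_add precompact_wrt_compose[OF k(1), where c = 1])
        (auto simp: linear_diff[OF R_lin])
  qed
  then show ?thesis
  proof
    assume "\<exists>n r. r < 1 \<and> (\<forall>x. \<beta>.semi ((flow \<tau> ^^ n) x) \<le> r * \<beta>.semi x)"
    then obtain n r where r: "r < 1" "\<And>x. \<beta>.semi ((flow \<tau> ^^ n) x) \<le> r * \<beta>.semi x" by blast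
    \<comment> \<open>\<open>Suc n\<close> instead of \<open>n\<close> makes the time positive even
      for \<open>n = 0\<close>; the additional step does not increase
      \<open>\<beta>\<close>.\<close>
    define \<tau>' where "\<tau>' = real (Suc n) * \<tau>"
    have \<tau>': "\<tau>' > 0" using \<tau> by (simp add: \<tau>'_def)
    have dec': "\<beta> (flow \<tau>' x) (flow \<tau>' x) \<le> (max r 0)\<^sup>2 * \<beta> x x" for x
    proof -
      have "flow \<tau>' x = flow \<tau> ((flow \<tau> ^^ n) x)" using Tpow[of "Suc n" x] by (simp add: \<tau>'_def)
      then have "\<beta>.semi (flow \<tau>' x) \<le> \<beta>.semi ((flow \<tau> ^^ n) x)"
        unfolding \<beta>.semi_def using \<beta>_contr[of \<tau>] \<tau> by simp
      also have "\<dots> \<le> max r 0 * \<beta>.semi x"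
        using r(2)[of x] mult_right_mono[of r "max r 0" "\<beta>.semi x"] by simp
      finally have "(\<beta>.semi (flow \<tau>' x))\<^sup>2 \<le> (max r 0 * \<beta>.semi x)\<^sup>2" by (intro power_mono) auto
      then show ?thesis by (simp add: power_mult_distrib \<beta>.semi_sq)
    qed
    have r1: "(max r 0)\<^sup>2 < 1" using r(1) by (auto simp: max_def power_less_one_iff abs_square_less_1)
    show ?thesis
      by (rule exponential_decay[OF \<open>coercive_form \<beta>\<close> _ \<tau>' r1 dec']) (rule \<beta>_contr)
  next
    assume "\<exists>y. y \<noteq> 0 \<and> (\<forall>n. \<beta>.semi ((flow \<tau> ^^ n) y) = \<beta>.semi y)"
    then obtain v where v: "v \<noteq> 0" "\<And>n. \<beta>.semi ((flow \<tau> ^^ n) v) = \<beta>.semi v" by blast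
    \<comment> \<open>\<open>\<beta>\<close> is nonincreasing along the orbit and has its initial
      value at arbitrarily large multiples of \<open>\<tau>\<close>.\<close>
    have \<beta>_const: "\<beta> (flow t v) (flow t v) = \<beta> v v" if t: "t \<ge> 0" for t
    proof (rule antisym[OF \<beta>_contr[OF t]])
      obtain n :: nat where n: "t / \<tau> < real n" using reals_Archimedean2 by blast
      then have nt: "t \<le> real n * \<tau>" using \<tau> by (simp add: field_simps)
      have "\<beta> v v = \<beta> (flow (real n * \<tau>) v) (flow (real n * \<tau>) v)"
        using v(2)[of n] unfolding Tpow by (simp flip: \<beta>.semi_sq)
      also have "flow (real n * \<tau>) v = flow (real n * \<tau> - t) (flow t v)"
        using flow_add[of "real n * \<tau> - t" t v] nt t by simp
      also have "\<beta> \<dots> \<dots> \<le> \<beta> (flow t v) (flow t v)" using nt by (intro \<beta>_contr) simp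
      finally show "\<beta> v v \<le> \<beta> (flow t v) (flow t v)" .
    qed
    \<comment> \<open>Two nonincreasing energies with constant sum are both constant.\<close>
    have iso: "R v \<in> isometric" "R v - v \<in> isometric"
    proof -
      have "energy (flow t (R v)) (flow t (R v)) = energy (R v) (R v) \<and>
          energy (flow t (R v - v)) (flow t (R v - v)) = energy (R v - v) (R v - v)" if t: "t \<ge> 0" for t
        using \<beta>_const[OF t] e_contr[OF t, of "R v"] e_contr[OF t, of "R v - v"]
        unfolding \<beta>_flow[OF t] \<beta>_def[of v v] by linarith
      then show "R v \<in> isometric" "R v - v \<in> isometric" by (auto simp: isometric_def)
    qed
    have Rv: "R v \<noteq> 0"
    proof
      assume 0: "R v = 0"
      have "((\<lambda>h. (flow h (R v) - R v) /\<^sub>R h) \<longlongrightarrow> R v - v) (at_right 0)" by (rule flow_right_limit_0[OF R_G])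
      moreover have "((\<lambda>h. (flow h (R v) - R v) /\<^sub>R h) \<longlongrightarrow> 0) (at_right 0)"
        by (rule tendsto_eventually) (auto simp: 0 eventually_at_filter linear_0[OF flow_linear])
      ultimately have "R v - v = 0" by (rule tendsto_unique[rotated]) simp
      with 0 v(1) show False by simp
    qed
    \<comment> \<open>For an isometric vector the energy at time \<open>\<tau>\<close> is the
      initial one, so the term with \<open>q\<^sup>2\<close> is absorbed on the left and
      \<open>k\<close> alone controls the energy.\<close>
    have loc: "semi x \<le> 1 / (1 - q) * k x" if x: "x \<in> isometric" for x
    proof -
      have "(semi x)\<^sup>2 \<le> q\<^sup>2 * (semi x)\<^sup>2 + (k x)\<^sup>2"
        using dec[of x] isometric_form[OF x, of \<tau> x] \<tau> by (simp add: semi_sq)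
      also have "\<dots> \<le> (q * semi x + k x)\<^sup>2" using q k(2)[of x] by (simp add: power2_sum power_mult_distrib)
      finally have "semi x \<le> q * semi x + k x"
        by (rule power2_le_imp_le) (use q k(2)[of x] in simp)
      then show ?thesis using q by (simp add: field_simps)
    qed
    obtain U \<mu> where U: "U \<noteq> 0" "\<And>\<phi>. U \<bullet> \<phi> + \<alpha> (J U) (J \<phi>) = \<mu> * (J U \<bullet> J \<phi>)" "\<gamma> U U = 0"
      using isometric_eigenmode[OF k(1) _ loc R_G iso Rv] q by auto
    have "\<gamma>' U U = 0" using lower[of U] c\<^sub>0 U(3) C'.nonneg[of U] by (simp add: mult_le_0_iff)
    then have "\<gamma>' U \<phi> = 0" for \<phi> by (rule C'.eq_0_of_diag)
    with unique_continuation[OF U(2)] U(1) show ?thesis by blast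
  qed
qed

section \<open>Symmetric matrices\<close>

lemma symmetric_dot: "transpose B = B \<Longrightarrow> x \<bullet> (B *v y) = (B *v x) \<bullet> y" for B :: "real^'n^'n"
  by (metis dot_lmul_matrix transpose_matrix_vector)

lemma quadratic_normalise:
  fixes B :: "real^'n^'n"
  shows "(inverse (norm x) *\<^sub>R x) \<bullet> (B *v (inverse (norm x) *\<^sub>R x)) = (x \<bullet> (B *v x)) / (x \<bullet> x)"
  unfolding matrix_vector_mult_scaleR inner_scaleR_left inner_scaleR_right dot_square_norm power2_eq_square
  by (simp only: divide_inverse inverse_mult_distrib mult_ac)

lemma matrix_mult_add_left: "(A + B) ** C = A ** C + B ** (C :: real^'n^'m)"
  by (simp add: matrix_matrix_mult_def vec_eq_iff distrib_right sum.distrib)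

text \<open>A maximiser of the quadratic form on the unit sphere of \<open>S\<close> will do: the
  first variation in the direction \<open>\<mu> *\<^sub>R e - B *v e\<close>, which lies in
  \<open>S\<close>, must vanish.\<close>

lemma symmetric_eigenvector:
  fixes B :: "real^'n^'n"
  assumes B: "transpose B = B" and S: "subspace S" "\<And>x. x \<in> S \<Longrightarrow> B *v x \<in> S" "S \<noteq> {0}"
  shows "\<exists>e \<mu>. e \<in> S \<and> norm e = 1 \<and> B *v e = \<mu> *\<^sub>R e"
proof -
  have "closed S" by (rule closed_subspace) fact
  then have "compact (sphere 0 1 \<inter> S)" by (intro compact_Int_closed compact_sphere)
  moreover have "sphere 0 1 \<inter> S \<noteq> {}"
  proof -
    obtain x where x: "x \<in> S" "x \<noteq> 0" using S(1,3) subspace_0 by blast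
    then have "inverse (norm x) *\<^sub>R x \<in> sphere 0 1 \<inter> S" using S(1) by (simp add: subspace_scale)
    then show ?thesis by blast
  qed
  moreover have "continuous_on (sphere 0 1 \<inter> S) (\<lambda>x. x \<bullet> (B *v x))"
    by (intro continuous_intros bounded_linear.continuous_on[OF matrix_vector_mul_bounded_linear])
  ultimately obtain e where e: "e \<in> sphere 0 1 \<inter> S"
    "\<And>x. x \<in> sphere 0 1 \<inter> S \<Longrightarrow> x \<bullet> (B *v x) \<le> e \<bullet> (B *v e)"
    using continuous_attains_sup[of "sphere 0 1 \<inter> S" "\<lambda>x. x \<bullet> (B *v x)"] by blast
  define \<mu> where "\<mu> = e \<bullet> (B *v e)"
  have e1: "norm e = 1" "e \<in> S" using e(1) by auto
  have ee: "e \<bullet> e = 1" using e1 by (simp add: norm_eq_1)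
  have max: "x \<bullet> (B *v x) \<le> \<mu> * (x \<bullet> x)" if "x \<in> S" for x
  proof (cases "x = 0")
    case False
    have "inverse (norm x) *\<^sub>R x \<in> sphere 0 1 \<inter> S" using that S(1) False by (simp add: subspace_scale)
    from e(2)[OF this] show ?thesis
      unfolding quadratic_normalise \<mu>_def using False by (simp add: pos_divide_le_eq)
  qed simp
  have "B *v e = \<mu> *\<^sub>R e"
  proof -
    define y where "y = \<mu> *\<^sub>R e - B *v e"
    have y: "y \<in> S" unfolding y_def using S e1 by (intro subspace_diff subspace_scale) auto
    have "0 \<le> 0 + 2 * t * (y \<bullet> y) + t\<^sup>2 * (\<mu> * (y \<bullet> y) - y \<bullet> (B *v y))" for t
    proof -
      have "e + t *\<^sub>R y \<in> S" using S(1) e1 y by (intro subspace_add subspace_scale)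
      note max[OF this]
      also have "(e + t *\<^sub>R y) \<bullet> (B *v (e + t *\<^sub>R y))
          = \<mu> + 2 * t * ((B *v e) \<bullet> y) + t\<^sup>2 * (y \<bullet> (B *v y))"
        by (simp add: \<mu>_def matrix_vector_right_distrib matrix_vector_mult_scaleR inner_add_left
            inner_add_right symmetric_dot[OF B, of e y] inner_commute[of y "B *v e"] power2_eq_square algebra_simps)
      also have "\<mu> * ((e + t *\<^sub>R y) \<bullet> (e + t *\<^sub>R y)) = \<mu> + 2 * t * ((\<mu> *\<^sub>R e) \<bullet> y) + t\<^sup>2 * (\<mu> * (y \<bullet> y))"
        by (simp add: inner_add_left inner_add_right inner_commute[of y e] ee power2_eq_square algebra_simps)
      finally have "0 \<le> 2 * t * ((\<mu> *\<^sub>R e) \<bullet> y - (B *v e) \<bullet> y) + t\<^sup>2 * (\<mu> * (y \<bullet> y) - y \<bullet> (B *v y))"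
        by (simp add: algebra_simps)
      then show ?thesis by (simp add: y_def inner_diff_left)
    qed
    then have "(y \<bullet> y)\<^sup>2 \<le> 0 * (\<mu> * (y \<bullet> y) - y \<bullet> (B *v y))"
      by (rule quadratic_nonneg_imp) (use max[OF y] in simp)
    then show ?thesis by (simp add: y_def)
  qed
  with e1 show ?thesis by blast
qed

text \<open>Induction on the dimension: by symmetry, the part of \<open>S\<close> orthogonal to one
  eigenvector is again invariant.\<close>

lemma symmetric_spectral_subspace:
  fixes B :: "real^'n^'n"
  assumes B: "transpose B = B" and S: "subspace S" "\<And>x. x \<in> S \<Longrightarrow> B *v x \<in> S"
  shows "\<exists>E. finite E \<and> E \<subseteq> S \<and> (\<forall>e\<in>E. B *v e = (e \<bullet> (B *v e)) *\<^sub>R e) \<and> (\<forall>x\<in>S. x = (\<Sum>e\<in>E. (e \<bullet> x) *\<^sub>R e))"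
  using S
proof (induction "dim S" arbitrary: S rule: less_induct)
  case less
  show ?case
  proof (cases "S = {0}")
    case True
    then show ?thesis by (intro exI[of _ "{}"]) simp
  next
    case False
    then obtain e \<mu> where e: "e \<in> S" "norm e = 1" "B *v e = \<mu> *\<^sub>R e"
      using symmetric_eigenvector[OF B less.prems] by blast
    have ee: "e \<bullet> e = 1" using e by (simp add: norm_eq_1)
    define S' where "S' = {x \<in> S. e \<bullet> x = 0}"
    have S': "subspace S'"
      unfolding S'_def subspace_def using less.prems(1)
      by (auto simp: subspace_0 subspace_add subspace_scale inner_add_right)
    have inv: "B *v x \<in> S'" if "x \<in> S'" for x
      using that less.prems(2)[of x] symmetric_dot[OF B, of e x] e(3) by (simp add: S'_def)
    have "e \<notin> S'" using ee by (simp add: S'_def)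
    moreover have "S' \<subseteq> S" by (auto simp: S'_def)
    ultimately have "S' \<subset> S" using e(1) by blast
    then have "dim S' < dim S"
      using less.prems(1) S' by (intro dim_psubset) (simp add: span_eq_iff[THEN iffD2])
    from less.hyps[OF this S' inv] obtain E where E: "finite E" "E \<subseteq> S'"
      "\<forall>f\<in>E. B *v f = (f \<bullet> (B *v f)) *\<^sub>R f" "\<forall>x\<in>S'. x = (\<Sum>f\<in>E. (f \<bullet> x) *\<^sub>R f)" by blast
    have "x = (\<Sum>f\<in>insert e E. (f \<bullet> x) *\<^sub>R f)" if x: "x \<in> S" for x
    proof -
      have "x - (e \<bullet> x) *\<^sub>R e \<in> S'"
        using x e(1) less.prems(1) ee by (simp add: S'_def subspace_diff subspace_scale inner_diff_right)
      then have "x - (e \<bullet> x) *\<^sub>R e = (\<Sum>f\<in>E. (f \<bullet> (x - (e \<bullet> x) *\<^sub>R e)) *\<^sub>R f)" using E(4) by blast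
      also have "\<dots> = (\<Sum>f\<in>E. (f \<bullet> x) *\<^sub>R f)"
      proof (rule sum.cong[OF refl])
        fix f assume "f \<in> E"
        then have "f \<bullet> e = 0" using E(2) by (auto simp: S'_def inner_commute)
        then show "(f \<bullet> (x - (e \<bullet> x) *\<^sub>R e)) *\<^sub>R f = (f \<bullet> x) *\<^sub>R f" by (simp add: inner_diff_right)
      qed
      finally have "x = (e \<bullet> x) *\<^sub>R e + (\<Sum>f\<in>E. (f \<bullet> x) *\<^sub>R f)" by (simp add: algebra_simps)
      then show ?thesis using E(1,2) \<open>e \<notin> S'\<close> by (subst sum.insert) auto
    qed
    moreover have "B *v e = (e \<bullet> (B *v e)) *\<^sub>R e" using e ee by simp
    ultimately show ?thesis
      using E e(1) by (intro exI[of _ "insert e E"]) (auto simp: S'_def)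
  qed
qed

text \<open>The coordinate form is what sums over tuple indices require, where the components are
  vectors of V or H and not reals.\<close>

lemma symmetric_spectral:
  fixes B :: "real^'n^'n"
  assumes B: "transpose B = B"
  obtains E where "finite E" "\<And>e. e \<in> E \<Longrightarrow> B *v e = (e \<bullet> (B *v e)) *\<^sub>R e"
    "\<And>i k. (\<Sum>e\<in>E. e $ i * e $ k) = (if i = k then 1 else 0)"
    "\<And>i k. B $ i $ k = (\<Sum>e\<in>E. (e \<bullet> (B *v e)) * (e $ i * e $ k))"
proof -
  obtain E where E: "finite E" "\<And>e. e \<in> E \<Longrightarrow> B *v e = (e \<bullet> (B *v e)) *\<^sub>R e"
    "\<And>x. x = (\<Sum>e\<in>E. (e \<bullet> x) *\<^sub>R e)"
    using symmetric_spectral_subspace[OF B subspace_UNIV] by auto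
  have ax: "axis k 1 = (\<Sum>e\<in>E. e $ k *\<^sub>R e)" for k
  proof -
    have "axis k 1 = (\<Sum>e\<in>E. (e \<bullet> axis k 1) *\<^sub>R e)" by (rule E(3))
    also have "\<dots> = (\<Sum>e\<in>E. e $ k *\<^sub>R e)" by (simp add: inner_axis)
    finally show ?thesis .
  qed
  show thesis
  proof (rule that[OF E(1,2)])
    fix i k
    have "(\<Sum>e\<in>E. e $ i * e $ k) = (axis k 1 :: real^'n) $ i"
      by (subst ax) (simp add: sum_component mult.commute)
    then show "(\<Sum>e\<in>E. e $ i * e $ k) = (if i = k then 1 else 0)" by (simp add: axis_def)
    have "B $ i $ k = (B *v axis k 1) $ i"
      by (simp add: matrix_vector_mult_basis column_def)
    also have "B *v axis k 1 = (\<Sum>e\<in>E. e $ k *\<^sub>R (B *v e))"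
      by (subst ax) (simp add: linear_sum[OF matrix_vector_mul_linear] matrix_vector_mult_scaleR)
    also have "\<dots> = (\<Sum>e\<in>E. e $ k *\<^sub>R ((e \<bullet> (B *v e)) *\<^sub>R e))"
      by (intro sum.cong refl arg_cong2[of _ _ _ _ "(*\<^sub>R)"] E)
    finally show "B $ i $ k = (\<Sum>e\<in>E. (e \<bullet> (B *v e)) * (e $ i * e $ k))"
      by (simp add: sum_component algebra_simps)
  qed
qed

lemma positive_definite_bound:
  fixes B :: "real^'n^'n"
  assumes "\<And>x. x \<noteq> 0 \<Longrightarrow> 0 < x \<bullet> (B *v x)"
  shows "\<exists>c>0. \<forall>x. c * (x \<bullet> x) \<le> x \<bullet> (B *v x)"
proof -
  have "continuous_on (sphere 0 1) (\<lambda>x. x \<bullet> (B *v x))"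
    by (intro continuous_intros bounded_linear.continuous_on[OF matrix_vector_mul_bounded_linear])
  moreover have "(axis undefined 1 :: real^'n) \<in> sphere 0 1" by simp
  ultimately obtain e where e: "e \<in> sphere 0 1"
    "\<And>x. x \<in> sphere 0 1 \<Longrightarrow> e \<bullet> (B *v e) \<le> x \<bullet> (B *v x)"
    using continuous_attains_inf[of "sphere 0 1" "\<lambda>x. x \<bullet> (B *v x)"] by (metis compact_sphere empty_iff)
  have "e \<noteq> 0" using e(1) by auto
  moreover have "e \<bullet> (B *v e) * (x \<bullet> x) \<le> x \<bullet> (B *v x)" for x
  proof (cases "x = 0")
    case False
    have "inverse (norm x) *\<^sub>R x \<in> sphere 0 1" using False by simp
    from e(2)[OF this] show ?thesis
      unfolding quadratic_normalise using False by (simp add: pos_le_divide_eq)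
  qed simp
  ultimately show ?thesis using assms by blast
qed

text \<open>A null vector minimises the quadratic form; the variation in the direction
  \<open>B *v x\<close> gives the claim.\<close>

lemma psd_null:
  fixes B :: "real^'n^'n"
  assumes B: "symmetric_psd B" and x: "x \<bullet> (B *v x) = 0"
  shows "B *v x = 0"
proof -
  let ?y = "B *v x"
  have s: "transpose B = B" "\<And>x. 0 \<le> x \<bullet> (B *v x)" using B by (auto simp: symmetric_psd_def)
  have "(x + t *\<^sub>R ?y) \<bullet> (B *v (x + t *\<^sub>R ?y)) = 0 + 2 * t * (?y \<bullet> ?y) + t\<^sup>2 * (?y \<bullet> (B *v ?y))" for t
    using x by (simp add: matrix_vector_right_distrib matrix_vector_mult_scaleR inner_add_left
        inner_add_right symmetric_dot[OF s(1), of x ?y] power2_eq_square algebra_simps)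
  then have "0 \<le> 0 + 2 * t * (?y \<bullet> ?y) + t\<^sup>2 * (?y \<bullet> (B *v ?y))" for t using s(2) by metis
  then have "(?y \<bullet> ?y)\<^sup>2 \<le> 0 * (?y \<bullet> (B *v ?y))" by (rule quadratic_nonneg_imp) (rule s)
  then show ?thesis by simp
qed

text \<open>\<open>Q\<close> is the Gram-type sum over an orthonormal basis of the kernel. The three
  properties determine the orthogonal projection, and everything later rests on them alone.\<close>

lemma kernel_projection:
  fixes C :: "real^'n^'m"
  obtains Q :: "real^'n^'n" where "transpose Q = Q" "C ** Q = 0" "\<And>x. C *v x = 0 \<Longrightarrow> Q *v x = x"
proof -
  have K: "subspace (matrix_ker C)"
    by (auto simp: subspace_def matrix_ker_def matrix_vector_right_distrib matrix_vector_mult_scaleR)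
  obtain B where B: "B \<subseteq> matrix_ker C" "pairwise orthogonal B" "\<And>x. x \<in> B \<Longrightarrow> norm x = 1"
    "independent B" "span B = matrix_ker C"
    using orthonormal_basis_subspace[OF K] by metis
  have fin: "finite B" by (rule independent_imp_finite) fact
  define Q :: "real^'n^'n" where "Q = (\<chi> i k. \<Sum>b\<in>B. b $ i * b $ k)"
  have Q: "Q *v x = (\<Sum>b\<in>B. (b \<bullet> x) *\<^sub>R b)" for x
  proof (rule vec_eq_iff[THEN iffD2], rule allI)
    fix i
    have "(Q *v x) $ i = (\<Sum>k\<in>UNIV. \<Sum>b\<in>B. b $ i * b $ k * x $ k)"
      by (simp add: Q_def matrix_vector_mult_def sum_distrib_right)
    also have "\<dots> = (\<Sum>b\<in>B. \<Sum>k\<in>UNIV. b $ i * b $ k * x $ k)" by (rule sum.swap)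
    also have "\<dots> = (\<Sum>b\<in>B. (b \<bullet> x) *\<^sub>R b) $ i"
      by (simp add: sum_component inner_vec_def sum_distrib_left mult_ac)
    finally show "(Q *v x) $ i = (\<Sum>b\<in>B. (b \<bullet> x) *\<^sub>R b) $ i" .
  qed
  show thesis
  proof
    show "transpose Q = Q" by (simp add: Q_def transpose_def vec_eq_iff mult.commute)
    have "C *v (Q *v x) = 0" for x
    proof -
      have "Q *v x \<in> matrix_ker C"
        unfolding Q using B(1) K by (intro subspace_sum subspace_scale) auto
      then show ?thesis by (simp add: matrix_ker_def)
    qed
    then show "C ** Q = 0" by (simp add: matrix_eq matrix_vector_mul_assoc[symmetric])
    fix x assume "C *v x = 0"
    then have "x \<in> span B" by (simp add: B matrix_ker_def)
    from orthonormal_basis_expand[OF B(2) _ this fin] show "Q *v x = x"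
      unfolding Q using B(3) by (simp add: inner_commute)
  qed
qed

text \<open>\<open>transpose C ** C + Q\<close> is injective, and its left inverse \<open>E\<close>
  satisfies \<open>E ** Q = Q\<close>, so \<open>B = E ** transpose C\<close>. Thus the projected
  state is bounded by \<open>C\<close> applied to the state.\<close>

lemma left_factor_projection:
  fixes C :: "real^'n^'m" and Q :: "real^'n^'n"
  assumes Q: "transpose Q = Q" "C ** Q = 0" "\<And>x. C *v x = 0 \<Longrightarrow> Q *v x = x"
  shows "\<exists>B. mat 1 - Q = B ** C"
proof -
  have QQ: "Q ** Q = Q"
    by (simp add: matrix_eq flip: matrix_vector_mul_assoc)
      (metis Q(2,3) matrix_vector_mul_assoc matrix_vector_mult_0)
  let ?S = "transpose C ** C + Q"
  have "x = 0" if "?S *v x = 0" for x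
  proof -
    have "x \<bullet> (?S *v x) = (C *v x) \<bullet> (C *v x) + (Q *v x) \<bullet> (Q *v x)"
    proof -
      have "x \<bullet> (transpose C *v (C *v x)) = (C *v x) \<bullet> (C *v x)"
        by (metis dot_lmul_matrix inner_commute transpose_matrix_vector transpose_transpose)
      moreover have "x \<bullet> (Q *v x) = (Q *v x) \<bullet> (Q *v x)"
        using symmetric_dot[OF Q(1), of x "Q *v x"] by (simp add: matrix_vector_mul_assoc QQ)
      ultimately show ?thesis
        by (simp add: matrix_vector_mult_add_rdistrib inner_add_right flip: matrix_vector_mul_assoc)
    qed
    then have "(C *v x) \<bullet> (C *v x) + (Q *v x) \<bullet> (Q *v x) = 0" using that by simp
    then have "C *v x = 0" "Q *v x = 0"
      using inner_ge_zero[of "C *v x"] inner_ge_zero[of "Q *v x"]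
      by (simp_all add: add_nonneg_eq_0_iff)
    then show "x = 0" using Q(3) by simp
  qed
  then obtain E where E: "E ** ?S = mat 1" using matrix_left_invertible_ker[of ?S] by blast
  have "E ** Q = E ** (?S ** Q)"
    using Q(2) by (simp add: matrix_mult_add_left QQ flip: matrix_mul_assoc)
  also have "\<dots> = Q" by (simp add: matrix_mul_assoc E)
  finally have "(E ** transpose C) ** C = mat 1 - Q"
    using E by (simp add: matrix_add_ldistrib matrix_mul_assoc algebra_simps)
  then show ?thesis by metis
qed

section \<open>Tuples of vectors\<close>

lemma norm_vec_le_sum: "norm (U :: 'a::real_normed_vector^'n) \<le> (\<Sum>i\<in>UNIV. norm (U $ i))"
  by (simp add: norm_vec_def L2_set_le_sum)

lemma bounded_linear_vecI:
  assumes "\<And>i. bounded_linear (\<lambda>x. f x $ i)" shows "bounded_linear (f :: 'a::real_normed_vector \<Rightarrow> 'b::real_normed_vector^'n)"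
proof -
  have "\<forall>i. \<exists>K. \<forall>x. norm (f x $ i) \<le> norm x * K"
    using bounded_linear.bounded[OF assms] by blast
  then obtain K where K: "\<And>i x. norm (f x $ i) \<le> norm x * K i" by metis
  show ?thesis
  proof (rule bounded_linear_intro[of _ "\<Sum>i\<in>UNIV. K i"])
    show "f (x + y) = f x + f y" for x y
      by (simp add: vec_eq_iff linear_add[OF bounded_linear.linear[OF assms]])
    show "f (r *\<^sub>R x) = r *\<^sub>R f x" for r x
      by (simp add: vec_eq_iff linear_scale[OF bounded_linear.linear[OF assms]])
    show "norm (f x) \<le> norm x * (\<Sum>i\<in>UNIV. K i)" for x
      using order_trans[OF norm_vec_le_sum sum_mono[OF K]] by (simp add: sum_distrib_left)
  qed
qed

lemma bounded_linear_componentwise: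
  assumes "bounded_linear f" shows "bounded_linear (componentwise f :: 'a::real_normed_vector^'n \<Rightarrow> 'b::real_normed_vector^'n)"
  by (rule bounded_linear_vecI)
    (simp add: componentwise_def bounded_linear_compose[OF assms bounded_linear_vec_nth])

lemma bounded_linear_mat_act:
  "bounded_linear (mat_act B :: 'a::real_normed_vector^'n \<Rightarrow> 'a^'m)"
  by (rule bounded_linear_vecI)
    (auto simp: mat_act_def intro!: bounded_linear_sum bounded_linear_compose[OF bounded_linear_scaleR_right bounded_linear_vec_nth])

lemma bounded_linear_axis: "bounded_linear (axis i :: 'a::real_normed_vector \<Rightarrow> 'a^'n)"
proof (rule bounded_linear_vecI)
  fix k
  show "bounded_linear (\<lambda>x. (axis i x :: 'a^'n) $ k)"
    by (cases "k = i") (auto simp: axis_def bounded_linear_ident bounded_linear_zero)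
qed

lemma vec_eq_sum_axis: "(U :: 'a::real_normed_vector^'n) = (\<Sum>i\<in>UNIV. axis i (U $ i))"
  by (simp add: vec_eq_iff sum_component axis_def if_distrib cong: if_cong)

lemma mat_act_mult: "mat_act B (mat_act P U) = mat_act (B ** P) U"
proof -
  have "(\<Sum>k\<in>UNIV. \<Sum>l\<in>UNIV. (B $ i $ k * P $ k $ l) *\<^sub>R U $ l)
      = (\<Sum>l\<in>UNIV. \<Sum>k\<in>UNIV. (B $ i $ k * P $ k $ l) *\<^sub>R U $ l)" for i
    by (rule sum.swap)
  then show ?thesis
    by (simp add: mat_act_def vec_eq_iff matrix_matrix_mult_def scaleR_sum_right scaleR_sum_left)
qed

lemma mat_act_componentwise: "linear f \<Longrightarrow> componentwise f (mat_act B U) = mat_act B (componentwise f U)"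
  by (simp add: componentwise_def mat_act_def vec_eq_iff linear_sum linear_scale)

section \<open>Forms on tuples induced by a matrix\<close>

definition mat_form :: "real^'n^'m \<Rightarrow> ('a \<Rightarrow> 'c \<Rightarrow> real) \<Rightarrow> 'a^'n \<Rightarrow> 'c^'m \<Rightarrow> real" where
  "mat_form B h U W = (\<Sum>i\<in>UNIV. \<Sum>k\<in>UNIV. B $ i $ k * h (U $ k) (W $ i))"

lemma inner_eq_mat_form:
  fixes U W :: "'a::real_inner^'n"
  shows "U \<bullet> W = mat_form (mat 1) (\<bullet>) U W"
proof -
  have "(\<Sum>k\<in>UNIV. (mat 1 :: real^'n^'n) $ i $ k * (U $ k \<bullet> W $ i)) = U $ i \<bullet> W $ i" for i
    by (simp add: mat_def if_distrib[of "\<lambda>c. c * _"] cong: if_cong)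
  then show ?thesis by (simp add: mat_form_def inner_vec_def)
qed

lemma mat_form_zero: "mat_form 0 h = (\<lambda>_ _. 0)"
  by (simp add: mat_form_def fun_eq_iff)

lemma mat_form_mat_act_left:
  assumes "\<And>w. linear (\<lambda>u. h u w)"
  shows "mat_form B h (mat_act P U) W = mat_form (B ** P) h U W"
proof -
  have "mat_form B h (mat_act P U) W = (\<Sum>i\<in>UNIV. \<Sum>k\<in>UNIV. \<Sum>l\<in>UNIV. B $ i $ k * P $ k $ l * h (U $ l) (W $ i))"
    by (simp add: mat_form_def mat_act_def linear_sum[OF assms] linear_scale[OF assms]
        sum_distrib_left mult.assoc)
  also have "\<dots> = (\<Sum>i\<in>UNIV. \<Sum>l\<in>UNIV. \<Sum>k\<in>UNIV. B $ i $ k * P $ k $ l * h (U $ l) (W $ i))"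
    by (intro sum.cong refl sum.swap)
  finally show ?thesis by (simp add: mat_form_def matrix_matrix_mult_def sum_distrib_right)
qed

lemma mat_form_mat_act_right:
  assumes "\<And>u. linear (h u)"
  shows "mat_form B h U (mat_act P W) = mat_form (transpose P ** B) h U W"
proof -
  have "mat_form B h U (mat_act P W) = (\<Sum>i\<in>UNIV. \<Sum>k\<in>UNIV. \<Sum>l\<in>UNIV. P $ i $ l * B $ i $ k * h (U $ k) (W $ l))"
    by (simp add: mat_form_def mat_act_def linear_sum[OF assms] linear_scale[OF assms]
        sum_distrib_left mult_ac)
  also have "\<dots> = (\<Sum>i\<in>UNIV. \<Sum>l\<in>UNIV. \<Sum>k\<in>UNIV. P $ i $ l * B $ i $ k * h (U $ k) (W $ l))"
    by (intro sum.cong refl sum.swap)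
  also have "\<dots> = (\<Sum>l\<in>UNIV. \<Sum>i\<in>UNIV. \<Sum>k\<in>UNIV. P $ i $ l * B $ i $ k * h (U $ k) (W $ l))"
    by (rule sum.swap)
  also have "\<dots> = (\<Sum>l\<in>UNIV. \<Sum>k\<in>UNIV. \<Sum>i\<in>UNIV. P $ i $ l * B $ i $ k * h (U $ k) (W $ l))"
    by (intro sum.cong refl sum.swap)
  finally show ?thesis
    by (simp add: mat_form_def matrix_matrix_mult_def transpose_def sum_distrib_right)
qed

text \<open>Diagonalising \<open>B\<close> turns the form into a sum of
  \<open>e \<bullet> (B *v e)\<close> times \<open>h (z e) (z e)\<close>, where \<open>z e\<close>
  contracts \<open>U\<close> with the eigenvector \<open>e\<close>.\<close>

lemma mat_form_diag_psd:
  fixes B :: "real^'n^'n" and h :: "'a::real_vector \<Rightarrow> 'a \<Rightarrow> real"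
  assumes B: "symmetric_psd B" and h: "\<And>u. linear (h u)" "\<And>w. linear (\<lambda>u. h u w)" "\<And>u. 0 \<le> h u u"
  shows "0 \<le> mat_form B h U U"
proof -
  have s: "transpose B = B" "\<And>x. 0 \<le> x \<bullet> (B *v x)" using B by (auto simp: symmetric_psd_def)
  obtain E where E: "finite E" "\<And>i k. B $ i $ k = (\<Sum>e\<in>E. (e \<bullet> (B *v e)) * (e $ i * e $ k))"
    by (rule symmetric_spectral[OF s(1)]) (rule that)
  define z where "z e = (\<Sum>i\<in>UNIV. e $ i *\<^sub>R U $ i)" for e :: "real^'n"
  have z: "h (z e) (z e) = (\<Sum>i\<in>UNIV. \<Sum>k\<in>UNIV. e $ i * e $ k * h (U $ k) (U $ i))" for e
    unfolding z_def
    by (simp add: linear_sum[OF h(1)] linear_sum[OF h(2)] linear_scale[OF h(1)] linear_scale[OF h(2)]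
        sum_distrib_left mult.assoc)
  have "mat_form B h U U = (\<Sum>i\<in>UNIV. \<Sum>k\<in>UNIV. \<Sum>e\<in>E. (e \<bullet> (B *v e)) * (e $ i * e $ k * h (U $ k) (U $ i)))"
    by (simp add: mat_form_def E(2) sum_distrib_right mult.assoc)
  also have "\<dots> = (\<Sum>i\<in>UNIV. \<Sum>e\<in>E. \<Sum>k\<in>UNIV. (e \<bullet> (B *v e)) * (e $ i * e $ k * h (U $ k) (U $ i)))"
    by (intro sum.cong refl sum.swap)
  also have "\<dots> = (\<Sum>e\<in>E. \<Sum>i\<in>UNIV. \<Sum>k\<in>UNIV. (e \<bullet> (B *v e)) * (e $ i * e $ k * h (U $ k) (U $ i)))"
    by (rule sum.swap)
  also have "\<dots> = (\<Sum>e\<in>E. (e \<bullet> (B *v e)) * h (z e) (z e))"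
    by (simp add: z sum_distrib_left)
  also have "\<dots> \<ge> 0" by (intro sum_nonneg mult_nonneg_nonneg s h)
  finally show ?thesis .
qed

lemma bounded_bilinear_sum:
  assumes "finite I" "\<And>i. i \<in> I \<Longrightarrow> bounded_bilinear (b i)"
  shows "bounded_bilinear (\<lambda>x y. \<Sum>i\<in>I. b i x y)"
  using assms
proof (induction I)
  case empty
  show ?case by (auto intro!: bounded_bilinear.intro exI[of _ 0])
next
  case (insert i I)
  then show ?case by (simp add: bounded_bilinear_add)
qed

lemma sym_form_mat_form:
  fixes B :: "real^'n^'n" and h :: "'a::real_normed_vector \<Rightarrow> 'a \<Rightarrow> real"
  assumes B: "symmetric_psd B" and h: "sym_form h"
  shows "sym_form (mat_form B h)"
proof -
  interpret H: sym_form h by (rule h)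
  interpret b: bounded_bilinear h by (rule H.bilinear)
  have lin: "linear (h u)" "linear (\<lambda>u. h u w)" for u w
    using b.bounded_linear_left b.bounded_linear_right bounded_linear.linear by blast+
  show ?thesis
    unfolding sym_form_def
  proof (intro conjI allI)
    have "bounded_bilinear (\<lambda>U W. h (U $ k) (W $ i))" for i k :: 'n
      by (rule bounded_bilinear.comp[OF b.bounded_bilinear_axioms bounded_linear_vec_nth bounded_linear_vec_nth])
    then show "bounded_bilinear (mat_form B h)"
      unfolding mat_form_def
      by (intro bounded_bilinear_sum bounded_bilinear_scale) auto
    have Bs: "B $ i $ k = B $ k $ i" for i k
    proof -
      have "B $ i $ k = transpose B $ k $ i" by (simp add: transpose_def)
      then show ?thesis using B by (simp add: symmetric_psd_def)
    qed
    show "mat_form B h U W = mat_form B h W U" for U W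
    proof -
      have "mat_form B h U W = (\<Sum>k\<in>UNIV. \<Sum>i\<in>UNIV. B $ i $ k * h (U $ k) (W $ i))"
        unfolding mat_form_def by (rule sum.swap)
      also have "\<dots> = mat_form B h W U"
        unfolding mat_form_def
      proof (intro sum.cong refl)
        fix i k
        show "B $ i $ k * h (U $ k) (W $ i) = B $ k $ i * h (W $ i) (U $ k)"
          by (simp only: Bs[of i k] H.sym[of "U $ k" "W $ i"])
      qed
      finally show ?thesis .
    qed
    show "0 \<le> mat_form B h U U" for U
      by (rule mat_form_diag_psd[OF B lin H.nonneg])
  qed
qed

lemma mat_form_mono:
  fixes B B' :: "real^'n^'n"
  assumes h: "sym_form h" and B: "transpose B = B" "transpose B' = B'" "\<And>x. x \<bullet> (B *v x) \<le> x \<bullet> (B' *v x)"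
  shows "mat_form B h U U \<le> mat_form B' h U U"
proof -
  interpret H: sym_form h by (rule h)
  interpret b: bounded_bilinear h by (rule H.bilinear)
  have "symmetric_psd (B' - B)"
    using B by (simp add: symmetric_psd_def matrix_vector_mult_diff_rdistrib inner_diff_right)
      (simp add: transpose_def vec_eq_iff)
  from sym_form.nonneg[OF sym_form_mat_form[OF this h], of U]
  show ?thesis by (simp add: mat_form_def left_diff_distrib sum_subtractf)
qed

lemma mat_form_scaleR: "mat_form (c *\<^sub>R B) h U W = c * mat_form B h U W"
  by (simp add: mat_form_def sum_distrib_left mult.assoc)

lemma precompact_wrt_mono:
  assumes "precompact_wrt s k" "\<And>x. l x \<le> k x" shows "precompact_wrt s l"
  unfolding precompact_wrt_def
proof (intro allI impI)
  fix B X assume "\<forall>n::nat. s (X n) \<le> B"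
  then obtain r where r: "strict_mono r" "Cauchy_wrt k (X \<circ> r)"
    using precompact_wrtD[OF assms(1), of X B] by blast
  then have "Cauchy_wrt l (X \<circ> r)"
    using assms(2) unfolding Cauchy_wrt_def by (meson le_less_trans)
  with r show "\<exists>r. strict_mono r \<and> Cauchy_wrt l (X \<circ> r)" by blast
qed

lemma precompact_wrt_of_compact:
  fixes f :: "'a::real_normed_vector \<Rightarrow> 'b::real_normed_vector"
  assumes f: "linear f" and comp: "\<And>S. bounded S \<Longrightarrow> compact (closure (f ` S))"
  shows "precompact_wrt norm (\<lambda>x. norm (f x))"
  unfolding precompact_wrt_def
proof (intro allI impI)
  fix B X assume "\<forall>n::nat. norm (X n :: 'a) \<le> B"
  then have "bounded (range X)" by (auto simp: bounded_iff)
  then have "seq_compact (closure (f ` range X))"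
    using comp by (simp add: compact_eq_seq_compact_metric)
  moreover have "\<forall>n. f (X n) \<in> closure (f ` range X)" by (meson closure_subset imageI rangeI subsetD)
  ultimately obtain l r where r: "strict_mono r" "((\<lambda>n. f (X n)) \<circ> r) \<longlonglongrightarrow> l"
    using seq_compactE[of "closure (f ` range X)" "\<lambda>n. f (X n)"] by metis
  have "Cauchy ((\<lambda>n. f (X n)) \<circ> r)" by (rule LIMSEQ_imp_Cauchy) fact
  then have "Cauchy_wrt (\<lambda>x. norm (f x)) (X \<circ> r)"
    by (simp add: Cauchy_wrt_def Cauchy_def dist_norm linear_diff[OF f])
  with r show "\<exists>r. strict_mono r \<and> Cauchy_wrt (\<lambda>x. norm (f x)) (X \<circ> r)" by blast
qed

lemma blinfun_eq_iff: "f = g \<longleftrightarrow> (\<forall>v. blinfun_apply f v = blinfun_apply g v)"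
  by (auto intro: blinfun_eqI)

section \<open>The system on tuples as an abstract wave equation\<close>

locale hilbert_system =
  fixes j :: "'v::{real_inner,banach} \<Rightarrow>\<^sub>L 'h::{real_inner,banach}" and g :: "'v \<Rightarrow>\<^sub>L 'v \<Rightarrow>\<^sub>L real"
  assumes triple: "hilbert_triple j" and g_sym: "symmetric_nonneg_op g"
begin

abbreviation gform :: "'v \<Rightarrow> 'v \<Rightarrow> real" where
  "gform u v \<equiv> blinfun_apply (blinfun_apply g u) v"

lemma gform_sym_form: "sym_form gform"
  unfolding sym_form_def
proof (intro conjI allI)
  show "bounded_bilinear gform"
    by (rule bounded_bilinear.comp[OF bounded_bilinear_blinfun_apply
          blinfun.bounded_linear_right bounded_linear_ident])
qed (use g_sym in \<open>auto simp: symmetric_nonneg_op_def\<close>)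

abbreviation jN :: "'v^'n \<Rightarrow> 'h^'n" where "jN \<equiv> componentwise (blinfun_apply j)"

lemma H_to_dual_apply: "blinfun_apply (H_to_dual j h) v = h \<bullet> blinfun_apply j v"
  by (simp add: H_to_dual_def inner_commute)

lemma duality_map_apply: "blinfun_apply (duality_map u) v = u \<bullet> v"
  by (simp add: duality_map_def inner_commute)

lemma jN_dense: "closure (range (jN :: 'v^'n \<Rightarrow> 'h^'n)) = UNIV"
proof (intro equalityI subsetI)
  fix W :: "'h^'n"
  show "W \<in> closure (range jN)"
    unfolding closure_approachable
  proof (intro allI impI)
    fix \<epsilon> :: real assume \<epsilon>: "\<epsilon> > 0"
    have "\<exists>u. norm (blinfun_apply j u - W $ i) < \<epsilon> / (CARD('n) + 1)" for i
    proof -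
      have "W $ i \<in> closure (range (blinfun_apply j))"
        using triple by (simp add: hilbert_triple_def dense_compact_embedding_def)
      moreover have "\<epsilon> / (CARD('n) + 1) > 0" using \<epsilon> by simp
      ultimately show ?thesis unfolding closure_approachable dist_norm by (metis rangeE)
    qed
    then obtain u where u: "\<And>i. norm (blinfun_apply j (u i) - W $ i) < \<epsilon> / (CARD('n) + 1)" by metis
    have "norm (jN (\<chi> i. u i) - W) \<le> (\<Sum>i::'n\<in>UNIV. norm (blinfun_apply j (u i) - W $ i))"
      using norm_vec_le_sum[of "jN (\<chi> i. u i) - W"] by (simp add: componentwise_def)
    also have "\<dots> \<le> (\<Sum>i::'n\<in>UNIV. \<epsilon> / (CARD('n) + 1))" by (intro sum_mono less_imp_le u)
    also have "\<dots> < \<epsilon>" using \<epsilon> by (simp add: field_simps)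
    finally show "\<exists>y\<in>range jN. dist y W < \<epsilon>" unfolding dist_norm by blast
  qed
qed simp

text \<open>Each functional \<open>l (axis i v)\<close> of \<open>v\<close> is approximated in the
  dual of V by an element of H; the tolerance is shared among the components.\<close>

lemma jN_dual_dense:
  assumes l: "bounded_linear (l :: 'v^'n \<Rightarrow> real)" and \<epsilon>: "\<epsilon> > 0"
  shows "\<exists>F. \<forall>\<phi>. \<bar>l \<phi> - F \<bullet> jN \<phi>\<bar> \<le> \<epsilon> * norm \<phi>"
proof -
  let ?\<delta> = "\<epsilon> / CARD('n)"
  have \<delta>: "?\<delta> > 0" using \<epsilon> by simp
  have "\<exists>f. \<forall>v. \<bar>l (axis i v) - f \<bullet> blinfun_apply j v\<bar> \<le> ?\<delta> * norm v" for i :: 'n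
  proof -
    have li: "bounded_linear (\<lambda>v. l (axis i v))" by (rule bounded_linear_compose[OF l bounded_linear_axis])
    have "Blinfun (\<lambda>v. l (axis i v)) \<in> closure (range (H_to_dual j))"
      using triple bounded_linear_Blinfun_apply[OF bounded_linear_H_to_dual[of j]]
      by (simp add: hilbert_triple_def dense_compact_embedding_def)
    then obtain f where f: "norm (H_to_dual j f - Blinfun (\<lambda>v. l (axis i v))) < ?\<delta>"
      using \<delta> unfolding closure_approachable dist_norm by (metis rangeE)
    have "\<bar>l (axis i v) - f \<bullet> blinfun_apply j v\<bar> \<le> ?\<delta> * norm v" for v
    proof -
      have "f \<bullet> blinfun_apply j v - l (axis i v) = blinfun_apply (H_to_dual j f - Blinfun (\<lambda>v. l (axis i v))) v"
        by (simp add: blinfun.diff_left H_to_dual_apply bounded_linear_Blinfun_apply[OF li])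
      then have "\<bar>f \<bullet> blinfun_apply j v - l (axis i v)\<bar> \<le> norm (H_to_dual j f - Blinfun (\<lambda>v. l (axis i v))) * norm v"
        using norm_blinfun[of "H_to_dual j f - Blinfun (\<lambda>v. l (axis i v))" v] by simp
      also have "\<dots> \<le> ?\<delta> * norm v" using f by (intro mult_right_mono) auto
      finally show ?thesis by (simp add: abs_minus_commute)
    qed
    then show ?thesis by blast
  qed
  then obtain f where f: "\<And>i v. \<bar>l (axis i v) - f i \<bullet> blinfun_apply j v\<bar> \<le> ?\<delta> * norm v" by metis
  have "\<bar>l \<phi> - (\<chi> i. f i) \<bullet> jN \<phi>\<bar> \<le> \<epsilon> * norm \<phi>" for \<phi>
  proof -
    have "l \<phi> = (\<Sum>i\<in>UNIV. l (axis i (\<phi> $ i)))"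
      by (subst vec_eq_sum_axis) (simp only: linear_sum[OF bounded_linear.linear[OF l]])
    then have "l \<phi> - (\<chi> i. f i) \<bullet> jN \<phi> = (\<Sum>i\<in>UNIV. l (axis i (\<phi> $ i)) - f i \<bullet> blinfun_apply j (\<phi> $ i))"
      by (simp add: inner_vec_def componentwise_def sum_subtractf)
    also have "\<bar>\<dots>\<bar> \<le> (\<Sum>i\<in>UNIV. \<bar>l (axis i (\<phi> $ i)) - f i \<bullet> blinfun_apply j (\<phi> $ i)\<bar>)" by (rule sum_abs)
    also have "\<dots> \<le> (\<Sum>i::'n\<in>UNIV. ?\<delta> * norm \<phi>)"
    proof (rule sum_mono)
      fix i
      show "\<bar>l (axis i (\<phi> $ i)) - f i \<bullet> blinfun_apply j (\<phi> $ i)\<bar> \<le> ?\<delta> * norm \<phi>"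
        using order_trans[OF f mult_left_mono[OF Finite_Cartesian_Product.norm_nth_le[of \<phi> i]]] \<delta> by simp
    qed
    finally show ?thesis by simp
  qed
  then show ?thesis by blast
qed

lemma jN_precompact: "precompact_wrt norm (\<lambda>U :: 'v^'n. norm (jN U))"
proof (rule precompact_wrt_mono)
  have j: "precompact_wrt norm (\<lambda>u. norm (blinfun_apply j u))"
    using triple blinfun.bounded_linear_right bounded_linear.linear
    by (intro precompact_wrt_of_compact) (auto simp: hilbert_triple_def dense_compact_embedding_def)
  show "precompact_wrt norm (\<lambda>U :: 'v^'n. \<Sum>i\<in>UNIV. norm (blinfun_apply j (U $ i)))"
    by (intro precompact_wrt_sum precompact_wrt_compose[OF j, where c = 1]) (auto simp: Finite_Cartesian_Product.norm_nth_le)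
  show "norm (jN U) \<le> (\<Sum>i\<in>UNIV. norm (blinfun_apply j (U $ i)))" for U :: "'v^'n"
    using norm_vec_le_sum[of "jN U"] by (simp add: componentwise_def)
qed

lemma wave_system:
  assumes "symmetric_psd A" "symmetric_psd D"
  shows "wave jN (mat_form A (\<bullet>)) (mat_form D gform)"
  unfolding wave_def
  by (intro conjI allI impI jN_dense jN_dual_dense jN_precompact sym_form_mat_form[OF assms(1) sym_form_inner]
      sym_form_mat_form[OF assms(2) gform_sym_form] bounded_linear_componentwise blinfun.bounded_linear_right)

lemma wave_operator_eq:
  fixes A D :: "real^'n^'n"
  assumes "symmetric_psd A" "symmetric_psd D"
  shows "wave_operator j g A D = wave.wave_op jN (mat_form A (\<bullet>)) (mat_form D gform)"
proof -
  interpret wave jN "mat_form A (\<bullet>)" "mat_form D gform" by (rule wave_system[OF assms])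
  have "componentwise duality_map U + mat_act A (componentwise (\<lambda>u. H_to_dual j (blinfun_apply j u)) U)
        + mat_act D (componentwise (blinfun_apply g) Z) = componentwise (H_to_dual j) F
      \<longleftrightarrow> (\<forall>\<phi>. U \<bullet> \<phi> + mat_form A (\<bullet>) (jN U) (jN \<phi>) + mat_form D gform Z \<phi> = F \<bullet> jN \<phi>)"
    (is "?E \<longleftrightarrow> ?W") for U Z :: "'v^'n" and F
  proof -
    \<comment> \<open>The residual of component \<open>i\<close>, tested with \<open>v\<close>. One
      identity for all tuples \<open>\<phi>\<close> amounts to one per component, since
      \<open>\<phi>\<close> may be supported on a single index.\<close>
    define L where "L i v = U $ i \<bullet> v + (\<Sum>k\<in>UNIV. A $ i $ k * (blinfun_apply j (U $ k) \<bullet> blinfun_apply j v))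
        + (\<Sum>k\<in>UNIV. D $ i $ k * gform (Z $ k) v) - F $ i \<bullet> blinfun_apply j v" for i v
    have E: "?E \<longleftrightarrow> (\<forall>i v. L i v = 0)"
      by (auto simp: vec_eq_iff blinfun_eq_iff componentwise_def mat_act_def L_def duality_map_apply
          H_to_dual_apply blinfun.add_left blinfun.sum_left blinfun.scaleR_left)
    have W: "U \<bullet> \<phi> + mat_form A (\<bullet>) (jN U) (jN \<phi>) + mat_form D gform Z \<phi> - F \<bullet> jN \<phi> = (\<Sum>i\<in>UNIV. L i (\<phi> $ i))" for \<phi>
      by (simp add: L_def inner_vec_def mat_form_def componentwise_def sum.distrib sum_subtractf)
    have L0: "L i 0 = 0" for i by (simp add: L_def blinfun.zero_right)
    have "L i v = 0" if ?W for i v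
    proof -
      have "(\<Sum>k\<in>UNIV. L k ((axis i v :: 'v^'n) $ k)) = 0" using that W[of "axis i v"] by simp
      moreover have "L k ((axis i v :: 'v^'n) $ k) = (if k = i then L i v else 0)" for k
        by (simp add: axis_def L0)
      ultimately show ?thesis by simp
    qed
    moreover have ?W if "\<forall>i v. L i v = 0" using that W by simp
    ultimately show ?thesis unfolding E by blast
  qed
  then show ?thesis by (simp add: wave_operator_def wave_op_def)
qed

lemma mat_one_psd: "symmetric_psd (mat 1 :: real^'n^'n)"
  by (simp add: symmetric_psd_def)

lemma zero_psd: "symmetric_psd (0 :: real^'n^'n)"
  by (simp add: symmetric_psd_def transpose_def vec_eq_iff)

lemma wave_mild_solution:
  fixes A D :: "real^'n^'n"
  assumes "symmetric_psd A" "symmetric_psd D"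
  defines "T \<equiv> dissipative.flow (wave.wave_op jN (mat_form A (\<bullet>)) (mat_form D gform))"
  shows "mild_solution j g A D U0 U1 (\<lambda>t. fst (T t (U0, U1))) (\<lambda>t. snd (T t (U0, U1)))"
proof -
  interpret wave jN "mat_form A (\<bullet>)" "mat_form D gform" by (rule wave_system[OF assms(1,2)])
  show ?thesis
    unfolding mild_solution_def T_def
    using C0_semigroup_semigroup generator_semigroup wave_operator_eq[OF assms(1,2)]
    by (intro conjI exI[of _ semigroup])
      (auto simp: semigroup_apply intro!: J_flow_deriv continuous_intros flow_continuous)
qed

end

section \<open>Stability and synchronization\<close>

lemma norm_1: "norm (X :: 'a::real_normed_vector^1) = norm (X $ 1)"
  by (simp add: norm_vec_def L2_set_def)

lemma vec_1_eq: "(X :: 'a^1) = vec (X $ 1)"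
  by (simp add: vec_eq_iff forall_1)

lemma mat_form_mat_1: "mat_form (mat 1) h U W = (\<Sum>i\<in>UNIV. h (U $ i) (W $ i))"
  by (simp add: mat_form_def mat_def if_distrib[of "\<lambda>c. c * _"] cong: if_cong)

lemma sum_axis:
  assumes "\<And>k. f k 0 = (0::real)" shows "(\<Sum>k\<in>UNIV. f k ((axis i v :: 'a::zero^'n) $ k)) = f i v"
proof -
  have "f k ((axis i v :: 'a^'n) $ k) = (if k = i then f i v else 0)" for k
    by (simp add: axis_def assms)
  then show ?thesis by simp
qed

lemma mat_act_symmetric_inner:
  fixes U W :: "'a::real_inner^'n"
  assumes "transpose P = P" shows "mat_act P U \<bullet> W = U \<bullet> mat_act P W"
proof -
  have "linear (\<lambda>u. u \<bullet> w)" "linear ((\<bullet>) w)" for w :: 'a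
    by (simp_all add: bounded_linear.linear[OF bounded_linear_inner_left] bounded_linear.linear[OF bounded_linear_inner_right])
  then show ?thesis
    unfolding inner_eq_mat_form by (simp add: mat_form_mat_act_left mat_form_mat_act_right assms)
qed

definition pair_act :: "real^'n^'k \<Rightarrow> ('a::real_vector^'n) \<times> ('b::real_vector^'n) \<Rightarrow> ('a^'k) \<times> ('b^'k)" where
  "pair_act B x = (mat_act B (fst x), mat_act B (snd x))"

lemma bounded_linear_pair_act:
  "bounded_linear (pair_act B :: ('a::real_normed_vector^'n) \<times> ('b::real_normed_vector^'n) \<Rightarrow> _)"
  unfolding pair_act_def[abs_def]
  by (intro bounded_linear_Pair bounded_linear_compose[OF bounded_linear_mat_act]
      bounded_linear_fst bounded_linear_snd)

lemma pair_act_mult: "pair_act X (pair_act Y x) = pair_act (X ** Y) x"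
  for x :: "('a::real_normed_vector^'n) \<times> ('b::real_normed_vector^'n)"
  by (simp add: pair_act_def mat_act_mult)

context hilbert_system
begin

abbreviation flow_of :: "real^'n^'n \<Rightarrow> real^'n^'n \<Rightarrow> real \<Rightarrow> ('v^'n) \<times> ('h^'n) \<Rightarrow> ('v^'n) \<times> ('h^'n)" where
  "flow_of A D \<equiv> dissipative.flow (wave.wave_op jN (mat_form A (\<bullet>)) (mat_form D gform))"

text \<open>For each initial datum in the domain, the semigroup supplied by the hypothesis agrees
  with \<open>flow\<close> on that datum by uniqueness; density carries the estimate to all
  data.\<close>

lemma scalar_decay:
  assumes stable: "uniformly_stable j g"
  shows "\<exists>M \<omega>. 0 < \<omega> \<and> (\<forall>t\<ge>0. \<forall>x :: ('v^1) \<times> ('h^1). norm (flow_of 0 (mat 1) t x) \<le> M * exp (- \<omega> * t) * norm x)"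
proof -
  interpret wave "jN :: 'v^1 \<Rightarrow> 'h^1" "mat_form 0 (\<bullet>)" "mat_form (mat 1) gform"
    by (rule wave_system[OF zero_psd mat_one_psd])
  obtain M \<omega> where \<omega>: "0 < \<omega>" and sol: "\<And>u0 u1. \<exists>u u'. scalar_mild_solution j g u0 u1 u u' \<and>
      (\<forall>t\<ge>0. norm (u t, u' t) \<le> M * exp (- \<omega> * t) * norm (u0, u1))"
    using stable unfolding uniformly_stable_def by blast
  have dom: "norm (flow t x) \<le> M * exp (- \<omega> * t) * norm x" if xa: "(x, a) \<in> wave_op" and t: "t \<ge> 0" for x a t
  proof -
    have x: "x = (vec (fst x $ 1), vec (snd x $ 1))" using vec_1_eq by (metis prod.collapse)
    obtain u u' where u: "scalar_mild_solution j g (fst x $ 1) (snd x $ 1) u u'"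
      "\<forall>t\<ge>0. norm (u t, u' t) \<le> M * exp (- \<omega> * t) * norm (fst x $ 1, snd x $ 1)"
      using sol by blast
    then obtain T where T: "C0_semigroup T" "generator T = wave_operator j g (0 :: real^1^1) (mat 1)"
      "\<forall>t\<ge>0. (vec (u t), vec (u' t)) = blinfun_apply (T t) x"
      and cont: "continuous_on {0..} (\<lambda>t. vec (u t) :: 'v^1)" "continuous_on {0..} (\<lambda>t. vec (u' t) :: 'h^1)"
      unfolding scalar_mild_solution_def mild_solution_def x[symmetric] by blast
    have "continuous_on {0..} (\<lambda>t. (vec (u t) :: 'v^1, vec (u' t) :: 'h^1))"
      by (intro continuous_intros cont)
    then have "continuous_on {0..} (\<lambda>t. blinfun_apply (T t) x)"
      by (rule continuous_on_cong[THEN iffD1, rotated 2]) (use T(3) in auto)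
    from semigroup_unique[OF T(1) _ this xa t]
    have "flow t x = (vec (u t), vec (u' t))"
      using T(2,3) t wave_operator_eq[OF zero_psd mat_one_psd] by metis
    then have "norm (flow t x) = norm (u t, u' t)" by (simp add: norm_Pair norm_1)
    moreover have "norm x = norm (fst x $ 1, snd x $ 1)" by (cases x) (simp add: norm_Pair norm_1)
    ultimately show ?thesis using u(2) t by simp
  qed
  have "norm (flow t x) \<le> M * exp (- \<omega> * t) * norm x" if t: "t \<ge> 0" for t x
  proof -
    obtain X A where X: "\<And>n. (X n, A n) \<in> wave_op" "X \<longlonglongrightarrow> x"
      using dense_G_sequence by blast
    have "norm (flow t (X n)) \<le> M * exp (- \<omega> * t) * norm (X n)" for n by (rule dom[OF X(1) t])
    moreover have "(\<lambda>n. norm (flow t (X n))) \<longlonglongrightarrow> norm (flow t x)"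
      by (intro tendsto_norm bounded_linear.tendsto[OF flow_bounded_linear[OF t]] X)
    moreover have "(\<lambda>n. M * exp (- \<omega> * t) * norm (X n)) \<longlonglongrightarrow> M * exp (- \<omega> * t) * norm x"
      by (intro tendsto_intros X)
    ultimately show ?thesis by (intro LIMSEQ_le) auto
  qed
  with \<omega> show ?thesis by blast
qed

text \<open>The coordinate maps intertwine the decoupled system with the scalar one, and squared
  norms of coordinates add up. The absolute value makes the bound nonnegative.\<close>

lemma copies_decay:
  assumes decay: "\<And>t x. t \<ge> 0 \<Longrightarrow> norm (flow_of 0 (mat 1) t (x :: ('v^1) \<times> ('h^1))) \<le> M * exp (- \<omega> * t) * norm x"
    and t: "t \<ge> 0"
  shows "norm (flow_of 0 (mat 1) t (x :: ('v^'n) \<times> ('h^'n))) \<le> \<bar>M\<bar> * exp (- \<omega> * t) * norm x"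
proof -
  interpret S: wave "jN :: 'v^1 \<Rightarrow> 'h^1" "mat_form 0 (\<bullet>)" "mat_form (mat 1) gform"
    by (rule wave_system[OF zero_psd mat_one_psd])
  interpret N: wave "jN :: 'v^'n \<Rightarrow> 'h^'n" "mat_form 0 (\<bullet>)" "mat_form (mat 1) gform"
    by (rule wave_system[OF zero_psd mat_one_psd])
  define P where "P i x = (vec (fst x $ i) :: 'v^1, vec (snd x $ i) :: 'h^1)" for i and x :: "('v^'n) \<times> ('h^'n)"
  have P: "bounded_linear (P i)" for i
    unfolding P_def
    by (intro bounded_linear_Pair bounded_linear_vecI)
      (auto intro!: bounded_linear_compose[OF bounded_linear_vec_nth] bounded_linear_fst bounded_linear_snd)
  have graph: "(P i x, P i a) \<in> S.wave_op" if xa: "(x, a) \<in> N.wave_op" for i x a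
  proof -
    obtain U Z F where *: "x = (U, jN Z)" "a = (Z, - F)"
      "\<And>\<phi>. U \<bullet> \<phi> + mat_form 0 (\<bullet>) (jN U) (jN \<phi>) + mat_form (mat 1) gform Z \<phi> = F \<bullet> jN \<phi>"
      using N.wave_opE[OF xa] by blast
    have "((vec (U $ i), jN (vec (Z $ i))), (vec (Z $ i), - vec (F $ i))) \<in> S.wave_op"
    proof (rule S.wave_opI)
      fix \<phi> :: "'v^1"
      have "U $ i \<bullet> \<phi> $ 1 + gform (Z $ i) (\<phi> $ 1) = F $ i \<bullet> blinfun_apply j (\<phi> $ 1)"
        using *(3)[of "axis i (\<phi> $ 1)"]
          sum_axis[of "\<lambda>k v. U $ k \<bullet> v" i "\<phi> $ 1"] sum_axis[of "\<lambda>k v. gform (Z $ k) v" i "\<phi> $ 1"]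
          sum_axis[of "\<lambda>k v. F $ k \<bullet> blinfun_apply j v" i "\<phi> $ 1"]
        by (simp add: mat_form_zero mat_form_mat_1 inner_vec_def componentwise_def blinfun.zero_right)
      then show "vec (U $ i) \<bullet> \<phi> + mat_form 0 (\<bullet>) (jN (vec (U $ i))) (jN \<phi>) + mat_form (mat 1) gform (vec (Z $ i)) \<phi>
          = vec (F $ i) \<bullet> jN \<phi>"
        by (simp add: mat_form_zero mat_form_mat_1 inner_vec_def componentwise_def)
    qed
    moreover have "P i x = (vec (U $ i), jN (vec (Z $ i)))" "P i a = (vec (Z $ i), - vec (F $ i))"
      by (simp_all add: P_def * componentwise_def vec_eq_iff)
    ultimately show ?thesis by simp
  qed
  have PF: "P i (N.flow t x) = S.flow t (P i x)" for i x
    by (rule flow_intertwine[OF N.dissipative_wave_op S.dissipative_wave_op P graph t])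
  have norm_P: "(norm y)\<^sup>2 = (\<Sum>i\<in>UNIV. (norm (P i y))\<^sup>2)" for y
    unfolding power2_norm_eq_inner
    by (simp add: P_def inner_prod_def inner_vec_def sum.distrib)
  have "(norm (N.flow t x))\<^sup>2 \<le> (\<Sum>i\<in>UNIV. (\<bar>M\<bar> * exp (- \<omega> * t) * norm (P i x))\<^sup>2)"
    unfolding norm_P PF
  proof (intro sum_mono power_mono)
    fix i
    have "norm (S.flow t (P i x)) \<le> M * exp (- \<omega> * t) * norm (P i x)" by (rule decay) fact
    also have "\<dots> \<le> \<bar>M\<bar> * exp (- \<omega> * t) * norm (P i x)" by (intro mult_right_mono) auto
    finally show "norm (S.flow t (P i x)) \<le> \<bar>M\<bar> * exp (- \<omega> * t) * norm (P i x)" .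
  qed simp
  also have "\<dots> = (\<bar>M\<bar> * exp (- \<omega> * t) * norm x)\<^sup>2"
    by (simp add: power_mult_distrib norm_P sum_distrib_left)
  finally show ?thesis by (rule power2_le_imp_le) simp
qed

text \<open>A positive definite \<open>D\<close> lies between two multiples of the identity matrix,
  so its damping is equivalent to that of decoupled copies of the scalar equation. What remains is
  \<open>uc\<close>, the absence of undamped modes.\<close>

lemma positive_definite_decay:
  fixes A D :: "real^'n^'n"
  assumes stable: "uniformly_stable j g" and A: "symmetric_psd A"
    and D: "transpose D = D" "\<And>x. x \<noteq> 0 \<Longrightarrow> 0 < x \<bullet> (D *v x)"
  shows "\<exists>M \<omega>. 1 \<le> M \<and> 0 < \<omega> \<and> (\<forall>t\<ge>0. \<forall>x. norm (flow_of A D t x) \<le> M * exp (- \<omega> * t) * norm x)"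
proof -
  have D_psd: "symmetric_psd D"
    using D by (auto simp: symmetric_psd_def) (metis inner_zero_left less_eq_real_def)
  obtain c where c: "c > 0" "\<And>x. c * (x \<bullet> x) \<le> x \<bullet> (D *v x)" using positive_definite_bound[OF D(2)] by blast
  obtain K where K: "K > 0" "\<And>x. norm (D *v x) \<le> norm x * K"
    using bounded_linear.pos_bounded[OF matrix_vector_mul_bounded_linear] by blast
  have K': "x \<bullet> (D *v x) \<le> K * (x \<bullet> x)" for x
  proof -
    have "x \<bullet> (D *v x) \<le> norm x * norm (D *v x)" by (rule norm_cauchy_schwarz)
    also have "\<dots> \<le> norm x * (norm x * K)" using K by (intro mult_left_mono) auto
    finally show ?thesis by (simp add: dot_square_norm power2_eq_square mult_ac)
  qed
  obtain M \<omega> where \<omega>: "0 < \<omega>" and decay1: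
    "\<And>t x. t \<ge> 0 \<Longrightarrow> norm (flow_of 0 (mat 1) t (x :: ('v^1) \<times> ('h^1))) \<le> M * exp (- \<omega> * t) * norm x"
    using scalar_decay[OF stable] by blast
  interpret S: wave "jN :: 'v^'n \<Rightarrow> 'h^'n" "\<lambda>_ _. 0" "mat_form (mat 1) gform"
    using wave_system[OF zero_psd mat_one_psd] by (simp add: mat_form_zero)
  have decay: "norm (S.flow t x) \<le> \<bar>M\<bar> * exp (- \<omega> * t) * norm x" if "t \<ge> 0" for t x
    using copies_decay[OF decay1 that, where 'n = 'n] by (simp add: mat_form_zero)
  have sm1: "transpose (r *\<^sub>R mat 1 :: real^'n^'n) = r *\<^sub>R mat 1" for r
    by (simp add: transpose_def mat_def vec_eq_iff)
  have sm2: "x \<bullet> ((r *\<^sub>R mat 1 :: real^'n^'n) *v x) = r * (x \<bullet> x)" for r x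
    by (simp add: scaleR_matrix_vector_assoc[symmetric])
  have uc: "U = 0" if mode: "\<And>\<phi>. U \<bullet> \<phi> + mat_form A (\<bullet>) (jN U) (jN \<phi>) = \<mu> * (jN U \<bullet> jN \<phi>)"
    and undamped: "\<And>\<phi>. mat_form (mat 1) gform U \<phi> = 0" for U :: "'v^'n" and \<mu>
  proof -
    obtain E where E: "finite E" "\<And>e. e \<in> E \<Longrightarrow> A *v e = (e \<bullet> (A *v e)) *\<^sub>R e"
      "\<And>i k. (\<Sum>e\<in>E. e $ i * e $ k) = (if i = k then 1 else 0)"
      using A by (auto simp: symmetric_psd_def elim: symmetric_spectral)
    \<comment> \<open>Contracted with an eigenvector of \<open>A\<close>, the coupled mode solves a
      scalar eigenvalue equation with \<open>\<mu> - a\<close> in place of \<open>\<mu>\<close>, and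
      \<open>g\<close> still annihilates it.\<close>
    define z where "z e = (\<Sum>k\<in>UNIV. e $ k *\<^sub>R U $ k)" for e :: "real^'n"
    have g0: "gform (U $ i) v = 0" for i v
      using undamped[of "axis i v"] sum_axis[of "\<lambda>k. gform (U $ k)" i v]
      by (simp add: mat_form_mat_1 blinfun.zero_right)
    have z0: "z e = 0" if e: "e \<in> E" for e
    proof -
      define a where "a = e \<bullet> (A *v e)"
      have Ae: "(\<Sum>i\<in>UNIV. A $ i $ k * e $ i) = a * e $ k" for k
      proof -
        have "(\<Sum>i\<in>UNIV. A $ i $ k * e $ i) = (transpose A *v e) $ k"
          by (simp add: matrix_vector_mult_def transpose_def)
        also have "transpose A = A" using A by (simp add: symmetric_psd_def)
        also have "A *v e = a *\<^sub>R e" unfolding a_def by (rule E(2)[OF e])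
        finally show ?thesis by simp
      qed
      have zv: "z e \<bullet> v = (\<mu> - a) * (blinfun_apply j (z e) \<bullet> blinfun_apply j v)" for v
      proof -
        let ?\<phi> = "(\<chi> i. e $ i *\<^sub>R v) :: 'v^'n"
        have jz: "blinfun_apply j (z e) = (\<Sum>k\<in>UNIV. e $ k *\<^sub>R blinfun_apply j (U $ k))"
          by (simp add: z_def blinfun.sum_right blinfun.scaleR_right)
        have 1: "U \<bullet> ?\<phi> = z e \<bullet> v" by (simp add: inner_vec_def z_def inner_sum_left)
        have 2: "jN U \<bullet> jN ?\<phi> = blinfun_apply j (z e) \<bullet> blinfun_apply j v"
          by (simp add: inner_vec_def jz componentwise_def inner_sum_left blinfun.scaleR_right)
        have "mat_form A (\<bullet>) (jN U) (jN ?\<phi>)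
            = (\<Sum>i\<in>UNIV. \<Sum>k\<in>UNIV. A $ i $ k * e $ i * (blinfun_apply j (U $ k) \<bullet> blinfun_apply j v))"
          by (simp add: mat_form_def componentwise_def blinfun.scaleR_right mult_ac)
        also have "\<dots> = (\<Sum>k\<in>UNIV. \<Sum>i\<in>UNIV. A $ i $ k * e $ i * (blinfun_apply j (U $ k) \<bullet> blinfun_apply j v))"
          by (rule sum.swap)
        also have "\<dots> = (\<Sum>k\<in>UNIV. a * e $ k * (blinfun_apply j (U $ k) \<bullet> blinfun_apply j v))"
          by (simp only: sum_distrib_right[symmetric] Ae)
        also have "\<dots> = a * (blinfun_apply j (z e) \<bullet> blinfun_apply j v)"
          by (simp add: jz inner_sum_left sum_distrib_left mult.assoc)
        finally show ?thesis using mode[of ?\<phi>] unfolding 1 2 by (simp add: left_diff_distrib)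
      qed
      \<comment> \<open>The constant tuple allows the decay of the decoupled copies to be used for a
        scalar mode.\<close>
      let ?Z = "vec (z e) :: 'v^'n"
      have "?Z = 0"
      proof (rule S.no_undamped_mode[OF \<omega> decay])
        show "?Z \<bullet> \<phi> + 0 = (\<mu> - a) * (jN ?Z \<bullet> jN \<phi>)" for \<phi>
          by (simp add: inner_vec_def componentwise_def zv sum_distrib_left)
        show "mat_form (mat 1) gform ?Z \<phi> = 0" for \<phi>
          by (simp add: mat_form_mat_1 z_def blinfun.sum_right blinfun.sum_left blinfun.scaleR_left
              blinfun.scaleR_right g0)
      qed
      then show ?thesis by (simp add: vec_eq_iff)
    qed
    \<comment> \<open>The resolution of the identity by the eigenvectors rebuilds \<open>U\<close>
      from its contractions.\<close>
    have "U $ i = 0" for i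
    proof -
      have "(\<Sum>e\<in>E. e $ i *\<^sub>R z e) = (\<Sum>e\<in>E. \<Sum>k\<in>UNIV. (e $ i * e $ k) *\<^sub>R U $ k)"
        by (simp add: z_def scaleR_sum_right)
      also have "\<dots> = (\<Sum>k\<in>UNIV. \<Sum>e\<in>E. (e $ i * e $ k) *\<^sub>R U $ k)" by (rule sum.swap)
      also have "\<dots> = (\<Sum>k\<in>UNIV. (if i = k then 1 else 0) *\<^sub>R U $ k)"
        by (simp only: scaleR_sum_left[symmetric] E(3))
      also have "\<dots> = U $ i" by (simp add: if_distrib[of "\<lambda>c. c *\<^sub>R _"] cong: if_cong)
      finally show ?thesis using z0 by simp
    qed
    then show ?thesis by (simp add: vec_eq_iff)
  qed
  interpret wave_comparison "jN :: 'v^'n \<Rightarrow> 'h^'n" "mat_form A (\<bullet>)" "mat_form D gform"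
    "mat_form (mat 1) gform" c K "\<bar>M\<bar>" \<omega>
    unfolding wave_comparison_def wave_comparison_axioms_def
  proof (intro conjI allI impI)
    show "wave (jN :: 'v^'n \<Rightarrow> 'h^'n) (mat_form A (\<bullet>)) (mat_form D gform)" by (rule wave_system[OF A D_psd])
    show "c * mat_form (mat 1) gform z z \<le> mat_form D gform z z" for z
      using mat_form_mono[OF gform_sym_form sm1 D(1), of c z] c(2) by (simp add: sm2 mat_form_scaleR)
    show "mat_form D gform z z \<le> K * mat_form (mat 1) gform z z" for z
      using mat_form_mono[OF gform_sym_form D(1) sm1, of K z] K' by (simp add: sm2 mat_form_scaleR)
    show "U = 0" if "\<forall>\<phi>. U \<bullet> \<phi> + mat_form A (\<bullet>) (jN U) (jN \<phi>) = \<mu> * (jN U \<bullet> jN \<phi>)"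
      "\<forall>\<phi>. mat_form (mat 1) gform U \<phi> = 0" for U \<mu>
      by (rule uc) (use that in blast)+
  qed (use c K \<omega> decay S.wave_axioms in auto)
  show ?thesis by (rule exponentially_stable)
qed

lemma synchronizable:
  fixes A D :: "real^'n^'n" and C :: "real^'n^'m" and R :: "real^'m^'m"
  assumes A: "symmetric_psd A" and D: "symmetric_psd D" and R: "symmetric_psd R"
    and ker: "(*v) A ` matrix_ker C \<subseteq> matrix_ker C"
    and rank: "rank R = CARD('m)"
    and D_eq: "D = transpose C ** R ** C" and stable: "uniformly_stable j g"
  shows "uniformly_synchronizable j g A D C"
proof -
  obtain Q :: "real^'n^'n" where Q: "transpose Q = Q" "C ** Q = 0" "\<And>x. C *v x = 0 \<Longrightarrow> Q *v x = x"
    by (rule kernel_projection[of C]) (rule that)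
  define P where "P = mat 1 - Q"
  obtain B where B: "P = B ** C" using left_factor_projection[OF Q] by (auto simp: P_def)
  have tA: "transpose A = A" and tD: "transpose D = D" and tR: "transpose R = R"
    using A D R by (auto simp: symmetric_psd_def)
  have CQx: "C *v (Q *v x) = 0" for x by (simp add: matrix_vector_mul_assoc Q(2))
  have QQ: "Q ** Q = Q" by (simp add: matrix_eq matrix_vector_mul_assoc[symmetric] Q(3)[OF CQx])
  have "C *v (A *v (Q *v x)) = 0" for x
    using ker CQx[of x] by (auto simp: matrix_ker_def)
  then have QAQ: "Q ** A ** Q = A ** Q"
    by (simp add: matrix_eq matrix_vector_mul_assoc[symmetric] Q(3))
  \<comment> \<open>\<open>Q ** A ** Q\<close> is symmetric, so \<open>A ** Q\<close> is symmetric
    too, which is commutation.\<close>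
  have AQ: "A ** Q = Q ** A"
  proof -
    have "transpose (Q ** A ** Q) = Q ** A ** Q"
      by (simp add: matrix_transpose_mul Q(1) tA matrix_mul_assoc)
    then show ?thesis using QAQ by (simp add: matrix_transpose_mul Q(1) tA)
  qed
  have DQ: "D ** Q = 0" by (simp add: D_eq Q(2) flip: matrix_mul_assoc)
  have QD: "Q ** D = 0"
  proof -
    have "transpose (D ** Q) = Q ** D" by (simp add: matrix_transpose_mul Q(1) tD)
    then show ?thesis by (simp add: DQ transpose_def vec_eq_iff)
  qed
  have sub_l: "(X - Y) ** Z = X ** Z - Y ** Z" and sub_r: "Z ** (X - Y) = Z ** X - Z ** Y"
    for X Y Z :: "real^'n^'n"
    by (simp_all add: matrix_matrix_mult_def vec_eq_iff left_diff_distrib right_diff_distrib sum_subtractf)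
  have tP: "transpose P = P" using Q(1) by (simp add: P_def transpose_def mat_def vec_eq_iff)
  have AP: "A ** P = P ** A" by (simp add: P_def sub_l sub_r AQ)
  define D' where "D' = D + Q"
  \<comment> \<open>Adding \<open>Q\<close> changes the damping only on the kernel of
    \<open>C\<close>, which \<open>P\<close> annihilates.\<close>
  have D'P: "D' ** P = P ** D"
    by (simp add: D'_def P_def sub_l sub_r matrix_mult_add_left QQ DQ QD)
  have tD': "transpose D' = D'" using Q(1) tD by (simp add: D'_def transpose_def vec_eq_iff)
  \<comment> \<open>Where the form vanishes, \<open>R\<close> annihilates \<open>C *v x\<close>, so
    \<open>C *v x = 0\<close> by full rank; then \<open>Q\<close> fixes \<open>x\<close> but also
    annihilates it.\<close>
  have pos: "0 < x \<bullet> (D' *v x)" if "x \<noteq> 0" for x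
  proof -
    have "x \<bullet> (D *v x) = (C *v x) \<bullet> (R *v (C *v x))"
      by (simp add: D_eq flip: matrix_vector_mul_assoc)
        (metis dot_lmul_matrix transpose_matrix_vector transpose_transpose)
    moreover have "x \<bullet> (Q *v x) = (Q *v x) \<bullet> (Q *v x)"
      using symmetric_dot[OF Q(1), of x "Q *v x"] by (simp add: matrix_vector_mul_assoc QQ)
    ultimately have eq: "x \<bullet> (D' *v x) = (C *v x) \<bullet> (R *v (C *v x)) + (Q *v x) \<bullet> (Q *v x)"
      by (simp add: D'_def matrix_vector_mult_add_rdistrib inner_add_right)
    have R0: "0 \<le> y \<bullet> (R *v y)" for y using R by (simp add: symmetric_psd_def)
    have "x \<bullet> (D' *v x) \<noteq> 0"
    proof
      assume "x \<bullet> (D' *v x) = 0"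
      then have "(C *v x) \<bullet> (R *v (C *v x)) = 0" "(Q *v x) \<bullet> (Q *v x) = 0"
        using eq R0[of "C *v x"] inner_ge_zero[of "Q *v x"] by linarith+
      then have "R *v (C *v x) = R *v 0" "Q *v x = 0" using psd_null[OF R] by auto
      moreover have "inj ((*v) R)" using rank by (simp flip: full_rank_injective)
      ultimately have "C *v x = 0" by (metis injD)
      with Q(3) \<open>Q *v x = 0\<close> \<open>x \<noteq> 0\<close> show False by simp
    qed
    then show ?thesis using eq R0[of "C *v x"] inner_ge_zero[of "Q *v x"] by linarith
  qed
  have D'_psd: "symmetric_psd D'"
    using tD' pos by (auto simp: symmetric_psd_def) (metis inner_zero_left less_eq_real_def)
  interpret W: wave "jN :: 'v^'n \<Rightarrow> 'h^'n" "mat_form A (\<bullet>)" "mat_form D gform"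
    by (rule wave_system[OF A D])
  interpret W': wave "jN :: 'v^'n \<Rightarrow> 'h^'n" "mat_form A (\<bullet>)" "mat_form D' gform"
    by (rule wave_system[OF A D'_psd])
  have linj: "linear (blinfun_apply j)" by (rule bounded_linear.linear[OF blinfun.bounded_linear_right])
  have lini: "linear (\<lambda>u. u \<bullet> w)" "linear ((\<bullet>) w)" for w :: 'h
    by (simp_all add: bounded_linear.linear[OF bounded_linear_inner_left] bounded_linear.linear[OF bounded_linear_inner_right])
  have ling: "linear (\<lambda>u. gform u w)" "linear (gform w)" for w
    by (auto intro!: linearI simp: blinfun.bilinear_simps)
  have graph: "(pair_act P x, pair_act P a) \<in> W'.wave_op" if "(x, a) \<in> W.wave_op" for x a
  proof -
    obtain U Z F where *: "x = (U, jN Z)" "a = (Z, - F)"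
      "\<And>\<phi>. U \<bullet> \<phi> + mat_form A (\<bullet>) (jN U) (jN \<phi>) + mat_form D gform Z \<phi> = F \<bullet> jN \<phi>"
      using W.wave_opE[OF \<open>(x, a) \<in> W.wave_op\<close>] by blast
    have "((mat_act P U, jN (mat_act P Z)), (mat_act P Z, - mat_act P F)) \<in> W'.wave_op"
    proof (rule W'.wave_opI)
      fix \<phi>
      have "mat_form A (\<bullet>) (jN (mat_act P U)) (jN \<phi>) = mat_form A (\<bullet>) (jN U) (jN (mat_act P \<phi>))"
        by (simp add: mat_act_componentwise[OF linj] mat_form_mat_act_left[OF lini(1)]
            mat_form_mat_act_right[OF lini(2)] tP AP)
      moreover have "mat_form D' gform (mat_act P Z) \<phi> = mat_form D gform Z (mat_act P \<phi>)"
        by (simp add: mat_form_mat_act_left[OF ling(1)] mat_form_mat_act_right[OF ling(2)] tP D'P)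
      ultimately show "mat_act P U \<bullet> \<phi> + mat_form A (\<bullet>) (jN (mat_act P U)) (jN \<phi>)
          + mat_form D' gform (mat_act P Z) \<phi> = mat_act P F \<bullet> jN \<phi>"
        using *(3)[of "mat_act P \<phi>"] by (simp add: mat_act_symmetric_inner[OF tP] mat_act_componentwise[OF linj])
    qed
    moreover have "mat_act P (- F) = - mat_act P F"
      using linear_neg[OF bounded_linear.linear[OF bounded_linear_mat_act]] by blast
    ultimately show ?thesis by (simp add: * pair_act_def mat_act_componentwise[OF linj])
  qed
  have PF: "pair_act P (W.flow t x) = W'.flow t (pair_act P x)" if "t \<ge> 0" for t x
    by (rule flow_intertwine[OF W.dissipative_wave_op W'.dissipative_wave_op bounded_linear_pair_act graph that])
  have "C ** P = C"
    by (simp add: matrix_eq P_def CQx matrix_vector_mult_diff_rdistrib matrix_vector_mult_diff_distrib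
        flip: matrix_vector_mul_assoc)
  then have CP: "pair_act C x = pair_act C (pair_act P x)" for x :: "('v^'n) \<times> ('h^'n)"
    by (simp add: pair_act_mult)
  obtain M \<omega> where M: "1 \<le> M" "0 < \<omega>" "\<And>t x. t \<ge> 0 \<Longrightarrow> norm (W'.flow t x) \<le> M * exp (- \<omega> * t) * norm x"
    using positive_definite_decay[OF stable A tD' pos] by blast
  obtain K where K: "K > 0" "\<And>x :: ('v^'n) \<times> ('h^'n). norm (pair_act C x) \<le> norm x * K"
    using bounded_linear.pos_bounded[OF bounded_linear_pair_act] by blast
  obtain L where L: "L > 0" "\<And>x :: ('v^'m) \<times> ('h^'m). norm (pair_act B x) \<le> norm x * L"
    using bounded_linear.pos_bounded[OF bounded_linear_pair_act] by blast
  \<comment> \<open>\<open>C ** P = C\<close> passes to the stable system, and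
    \<open>P = B ** C\<close> leads back to \<open>C\<close> applied to the initial state.\<close>
  have est: "norm (pair_act C (W.flow t x)) \<le> max 1 (K * M * L) * exp (- \<omega> * t) * norm (pair_act C x)"
    if t: "t \<ge> 0" for t x
  proof -
    have "norm (pair_act C (W.flow t x)) \<le> norm (W'.flow t (pair_act P x)) * K"
      unfolding CP[of "W.flow t x"] PF[OF t] by (rule K(2))
    also have "\<dots> \<le> (M * exp (- \<omega> * t) * norm (pair_act P x)) * K"
      using K(1) M(3)[OF t] by (intro mult_right_mono) auto
    also have "\<dots> \<le> (M * exp (- \<omega> * t) * (norm (pair_act C x) * L)) * K"
      using K(1) M(1) L(2)[of "pair_act C x"] unfolding pair_act_mult B[symmetric]
      by (intro mult_right_mono mult_left_mono) auto
    also have "\<dots> = (K * M * L) * exp (- \<omega> * t) * norm (pair_act C x)" by simp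
    also have "\<dots> \<le> max 1 (K * M * L) * exp (- \<omega> * t) * norm (pair_act C x)"
      by (intro mult_right_mono) auto
    finally show ?thesis .
  qed
  show ?thesis
    unfolding uniformly_synchronizable_def
  proof (rule exI[of _ "max 1 (K * M * L)"], rule exI[of _ \<omega>], intro conjI allI)
    fix U0 :: "'v^'n" and U1 :: "'h^'n"
    show "\<exists>U U'. mild_solution j g A D U0 U1 U U' \<and> (\<forall>t\<ge>0. norm (mat_act C (U t), mat_act C (U' t))
        \<le> max 1 (K * M * L) * exp (- \<omega> * t) * norm (mat_act C U0, mat_act C U1))"
    proof (intro exI conjI)
      show "mild_solution j g A D U0 U1 (\<lambda>t. fst (W.flow t (U0, U1))) (\<lambda>t. snd (W.flow t (U0, U1)))"
        by (rule wave_mild_solution[OF A D])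
      show "\<forall>t\<ge>0. norm (mat_act C (fst (W.flow t (U0, U1))), mat_act C (snd (W.flow t (U0, U1))))
        \<le> max 1 (K * M * L) * exp (- \<omega> * t) * norm (mat_act C U0, mat_act C U1)"
        using est[of _ "(U0, U1)"] by (simp add: pair_act_def)
    qed
  qed (use M in auto)
qed

end

theorem theorem3p8:
  fixes j :: "'v::{real_inner,banach} \<Rightarrow>\<^sub>L 'h::{real_inner,banach}"
    and g :: "'v \<Rightarrow>\<^sub>L 'v \<Rightarrow>\<^sub>L real"
    and p :: nat
    and n :: "nat \<Rightarrow> nat"
    and A D :: "real^('n::{finite,linorder})^('n::{finite,linorder})"
    and C :: "real^('n::{finite,linorder})^('m::{finite,linorder})"
    and R :: "real^('m::{finite,linorder})^('m::{finite,linorder})"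
  assumes "hilbert_triple j"
    and "symmetric_nonneg_op g"
    and "1 \<le> p"
    and "group_division p n CARD('n)"
    and "CARD('m) = CARD('n) - p"
    and "C = sync_matrix p n"
    and "symmetric_psd A"
    and "symmetric_psd D"
    and "(*v) A ` matrix_ker C \<subseteq> matrix_ker C"
    and "symmetric_psd R"
    and "rank R = CARD('n) - p"
    and "D = transpose C ** R ** C"
    and "uniformly_stable j g"
  shows "uniformly_synchronizable j g A D C"
proof -
  have "hilbert_system j g" by (rule hilbert_system.intro) fact+
  then show ?thesis
    by (rule hilbert_system.synchronizable) (use assms in simp_all)
qed

end
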